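(* Let $(T_n)_{n\ge1}$ be a positively divergent perturbed random walk and $p>0$. The following conditions are equivalent: (1) $\mathbb{E}N(x)^p<\infty$ for some/all $x\in\mathbb{R}$; (2) $\mathbb{E}N^*(x)^p<\infty$ for some/all $x\ge0$; (3) $\mathbb{E}J_+(\xi^-)^{p+1}<\infty$.
   Context: Let $(\xi,\eta),(\xi_1,\eta_1),(\xi_2,\eta_2),\ldots$ be i.i.d. $\mathbb{R}^2$-valued random vectors; no condition is imposed on the dependence between $\xi$ and $\eta$. Put $S_0:=0$, $S_n:=\xi_1+\cdots+\xi_n$ for $n\in\mathbb{N}=\{1,2,\ldots\}$, and $T_n:=S_{n-1}+\eta_n$ for $n\in\mathbb{N}$; $(T_n)_{n\ge1}$ is called a perturbed random walk. Standing assumption: $\mathbb{P}\{\xi=0\}<1$ and $\mathbb{P}\{\eta=0\}<1$. The perturbed random walk is called positively divergent if $\lim_{n\to\infty}T_n=\infty$ a.s. For $x\in\mathbb{R}$, $N(x):=\#\{n\in\mathbb{N}:T_n\le x\}$ and $N^*(x):=\#\{n\in\mathbb{N}_0:S_n\le x\}$, where $\mathbb{N}_0=\{0,1,2,\ldots\}$. Write $\xi^+:=\max(\xi,0)$, $\xi^-:=\max(-\xi,0)$. For $x>0$ let $A_+(x):=\int_0^x\mathbb{P}\{\xi>y\}\,dy=\mathbb{E}\min(\xi^+,x)$ and $J_+(x):=x/A_+(x)$, and let $J_+(0):=1/\mathbb{P}\{\xi>0\}$ (these are well defined whenever $\mathbb{P}\{\xi>0\}>0$, which is the case for a positively divergent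 perturbed random walk). $J_+(\cdot)^{p+1}$ denotes the $(p+1)$st power of $J_+(\cdot)$ (inside the expectation), and similarly for $N(x)^p$, $N^*(x)^p$. An assertion "for some/all $x$" in a list of equivalent assertions means that both the version with "for some $x$" and the version with "for all $x$" belong to the list of equivalent assertions. *)

theory Defs
  imports "HOL-Probability.Probability"
begin

(* Index 0 carries the generic copy: (\<xi> 0, \<eta> 0) stands for (\<xi>, \<eta>), and the walk uses only
   the indices n \<ge> 1. Independence is across n; the two components may depend on each other. *)
locale perturbed_random_walk = prob_space M for M :: "'a measure" +
  fixes \<xi> \<eta> :: "nat \<Rightarrow> 'a \<Rightarrow> real"
  assumes indep: "indep_vars (\<lambda>_. borel :: (real \<times> real) measure) (\<lambda>n \<omega>. (\<xi> n \<omega>, \<eta> n \<omega>)) UNIV"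
    and ident: "\<And>n. distr M (borel :: (real \<times> real) measure) (\<lambda>\<omega>. (\<xi> n \<omega>, \<eta> n \<omega>))
                   = distr M borel (\<lambda>\<omega>. (\<xi> 0 \<omega>, \<eta> 0 \<omega>))"
    and xi_nonzero: "prob {\<omega> \<in> space M. \<xi> 0 \<omega> = 0} < 1"
    and eta_nonzero: "prob {\<omega> \<in> space M. \<eta> 0 \<omega> = 0} < 1"

definition walk :: "(nat \<Rightarrow> 'a \<Rightarrow> real) \<Rightarrow> nat \<Rightarrow> 'a \<Rightarrow> real" where
  "walk \<xi> n \<omega> = (\<Sum>k = 1..n. \<xi> k \<omega>)"

(* Meant for n \<ge> 1; the value at n = 0 is irrelevant. *)
definition pwalk :: "(nat \<Rightarrow> 'a \<Rightarrow> real) \<Rightarrow> (nat \<Rightarrow> 'a \<Rightarrow> real) \<Rightarrow> nat \<Rightarrow> 'a \<Rightarrow> real" where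
  "pwalk \<xi> \<eta> n \<omega> = walk \<xi> (n - 1) \<omega> + \<eta> n \<omega>"

definition positively_divergent ::
  "'a measure \<Rightarrow> (nat \<Rightarrow> 'a \<Rightarrow> real) \<Rightarrow> (nat \<Rightarrow> 'a \<Rightarrow> real) \<Rightarrow> bool" where
  "positively_divergent M \<xi> \<eta> \<longleftrightarrow>
     (AE \<omega> in M. filterlim (\<lambda>n. pwalk \<xi> \<eta> n \<omega>) at_top sequentially)"

(* Counting measure rather than card, so that infinite sets are counted as \<infinity> and not as 0. *)
definition N_pwalk ::
  "(nat \<Rightarrow> 'a \<Rightarrow> real) \<Rightarrow> (nat \<Rightarrow> 'a \<Rightarrow> real) \<Rightarrow> real \<Rightarrow> 'a \<Rightarrow> ennreal" where
  "N_pwalk \<xi> \<eta> x \<omega> = emeasure (count_space UNIV) {n. n \<ge> 1 \<and> pwalk \<xi> \<eta> n \<omega> \<le> x}"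

definition N_walk :: "(nat \<Rightarrow> 'a \<Rightarrow> real) \<Rightarrow> real \<Rightarrow> 'a \<Rightarrow> ennreal" where
  "N_walk \<xi> x \<omega> = emeasure (count_space UNIV) {n. walk \<xi> n \<omega> \<le> x}"

(* Real powers on [0, \<infinity>], for exponents p > 0 only. *)
definition ennreal_powr :: "ennreal \<Rightarrow> real \<Rightarrow> ennreal" where
  "ennreal_powr z p = (if z = \<infinity> then \<infinity> else ennreal (enn2real z powr p))"

definition A_plus :: "'a measure \<Rightarrow> ('a \<Rightarrow> real) \<Rightarrow> real \<Rightarrow> real" where
  "A_plus M X x = (LINT y:{0..x}|lborel. measure M {\<omega> \<in> space M. X \<omega> > y})"

(* Meant for x \<ge> 0 and P(X > 0) > 0, in which case no denominator vanishes. *)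
definition J_plus :: "'a measure \<Rightarrow> ('a \<Rightarrow> real) \<Rightarrow> real \<Rightarrow> real" where
  "J_plus M X x =
     (if x = 0 then 1 / measure M {\<omega> \<in> space M. X \<omega> > 0} else x / A_plus M X x)"

end

(* Both counts are studied through their dyadic tails: with r = 2 powr p, the p-th moment of Z is
   finite iff the sum of r^i P(Z >= 2^i) is.  Write N for the count of T and N* for that of S.
   - S diverges because T does: at the first visit of S below c after time m, the independent
     perturbation is at most C with probability at least 1/2.
   - N* controls N: apart from the visits of S itself, N counts hits n with S_{n-1} > 0 and
     T_n <= x.  By the Markov property at the first positive position after n hits, their number D
     satisfies P(D >= 2n) <= P(D >= n) P(N >= n), so D has all moments.
   - N controls N*: most perturbations met at the visits number n+1, ..., 2n of S are at most C, so
     P(N* >= 2n) <= P(N >= n/2) + 2 delta P(N* >= n) with delta = P(eta > C) small.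
   - N* controls J_+(xi^-): with conditional probability bounded below, a step k <= n with
     J_+(xi_k^-) > 16 n keeps S low up to time 2n.
   - J_+(xi^-) controls N*: if S_k <= a for some m <= k < 2m, remove the step with the largest
     negative part x among the first 2m.  The other steps, truncated at level x, have drift of order
     A_+(x), so an exponential supermartingale bounds the probability of staying below 2x by
     C exp(-kappa m / J_+(x)).  As there are 2m candidates for the removed step, the block has
     probability at most 2 m C E exp(-kappa m / J_+(xi^-)), and summing m^p times this over dyadic m
     yields E J_+(xi^-)^(p+1). *)

theory Submission
  imports Defs
begin

section \<open>Moments, dyadic tails and sequence spaces\<close>

text \<open>The two components of one pair may depend on each other; what is available is that the
  perturbation added at a time is independent of the position of S at that time. Hence the
  comparisons are made at times recognised from the past alone, on the product space of the i.i.d.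
  pairs, where the Markov property is the splitting of a sequence at an index. Dyadic tails are used
  because these arguments relate the tail at 2n to the tail at n: with weights r^i such an
  inequality is a contraction as soon as its factor is below 1/r, which the decay of a tail or the
  choice of C provides. The level is lost on the way: the passage from T to S yields a finite moment
  only at some level x - C, possibly negative. It is regained through J_+, since finiteness at any
  single level gives the moment of J_+, and that moment gives finiteness at every level. Divergence
  enters the last step quantitatively: truncated at a high level x, the negative part of
  \<open>\<xi>\<close> has mean at most (1 - c) A_+(x). When A_+ is bounded this amounts to a
  positive mean of \<open>\<xi>\<close>, which Lindley's recursion provides.\<close>

lemma summable_of_contraction:
  fixes u v :: "nat \<Rightarrow> real"
  assumes u: "\<And>i. 0 \<le> u i" and v: "\<And>i. 0 \<le> v i" "summable v"
    and c: "0 \<le> c" "c < 1"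
    and step: "\<And>i. i \<ge> k \<Longrightarrow> u (Suc i) \<le> v i + c * u i"
  shows "summable u"
proof -
  \<comment> \<open>The partial sum U is bounded by u k + suminf v + c * U with the same U on both
    sides; since c < 1 it is at most (suminf v + u k) / (1 - c).\<close>
  have "summable (\<lambda>i. u (i + k))"
  proof (rule bounded_imp_summable)
    fix n
    let ?U = "\<Sum>i\<le>n. u (i + k)" and ?V = "suminf v + u k"
    have "?U \<le> (\<Sum>i\<le>Suc n. u (i + k))" using u by simp
    also have "\<dots> = u k + (\<Sum>i\<le>n. u (Suc (i + k)))"
      by (subst sum.atMost_Suc_shift) simp
    also have "(\<Sum>i\<le>n. u (Suc (i + k))) \<le> (\<Sum>i\<le>n. v (i + k) + c * u (i + k))"
      by (intro sum_mono step) simp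
    also have "\<dots> = (\<Sum>i\<le>n. v (i + k)) + c * ?U"
      by (simp add: sum.distrib sum_distrib_left)
    also have "(\<Sum>i\<le>n. v (i + k)) = (\<Sum>j\<in>(\<lambda>i. i + k) ` {..n}. v j)"
      by (subst sum.reindex) auto
    also have "\<dots> \<le> suminf v" by (intro sum_le_suminf v) auto
    finally have "?U * (1 - c) \<le> ?V" by (simp add: algebra_simps)
    then show "?U \<le> ?V / (1 - c)" using c by (simp add: field_simps)
  qed (use u in auto)
  then show ?thesis by (simp add: summable_iff_shift)
qed

lemma suminf_ennreal_less_top_iff:
  fixes f :: "nat \<Rightarrow> real"
  assumes "\<And>i. 0 \<le> f i"
  shows "(\<Sum>i. ennreal (f i)) < \<infinity> \<longleftrightarrow> summable f"
proof
  assume "(\<Sum>i. ennreal (f i)) < \<infinity>"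
  then show "summable f" by (intro summable_suminf_not_top assms) auto
next
  assume "summable f"
  then have "(\<Sum>i. ennreal (f i)) = ennreal (suminf f)" by (intro suminf_ennreal2 assms)
  then show "(\<Sum>i. ennreal (f i)) < \<infinity>" by simp
qed

lemma ennreal_powr_measurable [measurable]:
  "(\<lambda>z. ennreal_powr z p) \<in> borel_measurable borel"
  unfolding ennreal_powr_def by measurable

lemma ennreal_powr_ennreal: "t \<ge> 0 \<Longrightarrow> ennreal_powr (ennreal t) p = ennreal (t powr p)"
  by (simp add: ennreal_powr_def)

lemma pow2_le_ennreal_iff: "t \<ge> 0 \<Longrightarrow> (2 ^ i \<le> ennreal t) = (2 ^ i \<le> t)"
proof -
  assume "t \<ge> 0"
  have "(2 ^ i :: ennreal) = ennreal (2 ^ i)"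
    by (simp flip: ennreal_power)
  then show ?thesis using \<open>t \<ge> 0\<close> by (simp add: ennreal_le_iff)
qed

lemma dyadic_index:
  fixes t :: real assumes "t \<ge> 1"
  obtains j :: nat where "2 ^ j \<le> t" "t < 2 ^ Suc j" "\<And>i. 2 ^ i \<le> t \<longleftrightarrow> i \<le> j"
proof -
  define m where "m = nat \<lfloor>t\<rfloor>"
  have "m \<ge> 1" using assms by (simp add: m_def le_nat_floor)
  then obtain j where j: "2 ^ j \<le> m" "m < 2 ^ (j + 1)"
    using ex_power_ivl1[of 2 m] by auto
  have 1: "2 ^ j \<le> t"
  proof -
    have "(2 ^ j :: real) = real (2 ^ j)" by simp
    also have "\<dots> \<le> real m" using j(1) by (intro of_nat_mono)
    also have "\<dots> \<le> t" using assms by (simp add: m_def)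
    finally show ?thesis .
  qed
  have 2: "t < 2 ^ Suc j"
  proof -
    have "t < real m + 1" using assms unfolding m_def by linarith
    also have "\<dots> = real (Suc m)" by simp
    also have "\<dots> \<le> real (2 ^ (j + 1))" using j(2) by (intro of_nat_mono) simp
    finally show ?thesis by simp
  qed
  have 3: "2 ^ i \<le> t \<longleftrightarrow> i \<le> j" for i
  proof
    assume "2 ^ i \<le> t"
    then have "(2::real) ^ i < 2 ^ Suc j" using 2 by linarith
    then show "i \<le> j" by (subst (asm) power_strict_increasing_iff) auto
  next
    assume "i \<le> j"
    then have "(2::real) ^ i \<le> 2 ^ j" by (intro power_increasing) auto
    then show "2 ^ i \<le> t" using 1 by linarith
  qed
  show ?thesis using that[OF 1 2 3] .
qed

lemma pow2_powr: "(2 ^ j :: real) powr p = (2 powr p) ^ j"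
  by (simp add: powr_powr mult.commute flip: powr_realpow)

text \<open>For finite z >= 1 the indices with 2^i <= z are exactly those up to the dyadic exponent
  of z, and a geometric sum with ratio r > 1 is at most r / (r - 1) times its last term.\<close>

lemma dyadic_suminf_le_powr:
  assumes p: "p > 0"
  defines "r \<equiv> 2 powr p"
  shows "(\<Sum>i. ennreal (r ^ i) * indicator {i. 2 ^ i \<le> z} i)
           \<le> ennreal (r / (r - 1)) * ennreal_powr z p"
proof -
  have r: "r > 1" using p by (simp add: r_def)
  show ?thesis
  proof (cases z)
    case (real t)
    note [simp] = pow2_le_ennreal_iff[OF \<open>0 \<le> t\<close>] real
    show ?thesis
    proof (cases "t < 1")
      case True
      have "\<not> (2 ^ i \<le> t)" for i
        using True one_le_power[of "2::real" i] by linarith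
      then show ?thesis by simp
    next
      case False
      then obtain j where j: "2 ^ j \<le> t" "t < 2 ^ Suc j" "\<And>i. 2 ^ i \<le> t \<longleftrightarrow> i \<le> j"
        using dyadic_index[of t] by auto
      have "(\<Sum>i. ennreal (r ^ i) * indicator {i. 2 ^ i \<le> z} i)
              = (\<Sum>i\<le>j. ennreal (r ^ i) * indicator {i. 2 ^ i \<le> z} i)"
        by (intro suminf_finite) (auto simp: j(3))
      also have "\<dots> = ennreal (\<Sum>i\<le>j. r ^ i)"
        using r by (subst sum_ennreal[symmetric]) (auto simp: j(3))
      also have "\<dots> \<le> ennreal (r / (r - 1) * t powr p)"
      proof (rule ennreal_leI)
        have "(\<Sum>i\<le>j. r ^ i) = (r ^ Suc j - 1) / (r - 1)"
          using r geometric_sum[of r "Suc j"] by (simp add: lessThan_Suc_atMost)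
        also have "\<dots> \<le> r / (r - 1) * r ^ j"
          using r by (simp add: field_simps)
        also have "r ^ j \<le> t powr p"
          unfolding r_def pow2_powr[symmetric] using j(1) p by (intro powr_mono2) auto
        finally show "(\<Sum>i\<le>j. r ^ i) \<le> r / (r - 1) * t powr p"
          using r by (simp add: mult_left_mono divide_right_mono)
      qed
      finally have "(\<Sum>i. ennreal (r ^ i) * indicator {i. 2 ^ i \<le> z} i) \<le> ennreal (r / (r - 1) * t powr p)" .
      then show ?thesis
        using r by (simp add: ennreal_powr_ennreal ennreal_mult[symmetric])
    qed
  next
    case top
    then show ?thesis using r by (simp add: ennreal_powr_def ennreal_mult_top)
  qed
qed

text \<open>If j is the last index then z < 2^(j+1), so z^p is at most r times the last term. The
  summand 1 takes care of z < 1, where the sum is empty; for infinite z the series diverges.\<close>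

lemma powr_le_dyadic_suminf:
  assumes p: "p > 0"
  defines "r \<equiv> 2 powr p"
  shows "ennreal_powr z p
           \<le> 1 + ennreal r * (\<Sum>i. ennreal (r ^ i) * indicator {i. 2 ^ i \<le> z} i)"
proof -
  have r: "r > 1" using p by (simp add: r_def)
  show ?thesis
  proof (cases z)
    case (real t)
    note [simp] = pow2_le_ennreal_iff[OF \<open>0 \<le> t\<close>] real
    show ?thesis
    proof (cases "t < 1")
      case True
      then have "t powr p \<le> 1" using real p powr_mono2[of p t 1] by simp
      then have "ennreal_powr z p \<le> 1" using real by (simp add: ennreal_powr_ennreal)
      then show ?thesis by (meson add_increasing2 order_trans zero_le order_refl)
    next
      case False
      then obtain j where j: "2 ^ j \<le> t" "t < 2 ^ Suc j" "\<And>i. 2 ^ i \<le> t \<longleftrightarrow> i \<le> j"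
        using dyadic_index[of t] by auto
      have "t powr p \<le> (2 ^ Suc j) powr p" using j(2) p real by (intro powr_mono2) auto
      also have "\<dots> = r * r ^ j" unfolding pow2_powr r_def by simp
      finally have "ennreal_powr z p \<le> ennreal r * ennreal (r ^ j)"
        using r by (simp add: ennreal_powr_ennreal ennreal_mult[symmetric] ennreal_leI)
      also have "ennreal (r ^ j) = (\<Sum>i\<in>{j}. ennreal (r ^ i) * indicator {i. 2 ^ i \<le> z} i)"
        by (simp add: j(3))
      also have "\<dots> \<le> (\<Sum>i. ennreal (r ^ i) * indicator {i. 2 ^ i \<le> z} i)"
        by (intro sum_le_suminf) auto
      finally show ?thesis
        by (meson add_increasing mult_left_mono order_trans zero_le order_refl)
    qed
  next
    case top
    have "\<not> summable (\<lambda>i. r ^ i)"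
      using r by (simp add: summable_geometric_iff)
    moreover have "\<And>i. 0 \<le> r ^ i" using r by simp
    ultimately have "\<not> (\<Sum>i. ennreal (r ^ i)) < \<infinity>"
      by (subst suminf_ennreal_less_top_iff)
    then have "(\<Sum>i. ennreal (r ^ i)) = \<infinity>"
      unfolding infinity_ennreal_def top.not_eq_extremum[symmetric] by (rule notnotD)
    then show ?thesis using r top by (simp add: ennreal_mult_top)
  qed
qed

text \<open>Integrating the two comparisons termwise replaces a moment by a weighted series of
  tails, the form in which doubling inequalities can be summed.\<close>

lemma (in prob_space) powr_moment_finite_iff:
  fixes Z :: "'a \<Rightarrow> ennreal"
  assumes Z [measurable]: "Z \<in> borel_measurable M" and p: "p > 0"
  shows "(\<integral>\<^sup>+\<omega>. ennreal_powr (Z \<omega>) p \<partial>M) < \<infinity> \<longleftrightarrow>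
           summable (\<lambda>i. (2 powr p) ^ i * prob {\<omega> \<in> space M. 2 ^ i \<le> Z \<omega>})"
proof -
  define r where "r = 2 powr p"
  have r: "r > 1" using p by (simp add: r_def)
  define D where "D z = (\<Sum>i. ennreal (r ^ i) * indicator {i. 2 ^ i \<le> z} i)" for z :: ennreal
  have "(\<integral>\<^sup>+\<omega>. D (Z \<omega>) \<partial>M)
      = (\<integral>\<^sup>+\<omega>. (\<Sum>i. ennreal (r ^ i) * indicator {\<omega> \<in> space M. 2 ^ i \<le> Z \<omega>} \<omega>) \<partial>M)"
    unfolding D_def by (intro nn_integral_cong suminf_cong) (auto split: split_indicator)
  also have "\<dots> = (\<Sum>i. \<integral>\<^sup>+\<omega>. ennreal (r ^ i) * indicator {\<omega> \<in> space M. 2 ^ i \<le> Z \<omega>} \<omega> \<partial>M)"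
    by (intro nn_integral_suminf) measurable
  also have "\<dots> = (\<Sum>i. ennreal (r ^ i * prob {\<omega> \<in> space M. 2 ^ i \<le> Z \<omega>}))"
    using r by (intro suminf_cong, subst nn_integral_cmult_indicator)
       (auto simp: emeasure_eq_measure ennreal_mult[symmetric])
  finally have D: "(\<integral>\<^sup>+\<omega>. D (Z \<omega>) \<partial>M) = (\<Sum>i. ennreal (r ^ i * prob {\<omega> \<in> space M. 2 ^ i \<le> Z \<omega>}))" .
  have [measurable]: "D \<in> borel_measurable borel"
  proof -
    have "D = (\<lambda>z. \<Sum>i. ennreal (r ^ i) * indicator {z. 2 ^ i \<le> z} z)"
      unfolding D_def by (auto simp: indicator_def)
    then show ?thesis by simp
  qed
  have fin: "(\<integral>\<^sup>+\<omega>. D (Z \<omega>) \<partial>M) < \<infinity> \<longleftrightarrow>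
      summable (\<lambda>i. r ^ i * prob {\<omega> \<in> space M. 2 ^ i \<le> Z \<omega>})"
    unfolding D using r
    by (subst suminf_ennreal_less_top_iff) auto
  have "(\<integral>\<^sup>+\<omega>. ennreal_powr (Z \<omega>) p \<partial>M) < \<infinity> \<longleftrightarrow> (\<integral>\<^sup>+\<omega>. D (Z \<omega>) \<partial>M) < \<infinity>"
  proof
    assume *: "(\<integral>\<^sup>+\<omega>. ennreal_powr (Z \<omega>) p \<partial>M) < \<infinity>"
    have "(\<integral>\<^sup>+\<omega>. D (Z \<omega>) \<partial>M) \<le> (\<integral>\<^sup>+\<omega>. ennreal (r / (r - 1)) * ennreal_powr (Z \<omega>) p \<partial>M)"
      unfolding D_def r_def by (intro nn_integral_mono dyadic_suminf_le_powr p)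
    also have "\<dots> = ennreal (r / (r - 1)) * (\<integral>\<^sup>+\<omega>. ennreal_powr (Z \<omega>) p \<partial>M)"
      by (intro nn_integral_cmult) measurable
    also have "\<dots> < \<infinity>" using * by (simp add: ennreal_mult_less_top)
    finally show "(\<integral>\<^sup>+\<omega>. D (Z \<omega>) \<partial>M) < \<infinity>" .
  next
    assume *: "(\<integral>\<^sup>+\<omega>. D (Z \<omega>) \<partial>M) < \<infinity>"
    have "(\<integral>\<^sup>+\<omega>. ennreal_powr (Z \<omega>) p \<partial>M) \<le> (\<integral>\<^sup>+\<omega>. 1 + ennreal r * D (Z \<omega>) \<partial>M)"
      unfolding D_def r_def by (intro nn_integral_mono powr_le_dyadic_suminf p)
    also have "\<dots> = 1 + ennreal r * (\<integral>\<^sup>+\<omega>. D (Z \<omega>) \<partial>M)"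
      by (subst nn_integral_add) (auto simp: nn_integral_cmult emeasure_space_1)
    also have "\<dots> < \<infinity>" using * by (simp add: ennreal_mult_less_top)
    finally show "(\<integral>\<^sup>+\<omega>. ennreal_powr (Z \<omega>) p \<partial>M) < \<infinity>" .
  qed
  with fin show ?thesis by (simp add: r_def)
qed

section \<open>Product measures on sequences: first coordinate, Markov property, reindexing, maximal
  inequality\<close>

context sequence_space
begin

lemma nn_integral_case_nat:
  assumes [measurable]: "f \<in> borel_measurable S"
  shows "(\<integral>\<^sup>+\<omega>. f \<omega> \<partial>S) = (\<integral>\<^sup>+z. \<integral>\<^sup>+\<omega>. f (case_nat z \<omega>) \<partial>S \<partial>M)"
proof -
  have "(\<integral>\<^sup>+\<omega>. f \<omega> \<partial>S) = (\<integral>\<^sup>+\<omega>. f \<omega> \<partial>distr (M \<Otimes>\<^sub>M S) S (\<lambda>(s, \<omega>). case_nat s \<omega>))"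
    by (simp only: PiM_iter)
  also have "\<dots> = (\<integral>\<^sup>+x. f (case x of (s, \<omega>) \<Rightarrow> case_nat s \<omega>) \<partial>(M \<Otimes>\<^sub>M S))"
    by (intro nn_integral_distr) measurable
  also have "\<dots> = (\<integral>\<^sup>+z. \<integral>\<^sup>+\<omega>. f (case_nat z \<omega>) \<partial>S \<partial>M)"
    by (subst P.nn_integral_fst[symmetric]) auto
  finally show ?thesis .
qed

lemma emeasure_case_nat:
  assumes [measurable]: "Measurable.pred S Q"
  shows "emeasure S {\<omega>\<in>space S. Q \<omega>}
       = (\<integral>\<^sup>+z. emeasure S {\<omega>\<in>space S. Q (case_nat z \<omega>)} \<partial>M)"
proof -
  have "emeasure S {\<omega>\<in>space S. Q \<omega>} = (\<integral>\<^sup>+\<omega>. indicator {\<omega>\<in>space S. Q \<omega>} \<omega> \<partial>S)"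
    by simp
  also have "\<dots> = (\<integral>\<^sup>+z. \<integral>\<^sup>+\<omega>. indicator {\<omega>\<in>space S. Q \<omega>} (case_nat z \<omega>) \<partial>S \<partial>M)"
    by (rule nn_integral_case_nat) measurable
  also have "\<dots> = (\<integral>\<^sup>+z. \<integral>\<^sup>+\<omega>. indicator {\<omega>\<in>space S. Q (case_nat z \<omega>)} \<omega> \<partial>S \<partial>M)"
    by (intro nn_integral_cong)
      (auto simp: indicator_def space_PiM PiE_iff split: nat.split)
  also have "\<dots> = (\<integral>\<^sup>+z. emeasure S {\<omega>\<in>space S. Q (case_nat z \<omega>)} \<partial>M)"
    by (intro nn_integral_cong nn_integral_indicator) measurable
  finally show ?thesis .
qed

lemma measurable_shift [measurable]: "(\<lambda>\<omega> i. \<omega> (i + n)) \<in> measurable S S"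
  by (rule measurable_PiM_single') (auto simp: space_PiM PiE_iff)

text \<open>\<open>comb_seq n\<close> glues the first n coordinates of one sequence to an
  independent second sequence, and the image of the product measure is again \<open>S\<close>. After
  this splitting Q sees only the first sequence and R only the second. That Q is decided before n is
  expressed by invariance under changes from n on, in place of a filtration.\<close>

lemma emeasure_markov:
  assumes [measurable]: "Measurable.pred S Q" "Measurable.pred S R"
    and Q: "\<And>\<omega> \<omega>'. (\<And>i. i < n \<Longrightarrow> \<omega> i = \<omega>' i) \<Longrightarrow> Q \<omega> = Q \<omega>'"
  shows "emeasure S {\<omega>\<in>space S. Q \<omega> \<and> R (\<lambda>i. \<omega> (i + n))}
       = emeasure S {\<omega>\<in>space S. Q \<omega>} * emeasure S {\<omega>\<in>space S. R \<omega>}"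
proof -
  let ?A = "{\<omega>\<in>space S. Q \<omega> \<and> R (\<lambda>i. \<omega> (i + n))}"
  have "emeasure S ?A = emeasure (distr (S \<Otimes>\<^sub>M S) S (\<lambda>(\<omega>, \<omega>'). comb_seq n \<omega> \<omega>')) ?A"
    by (simp only: PiM_comb_seq)
  also have "\<dots> = emeasure (S \<Otimes>\<^sub>M S) ((\<lambda>(\<omega>, \<omega>'). comb_seq n \<omega> \<omega>') -` ?A \<inter> space (S \<Otimes>\<^sub>M S))"
    by (intro emeasure_distr measurable_comb_seq) measurable
  also have "(\<lambda>(\<omega>, \<omega>'). comb_seq n \<omega> \<omega>') -` ?A \<inter> space (S \<Otimes>\<^sub>M S)
           = {\<omega>\<in>space S. Q \<omega>} \<times> {\<omega>\<in>space S. R \<omega>}"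
  proof -
    have "Q (comb_seq n \<omega> \<omega>') = Q \<omega>" for \<omega> \<omega>'
      by (rule Q) (simp add: comb_seq_less)
    moreover have "comb_seq n \<omega> \<omega>' \<in> space S" if "\<omega> \<in> space S" "\<omega>' \<in> space S" for \<omega> \<omega>'
      using that by (auto simp: space_PiM PiE_iff comb_seq_def)
    ultimately show ?thesis
      by (auto simp: space_pair_measure comb_seq_add)
  qed
  also have "emeasure (S \<Otimes>\<^sub>M S) \<dots> = emeasure S {\<omega>\<in>space S. Q \<omega>} * emeasure S {\<omega>\<in>space S. R \<omega>}"
    by (intro P.emeasure_pair_measure_Times) measurable
  finally show ?thesis .
qed

text \<open>I.i.d. coordinates keep their joint law under an injective selection of indices. The
  selections that occur below are shifts and \<open>move_front\<close>, which brings one step to the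
  front.\<close>

lemma distr_reindex:
  fixes f :: "nat \<Rightarrow> nat" assumes "inj f"
  shows "distr S S (\<lambda>\<omega> i. \<omega> (f i)) = S"
  using distr_PiM_reindex[of UNIV "\<lambda>_. M" f UNIV] assms
  by (simp add: M.prob_space_axioms restrict_def)

lemma measurable_reindex: "(\<lambda>\<omega> i. \<omega> (f i)) \<in> measurable S S" for f :: "nat \<Rightarrow> nat"
  by (rule measurable_PiM_single') (auto simp: space_PiM PiE_iff)

lemma emeasure_reindex:
  fixes f :: "nat \<Rightarrow> nat"
  assumes "inj f" and [measurable]: "Measurable.pred S Q"
  shows "emeasure S {\<omega>\<in>space S. Q (\<lambda>i. \<omega> (f i))} = emeasure S {\<omega>\<in>space S. Q \<omega>}"
proof -
  have "emeasure S {\<omega>\<in>space S. Q \<omega>} = emeasure (distr S S (\<lambda>\<omega> i. \<omega> (f i))) {\<omega>\<in>space S. Q \<omega>}"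
    by (simp only: distr_reindex[OF assms(1)])
  also have "\<dots> = emeasure S ((\<lambda>\<omega> i. \<omega> (f i)) -` {\<omega>\<in>space S. Q \<omega>} \<inter> space S)"
    by (intro emeasure_distr measurable_reindex) measurable
  also have "(\<lambda>\<omega> i. \<omega> (f i)) -` {\<omega>\<in>space S. Q \<omega>} \<inter> space S = {\<omega>\<in>space S. Q (\<lambda>i. \<omega> (f i))}"
    by (auto simp: space_PiM PiE_iff)
  finally show ?thesis ..
qed

lemma AE_reindex:
  fixes f :: "nat \<Rightarrow> nat"
  assumes "inj f" "AE \<omega> in S. Q \<omega>"
  shows "AE \<omega> in S. Q (\<lambda>i. \<omega> (f i))"
  using assms(2)
  by (subst (asm) distr_reindex[OF assms(1), symmetric]) (rule AE_distrD[OF measurable_reindex])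

text \<open>Ville's maximal inequality for the supermartingale of the products.\<close>

lemma emeasure_prod_maximal:
  fixes w :: "'a \<Rightarrow> ennreal"
  assumes [measurable]: "w \<in> borel_measurable M" and w: "(\<integral>\<^sup>+z. w z \<partial>M) \<le> 1"
  shows "emeasure S {\<omega>\<in>space S. \<exists>k\<le>n. 1 \<le> s * (\<Prod>i<k. w (\<omega> i))} \<le> s"
proof (induction n arbitrary: s)
  case 0
  show ?case
  proof (cases "1 \<le> s")
    case True
    then show ?thesis by (simp add: P.emeasure_space_1)
  qed simp
next
  case (Suc n)
  show ?case
  proof (cases "1 \<le> s")
    case True
    then show ?thesis using P.emeasure_le_1 order_trans by blast
  next
    case False
    \<comment> \<open>As s < 1, the index k = 0 is excluded, so every admissible product contains
      the first factor. This factor is absorbed into the starting value, and the induction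
      hypothesis is applied with s * w z in place of s.\<close>
    have "emeasure S {\<omega>\<in>space S. \<exists>k\<le>Suc n. 1 \<le> s * (\<Prod>i<k. w (\<omega> i))}
        = (\<integral>\<^sup>+z. emeasure S {\<omega>\<in>space S. \<exists>k\<le>Suc n. 1 \<le> s * (\<Prod>i<k. w (case_nat z \<omega> i))} \<partial>M)"
      by (rule emeasure_case_nat) measurable
    also have "\<dots> = (\<integral>\<^sup>+z. emeasure S {\<omega>\<in>space S. \<exists>k\<le>n. 1 \<le> (s * w z) * (\<Prod>i<k. w (\<omega> i))} \<partial>M)"
    proof -
      have "(\<exists>k\<le>Suc n. 1 \<le> s * (\<Prod>i<k. w (case_nat z \<omega> i)))
         \<longleftrightarrow> (\<exists>k\<le>n. 1 \<le> (s * w z) * (\<Prod>i<k. w (\<omega> i)))" for z \<omega>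
      proof -
        have "(\<Prod>i<Suc k. w (case_nat z \<omega> i)) = w z * (\<Prod>i<k. w (\<omega> i))" for k
          by (subst prod.lessThan_Suc_shift) simp
        then have step: "1 \<le> s * (\<Prod>i<Suc k. w (case_nat z \<omega> i)) \<longleftrightarrow> 1 \<le> (s * w z) * (\<Prod>i<k. w (\<omega> i))" for k
          by (simp add: mult.assoc)
        have "(\<exists>k\<le>Suc n. 1 \<le> s * (\<Prod>i<k. w (case_nat z \<omega> i)))
            \<longleftrightarrow> (\<exists>k\<le>n. 1 \<le> s * (\<Prod>i<Suc k. w (case_nat z \<omega> i)))"
        proof
          assume "\<exists>k\<le>Suc n. 1 \<le> s * (\<Prod>i<k. w (case_nat z \<omega> i))"
          then obtain k where "k \<le> Suc n" "1 \<le> s * (\<Prod>i<k. w (case_nat z \<omega> i))" by blast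
          then show "\<exists>k\<le>n. 1 \<le> s * (\<Prod>i<Suc k. w (case_nat z \<omega> i))"
            using False by (cases k) auto
        qed auto
        then show ?thesis by (simp only: step)
      qed
      then show ?thesis by simp
    qed
    also have "\<dots> \<le> (\<integral>\<^sup>+z. s * w z \<partial>M)"
      by (intro nn_integral_mono Suc.IH)
    also have "\<dots> = s * (\<integral>\<^sup>+z. w z \<partial>M)" by (rule nn_integral_cmult) measurable
    also have "\<dots> \<le> s" using mult_left_mono[OF w, of s] by simp
    finally show ?thesis .
  qed
qed

end

section \<open>The canonical walk and the comparison of the two counts\<close>

lemma of_nat_le_count_iff:
  "of_nat n \<le> emeasure (count_space UNIV) A \<longleftrightarrow> (finite A \<longrightarrow> n \<le> card A)"
  by (cases "finite A") (simp_all add: emeasure_count_space_finite)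

lemma of_nat_le_countI:
  assumes "finite B" "B \<subseteq> A" "n \<le> card B"
  shows "of_nat n \<le> emeasure (count_space UNIV) A"
  using assms by (auto simp: of_nat_le_count_iff intro: order_trans card_mono)

lemma count_suminf: "emeasure (count_space UNIV) {n::nat. P n} = (\<Sum>n. indicator {n. P n} n :: ennreal)"
  by (simp add: nn_integral_count_space_nat flip: nn_integral_indicator)

lemma measurable_count [measurable]:
  fixes P :: "'a \<Rightarrow> nat \<Rightarrow> bool"
  assumes [measurable]: "\<And>n. Measurable.pred M (\<lambda>\<omega>. P \<omega> n)"
  shows "(\<lambda>\<omega>. emeasure (count_space UNIV) {n. P \<omega> n}) \<in> borel_measurable M"
proof -
  have "(\<lambda>\<omega>. emeasure (count_space UNIV) {n. P \<omega> n}) = (\<lambda>\<omega>. \<Sum>n. indicator {\<omega>. P \<omega> n} \<omega> :: ennreal)"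
    unfolding count_suminf by (intro ext suminf_cong) (auto simp: indicator_def)
  then show ?thesis by (simp add: borel_measurable_indicator') 
qed

lemma nn_integral_count:
  fixes P :: "'a \<Rightarrow> nat \<Rightarrow> bool"
  assumes [measurable]: "\<And>n. Measurable.pred M (\<lambda>\<omega>. P \<omega> n)"
  shows "(\<integral>\<^sup>+\<omega>. emeasure (count_space UNIV) {n. P \<omega> n} \<partial>M)
       = (\<Sum>n. emeasure M {\<omega>\<in>space M. P \<omega> n})"
proof -
  have "(\<integral>\<^sup>+\<omega>. emeasure (count_space UNIV) {n. P \<omega> n} \<partial>M)
      = (\<integral>\<^sup>+\<omega>. (\<Sum>n. indicator {\<omega>\<in>space M. P \<omega> n} \<omega>) \<partial>M)"
    unfolding count_suminf by (intro nn_integral_cong suminf_cong) (auto simp: indicator_def)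
  also have "\<dots> = (\<Sum>n. \<integral>\<^sup>+\<omega>. indicator {\<omega>\<in>space M. P \<omega> n} \<omega> \<partial>M)"
    by (intro nn_integral_suminf) measurable
  also have "\<dots> = (\<Sum>n. emeasure M {\<omega>\<in>space M. P \<omega> n})" by simp
  finally show ?thesis .
qed

text \<open>\<open>card (V \<inter> {..<m})\<close> is the rank of m in V, counted from 0. It
  increases strictly along V, so the ranks below n single out the n smallest elements; the induction
  adds the least remaining one. The rank looks only at indices before m, so for visits of a walk it
  is determined by the past.\<close>

lemma card_rank_less:
  fixes V :: "nat set"
  assumes "finite V \<longrightarrow> n \<le> card V"
  shows "finite {m\<in>V. card (V \<inter> {..<m}) < n} \<and> card {m\<in>V. card (V \<inter> {..<m}) < n} = n"
  using assms
proof (induction n)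
  case (Suc n)
  let ?r = "\<lambda>m. card (V \<inter> {..<m})"
  have mono: "?r m < ?r m'" if "m \<in> V" "m < m'" for m m'
    using that by (intro psubset_card_mono) auto
  define B where "B = {m\<in>V. ?r m < n}"
  have B: "finite B" "card B = n" using Suc unfolding B_def by (auto simp: Suc_le_eq less_imp_le)
  have "V \<noteq> B" using Suc.prems B by auto
  then have ex: "\<exists>m. m \<in> V - B" using B_def by blast
  define k where "k = (LEAST m. m \<in> V - B)"
  have k: "k \<in> V - B" unfolding k_def using ex by (rule LeastI_ex)
  have least: "m \<in> B" if "m \<in> V" "m < k" for m
    using that not_less_Least[of m "\<lambda>m. m \<in> V - B"] unfolding k_def by auto
  have "?r k \<le> card B" using B least by (intro card_mono) auto
  moreover have "?r k \<ge> n" using k unfolding B_def by auto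
  ultimately have rk: "?r k = n" using B by simp
  have "{m\<in>V. ?r m < Suc n} = insert k B"
  proof (intro set_eqI iffI)
    fix m assume m: "m \<in> {m\<in>V. ?r m < Suc n}"
    show "m \<in> insert k B"
    proof (cases "m = k \<or> m < k")
      case True then show ?thesis using m least by auto
    next
      case False
      then have "?r k < ?r m" using k by (intro mono) auto
      then show ?thesis using m rk by auto
    qed
  next
    fix m assume "m \<in> insert k B"
    then show "m \<in> {m\<in>V. ?r m < Suc n}" using k rk by (auto simp: B_def)
  qed
  then show ?case using B k by simp
qed auto

lemma card_rank_interval:
  fixes V :: "nat set"
  assumes "finite V \<longrightarrow> b \<le> card V" "a \<le> b"
  shows "finite {m\<in>V. a \<le> card (V \<inter> {..<m}) \<and> card (V \<inter> {..<m}) < b}"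
    and "card {m\<in>V. a \<le> card (V \<inter> {..<m}) \<and> card (V \<inter> {..<m}) < b} = b - a"
proof -
  have eq: "{m\<in>V. a \<le> card (V \<inter> {..<m}) \<and> card (V \<inter> {..<m}) < b}
      = {m\<in>V. card (V \<inter> {..<m}) < b} - {m\<in>V. card (V \<inter> {..<m}) < a}" by auto
  note b = card_rank_less[OF assms(1)] and a = card_rank_less[of V a]
  show "finite {m\<in>V. a \<le> card (V \<inter> {..<m}) \<and> card (V \<inter> {..<m}) < b}"
    unfolding eq using b by simp
  show "card {m\<in>V. a \<le> card (V \<inter> {..<m}) \<and> card (V \<inter> {..<m}) < b} = b - a"
    unfolding eq using a b assms by (subst card_Diff_subset) auto
qed

text \<open>The rank is injective on V, so it embeds the set into {a..<b}, whatever the size of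
  V.\<close>

lemma card_rank_interval_le:
  fixes V :: "nat set"
  shows "finite {m\<in>V. a \<le> card (V \<inter> {..<m}) \<and> card (V \<inter> {..<m}) < b}"
    and "card {m\<in>V. a \<le> card (V \<inter> {..<m}) \<and> card (V \<inter> {..<m}) < b} \<le> b - a"
proof -
  let ?r = "\<lambda>m. card (V \<inter> {..<m})" and ?A = "{m\<in>V. a \<le> card (V \<inter> {..<m}) \<and> card (V \<inter> {..<m}) < b}"
  have mono: "?r m < ?r m'" if "m \<in> V" "m < m'" for m m'
    using that by (intro psubset_card_mono) auto
  have inj: "inj_on ?r ?A"
    by (rule linorder_inj_onI) (use mono in force)+
  have sub: "?r ` ?A \<subseteq> {a..<b}" by auto
  show "finite ?A" using inj sub by (meson finite_atLeastLessThan finite_imageD finite_subset)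
  show "card ?A \<le> b - a" using card_inj_on_le[OF inj sub] by simp
qed

lemma (in prob_space) tail_tendsto_0:
  fixes Z :: "'a \<Rightarrow> ennreal"
  assumes [measurable]: "Z \<in> borel_measurable M" and fin: "AE \<omega> in M. Z \<omega> < \<infinity>"
  shows "(\<lambda>i. prob {\<omega>\<in>space M. (2::ennreal) ^ i \<le> Z \<omega>}) \<longlonglongrightarrow> 0"
proof -
  have "(\<lambda>i. prob {\<omega>\<in>space M. (2::ennreal) ^ i \<le> Z \<omega>}) \<longlonglongrightarrow> prob (\<Inter>i. {\<omega>\<in>space M. (2::ennreal) ^ i \<le> Z \<omega>})"
  proof (rule finite_Lim_measure_decseq)
    have "{\<omega>\<in>space M. (2::ennreal) ^ i \<le> Z \<omega>} \<in> sets M" for i by measurable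
    then show "range (\<lambda>i. {\<omega>\<in>space M. (2::ennreal) ^ i \<le> Z \<omega>}) \<subseteq> events" by blast
    show "decseq (\<lambda>i. {\<omega>\<in>space M. (2::ennreal) ^ i \<le> Z \<omega>})"
      by (auto simp: decseq_def intro: order_trans[OF power_increasing])
  qed
  also have "prob (\<Inter>i. {\<omega>\<in>space M. (2::ennreal) ^ i \<le> Z \<omega>}) = 0"
  proof -
    have "AE \<omega> in M. \<omega> \<notin> (\<Inter>i. {\<omega>\<in>space M. (2::ennreal) ^ i \<le> Z \<omega>})"
      using fin
    proof eventually_elim
      case (elim \<omega>)
      then obtain t where t: "Z \<omega> = ennreal t" "t \<ge> 0" by (cases "Z \<omega>") auto
      obtain i where "t < 2 ^ i" using real_arch_pow[of 2 t] by auto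
      then have "\<not> 2 ^ i \<le> Z \<omega>" using t by (simp add: pow2_le_ennreal_iff)
      then show ?case by auto
    qed
    moreover have "{\<omega>\<in>space M. (2::ennreal) ^ i \<le> Z \<omega>} \<in> sets M" for i by measurable
    ultimately show ?thesis by (intro prob_eq_0[THEN iffD2]) auto
  qed
  finally show ?thesis by simp
qed

section \<open>The two walks on the canonical sequence space\<close>

definition rwalk :: "nat \<Rightarrow> (nat \<Rightarrow> real \<times> real) \<Rightarrow> real" where
  "rwalk n \<omega> = (\<Sum>k<n. fst (\<omega> k))"

text \<open>Coordinates are counted from 0, so \<open>rwalk n\<close> is S_n and
  \<open>prwalk n\<close> is T_(n+1). The perturbation sits at coordinate n while
  \<open>rwalk n\<close> uses only the coordinates below n, which makes the two independent.\<close>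

definition prwalk :: "nat \<Rightarrow> (nat \<Rightarrow> real \<times> real) \<Rightarrow> real" where
  "prwalk n \<omega> = rwalk n \<omega> + snd (\<omega> n)"

definition Nrwalk :: "real \<Rightarrow> (nat \<Rightarrow> real \<times> real) \<Rightarrow> ennreal" where
  "Nrwalk a \<omega> = emeasure (count_space UNIV) {n. rwalk n \<omega> \<le> a}"

definition Nprwalk :: "real \<Rightarrow> (nat \<Rightarrow> real \<times> real) \<Rightarrow> ennreal" where
  "Nprwalk a \<omega> = emeasure (count_space UNIV) {n. prwalk n \<omega> \<le> a}"

lemma rwalk_0 [simp]: "rwalk 0 \<omega> = 0"
  by (simp add: rwalk_def)

lemma rwalk_add: "rwalk (m + n) \<omega> = rwalk m \<omega> + rwalk n (\<lambda>i. \<omega> (i + m))"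
proof -
  have "(\<Sum>k<m + n. fst (\<omega> k)) = (\<Sum>k<m. fst (\<omega> k)) + (\<Sum>k<n. fst (\<omega> (k + m)))"
    by (induction n) (auto simp: add.commute)
  then show ?thesis by (simp add: rwalk_def)
qed

lemma prwalk_add: "prwalk (m + n) \<omega> = rwalk m \<omega> + prwalk n (\<lambda>i. \<omega> (i + m))"
  by (simp add: prwalk_def rwalk_add add.commute)

lemma rwalk_cong: "(\<And>i. i < n \<Longrightarrow> \<omega> i = \<omega>' i) \<Longrightarrow> rwalk n \<omega> = rwalk n \<omega>'"
  by (simp add: rwalk_def)

lemma prwalk_cong: "(\<And>i. i \<le> n \<Longrightarrow> \<omega> i = \<omega>' i) \<Longrightarrow> prwalk n \<omega> = prwalk n \<omega>'"
  by (simp add: prwalk_def rwalk_def)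

locale rw_space = sequence_space \<nu> for \<nu> :: "(real \<times> real) measure" +
  assumes sets_nu: "sets \<nu> = sets borel"
begin

lemma space_nu [simp]: "space \<nu> = UNIV"
  using sets_eq_imp_space_eq[OF sets_nu] by simp

lemma space_S [simp]: "space S = UNIV"
  by (simp add: space_PiM)

lemma Collect_sets_S: "Measurable.pred S Q \<Longrightarrow> {\<omega>. Q \<omega>} \<in> sets S"
  by (simp add: pred_def)

lemma measurable_fst_nu [measurable]: "fst \<in> borel_measurable \<nu>"
  using measurable_fst[of "borel :: real measure" "borel :: real measure"]
  by (subst measurable_cong_sets[OF sets_nu refl]) (simp add: borel_prod)

lemma measurable_snd_nu [measurable]: "snd \<in> borel_measurable \<nu>"
  using measurable_snd[of "borel :: real measure" "borel :: real measure"]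
  by (subst measurable_cong_sets[OF sets_nu refl]) (simp add: borel_prod)

lemma rwalk_measurable [measurable]: "rwalk n \<in> borel_measurable S"
  unfolding rwalk_def[abs_def] by measurable

lemma prwalk_measurable [measurable]: "prwalk n \<in> borel_measurable S"
  unfolding prwalk_def[abs_def] by measurable

lemma Nrwalk_measurable [measurable]: "Nrwalk a \<in> borel_measurable S"
  unfolding Nrwalk_def[abs_def] by measurable

lemma Nprwalk_measurable [measurable]: "Nprwalk a \<in> borel_measurable S"
  unfolding Nprwalk_def[abs_def] by measurable

lemma emeasure_coord:
  assumes [measurable]: "Measurable.pred \<nu> Q"
  shows "emeasure S {\<omega>. Q (\<omega> i)} = emeasure \<nu> {z. Q z}"
proof -
  have Q: "{z. Q z} \<in> sets \<nu>" using assms unfolding pred_def space_nu by simp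
  have "distr S \<nu> (\<lambda>\<omega>. \<omega> i) = \<nu>"
    by (rule distr_PiM_component) (auto intro: M.prob_space_axioms)
  then have "emeasure \<nu> {z. Q z} = emeasure (distr S \<nu> (\<lambda>\<omega>. \<omega> i)) {z. Q z}" by simp
  also have "\<dots> = emeasure S ((\<lambda>\<omega>. \<omega> i) -` {z. Q z} \<inter> space S)"
    by (rule emeasure_distr[OF _ Q]) simp
  also have "(\<lambda>\<omega>. \<omega> i) -` {z. Q z} \<inter> space S = {\<omega>. Q (\<omega> i)}" by auto
  finally show ?thesis ..
qed

text \<open>Strong Markov property for the stopping time that equals n on \<open>A n\<close>: these
  events are disjoint, so the Markov property at each fixed n can be summed.\<close>

lemma emeasure_stopped_markov:
  assumes [measurable]: "\<And>n. Measurable.pred S (A n)" "Measurable.pred S R"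
    and A: "\<And>n \<omega> \<omega>'. (\<And>i. i < n \<Longrightarrow> \<omega> i = \<omega>' i) \<Longrightarrow> A n \<omega> = A n \<omega>'"
    and disj: "\<And>n m \<omega>. A n \<omega> \<Longrightarrow> A m \<omega> \<Longrightarrow> n = m"
  shows "emeasure S {\<omega>. \<exists>n. A n \<omega> \<and> R (\<lambda>i. \<omega> (i + n))}
       = emeasure S {\<omega>. \<exists>n. A n \<omega>} * emeasure S {\<omega>. R \<omega>}"
proof -
  have [measurable]: "Measurable.pred S (\<lambda>\<omega>. R (\<lambda>i. \<omega> (i + n)))" for n
    using measurable_shift[of n] by measurable
  have "emeasure S {\<omega>. \<exists>n. A n \<omega> \<and> R (\<lambda>i. \<omega> (i + n))}
      = emeasure S (\<Union>n. {\<omega>\<in>space S. A n \<omega> \<and> R (\<lambda>i. \<omega> (i + n))})"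
    by (intro arg_cong[where f="emeasure S"]) auto
  also have "\<dots> = (\<Sum>n. emeasure S {\<omega>\<in>space S. A n \<omega> \<and> R (\<lambda>i. \<omega> (i + n))})"
  proof (rule suminf_emeasure[symmetric])
    have "{\<omega>\<in>space S. A n \<omega> \<and> R (\<lambda>i. \<omega> (i + n))} \<in> sets S" for n by measurable
    then show "range (\<lambda>n. {\<omega>\<in>space S. A n \<omega> \<and> R (\<lambda>i. \<omega> (i + n))}) \<subseteq> sets S" by blast
  qed (auto simp: disjoint_family_on_def dest: disj)
  also have "\<dots> = (\<Sum>n. emeasure S {\<omega>\<in>space S. A n \<omega>} * emeasure S {\<omega>\<in>space S. R \<omega>})"
    by (intro suminf_cong emeasure_markov A) measurable
  also have "\<dots> = (\<Sum>n. emeasure S {\<omega>\<in>space S. A n \<omega>}) * emeasure S {\<omega>. R \<omega>}"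
    by simp
  also have "(\<Sum>n. emeasure S {\<omega>\<in>space S. A n \<omega>}) = emeasure S (\<Union>n. {\<omega>\<in>space S. A n \<omega>})"
  proof (rule suminf_emeasure)
    have "{\<omega>\<in>space S. A n \<omega>} \<in> sets S" for n by measurable
    then show "range (\<lambda>n. {\<omega>\<in>space S. A n \<omega>}) \<subseteq> sets S" by blast
  qed (auto simp: disjoint_family_on_def dest: disj)
  also have "(\<Union>n. {\<omega>\<in>space S. A n \<omega>}) = {\<omega>. \<exists>n. A n \<omega>}" by auto
  finally show ?thesis .
qed

lemma snd_tail_small:
  assumes "\<delta> > 0"
  obtains C where "measure \<nu> {z. snd z > C} < \<delta>"
proof -
  have "(\<lambda>n. measure \<nu> {z\<in>space \<nu>. snd z > real n}) \<longlonglongrightarrow> measure \<nu> (\<Inter>n. {z\<in>space \<nu>. snd z > real n})"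
  proof (rule M.finite_Lim_measure_decseq)
    have "{z\<in>space \<nu>. snd z > real n} \<in> sets \<nu>" for n by measurable
    then show "range (\<lambda>n. {z\<in>space \<nu>. snd z > real n}) \<subseteq> sets \<nu>" by blast
    show "decseq (\<lambda>n. {z\<in>space \<nu>. snd z > real n})" by (auto simp: decseq_def)
  qed
  also have "(\<Inter>n. {z\<in>space \<nu>. snd z > real n}) = {}"
  proof -
    have "\<exists>n. \<not> real n < b" for b
      using reals_Archimedean2[of b] by (auto simp: not_less intro: less_imp_le)
    then show ?thesis by auto
  qed
  finally have "(\<lambda>n. measure \<nu> {z. snd z > real n}) \<longlonglongrightarrow> 0" by simp
  then have "eventually (\<lambda>n. measure \<nu> {z. snd z > real n} < \<delta>) sequentially"
    using assms by (rule order_tendstoD)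
  then show ?thesis using that by (auto simp: eventually_sequentially)
qed

text \<open>Let E m say that \<open>rwalk\<close> is at most c at some time from m on, and F m that
  \<open>prwalk\<close> is at most c + C at some time from m on. The independent perturbation gives
  P(E m) <= 2 P(F m). The F m decrease to a null event, so the intersection of the E m is null, for
  each c.\<close>

lemma rwalk_divergent:
  assumes div: "AE \<omega> in S. filterlim (\<lambda>n. prwalk n \<omega>) at_top sequentially"
  shows "AE \<omega> in S. filterlim (\<lambda>n. rwalk n \<omega>) at_top sequentially"
proof -
  obtain C where C: "measure \<nu> {z. snd z > C} < 1 / 2" using snd_tail_small[of "1/2"] by auto
  have C': "emeasure \<nu> {z. snd z \<le> C} \<ge> ennreal (1 / 2)"
  proof -
    have "{z\<in>space \<nu>. snd z > C} \<in> M.events" by measurable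
    then have "measure \<nu> {z. snd z \<le> C} = 1 - measure \<nu> {z. snd z > C}"
      using M.prob_neg[of "\<lambda>z. snd z > C"] by (simp only: not_less space_nu UNIV_I simp_thms)
    then show ?thesis unfolding M.emeasure_eq_measure using C by (intro ennreal_leI) linarith
  qed
  have "AE \<omega> in S. \<not> (\<forall>m. \<exists>n\<ge>m. rwalk n \<omega> \<le> c)" for c :: real
  proof -
    define E where "E m = {\<omega>. \<exists>n\<ge>m. rwalk n \<omega> \<le> c}" for m
    define F where "F m = {\<omega>. \<exists>n\<ge>m. prwalk n \<omega> \<le> c + C}" for m
    have [measurable]: "E m \<in> sets S" "F m \<in> sets S" for m
    proof -
      have "{\<omega>\<in>space S. \<exists>n\<ge>m. rwalk n \<omega> \<le> c} \<in> sets S" by measurable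
      then show "E m \<in> sets S" by (simp add: E_def)
      have "{\<omega>\<in>space S. \<exists>n\<ge>m. prwalk n \<omega> \<le> c + C} \<in> sets S" by measurable
      then show "F m \<in> sets S" by (simp add: F_def)
    qed
    have EF: "measure S (E m) \<le> 2 * measure S (F m)" for m
    proof -
      define A where "A n \<omega> \<longleftrightarrow> m \<le> n \<and> rwalk n \<omega> \<le> c \<and> (\<forall>k<n. m \<le> k \<longrightarrow> c < rwalk k \<omega>)" for n \<omega>
      have [measurable]: "Measurable.pred S (A n)" for n
        unfolding A_def by measurable
      have "emeasure S (E m) * ennreal (1 / 2) \<le> emeasure S (E m) * emeasure S {\<omega>. snd (\<omega> 0) \<le> C}"
        using C' by (intro mult_left_mono) (auto simp: emeasure_coord[of "\<lambda>z. snd z \<le> C"])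
      also have E_eq: "E m = {\<omega>. \<exists>n. A n \<omega>}"
      proof (intro set_eqI iffI)
        fix \<omega> assume "\<omega> \<in> E m"
        then have ex: "\<exists>n. m \<le> n \<and> rwalk n \<omega> \<le> c" by (auto simp: E_def)
        define l where "l = (LEAST n. m \<le> n \<and> rwalk n \<omega> \<le> c)"
        have "m \<le> l \<and> rwalk l \<omega> \<le> c" unfolding l_def by (rule LeastI_ex[OF ex])
        moreover have "\<not> (m \<le> k \<and> rwalk k \<omega> \<le> c)" if "k < l" for k
          using that unfolding l_def by (rule not_less_Least)
        ultimately have "A l \<omega>" unfolding A_def by force
        then show "\<omega> \<in> {\<omega>. \<exists>n. A n \<omega>}" by blast
      qed (auto simp: E_def A_def)
      also have "emeasure S {\<omega>. \<exists>n. A n \<omega>} * emeasure S {\<omega>. snd (\<omega> 0) \<le> C}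
          = emeasure S {\<omega>. \<exists>n. A n \<omega> \<and> snd (\<omega> (0 + n)) \<le> C}"
      proof (rule emeasure_stopped_markov[symmetric])
        fix n m' \<omega> assume "A n \<omega>" "A m' \<omega>"
        then show "n = m'" unfolding A_def by (meson not_le linorder_neqE_nat)
      next
        fix n and \<omega> \<omega>' :: "nat \<Rightarrow> real \<times> real" assume "\<And>i. i < n \<Longrightarrow> \<omega> i = \<omega>' i"
        then have "rwalk k \<omega> = rwalk k \<omega>'" if "k \<le> n" for k
          using that by (intro rwalk_cong) auto
        then show "A n \<omega> = A n \<omega>'" unfolding A_def by auto
      qed measurable
      also have "\<dots> \<le> emeasure S (F m)"
      proof (rule emeasure_mono)
        show "{\<omega>. \<exists>n. A n \<omega> \<and> snd (\<omega> (0 + n)) \<le> C} \<subseteq> F m"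
          by (auto simp: F_def A_def prwalk_def intro: add_mono)
      qed measurable
      finally have "ennreal (measure S (E m) * (1 / 2)) \<le> ennreal (measure S (F m))"
        unfolding E_eq[symmetric] P.emeasure_eq_measure by (subst ennreal_mult) auto
      then show ?thesis by (subst (asm) ennreal_le_iff) auto
    qed
    have "(\<lambda>m. measure S (F m)) \<longlonglongrightarrow> measure S (\<Inter>m. F m)"
    proof (rule P.finite_Lim_measure_decseq)
      show "range F \<subseteq> P.events" by auto
      show "decseq F" by (auto simp: decseq_def F_def intro: order_trans)
    qed
    also have "measure S (\<Inter>m. F m) = 0"
    proof -
      have "AE \<omega> in S. \<omega> \<notin> (\<Inter>m. F m)"
        using div
      proof eventually_elim
        case (elim \<omega>)
        then have "eventually (\<lambda>n. c + C < prwalk n \<omega>) sequentially"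
          by (simp add: filterlim_at_top_dense)
        then obtain N where "\<forall>n\<ge>N. c + C < prwalk n \<omega>" by (auto simp: eventually_sequentially)
        then have "\<omega> \<notin> F N" by (auto simp: F_def not_le)
        then show ?case by blast
      qed
      then show ?thesis by (intro P.prob_eq_0[THEN iffD2]) auto
    qed
    finally have F0: "(\<lambda>m. measure S (F m)) \<longlonglongrightarrow> 0" .
    have "measure S (\<Inter>m. E m) \<le> 0"
    proof (rule LIMSEQ_le_const)
      show "(\<lambda>m. 2 * measure S (F m)) \<longlonglongrightarrow> 0" using tendsto_mult_right_zero[OF F0] by simp
      have "measure S (\<Inter>m. E m) \<le> 2 * measure S (F k)" for k
        using EF[of k] P.finite_measure_mono[of "\<Inter>m. E m" "E k"] by fastforce
      then show "\<exists>N. \<forall>n\<ge>N. measure S (\<Inter>m. E m) \<le> 2 * measure S (F n)" by blast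
    qed
    then have "measure S (\<Inter>m. E m) = 0" using measure_nonneg[of S "\<Inter>m. E m"] by linarith
    then have "AE \<omega> in S. \<omega> \<notin> (\<Inter>m. E m)" by (subst (asm) P.prob_eq_0) auto
    then show ?thesis by (auto simp: E_def elim!: eventually_mono)
  qed
  then have "AE \<omega> in S. \<forall>c::nat. \<not> (\<forall>m. \<exists>n\<ge>m. rwalk n \<omega> \<le> real c)"
    by (simp add: AE_all_countable)
  then show ?thesis
  proof eventually_elim
    case (elim \<omega>)
    show ?case unfolding filterlim_at_top
    proof
      fix Z :: real
      obtain c :: nat where "Z \<le> real c" using real_arch_simple by blast
      moreover have "\<exists>m. \<forall>n\<ge>m. real c < rwalk n \<omega>" using elim by (meson not_le)
      ultimately show "eventually (\<lambda>n. Z \<le> rwalk n \<omega>) sequentially"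
        unfolding eventually_sequentially by (meson less_imp_le order_trans)
    qed
  qed
qed

section \<open>Comparison of the visit counts of S and T\<close>

lemma summable_Nprwalk_of_Nrwalk:
  assumes div: "AE \<omega> in S. filterlim (\<lambda>n. prwalk n \<omega>) at_top sequentially"
    and r: "r > 0"
    and sum: "summable (\<lambda>i. r ^ i * measure S {\<omega>. 2 ^ i \<le> Nrwalk 0 \<omega>})"
  shows "summable (\<lambda>i. r ^ i * measure S {\<omega>. 2 ^ i \<le> Nprwalk x \<omega>})"
proof -
  define H where "H \<omega> = {i. 0 < rwalk i \<omega> \<and> prwalk i \<omega> \<le> x}" for \<omega>
  define D where "D \<omega> = emeasure (count_space UNIV) (H \<omega>)" for \<omega>
  have [measurable]: "D \<in> borel_measurable S" unfolding D_def H_def by measurable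
  have fin: "AE \<omega> in S. Nprwalk x \<omega> < \<infinity>"
    using div
  proof eventually_elim
    case (elim \<omega>)
    then have "eventually (\<lambda>n. x < prwalk n \<omega>) sequentially" by (simp add: filterlim_at_top_dense)
    then obtain m where "\<And>n. n \<ge> m \<Longrightarrow> x < prwalk n \<omega>" by (auto simp: eventually_sequentially)
    then have "{n. prwalk n \<omega> \<le> x} \<subseteq> {..<m}" by (auto simp: not_le[symmetric])
    then have "finite {n. prwalk n \<omega> \<le> x}" by (rule finite_subset) simp
    then show ?case by (simp add: Nprwalk_def of_nat_less_top)
  qed
  have D_step: "measure S {\<omega>. of_nat (2 * n) \<le> D \<omega>}
      \<le> measure S {\<omega>. of_nat n \<le> D \<omega>} * measure S {\<omega>. of_nat n \<le> Nprwalk x \<omega>}"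
    if n: "n \<ge> 1" for n
  proof -
    define q where "q r \<omega> = card {i. i < r \<and> 0 < rwalk i \<omega> \<and> prwalk i \<omega> \<le> x}" for r \<omega>
    have q_eq: "q r \<omega> = card (H \<omega> \<inter> {..<r})" for r \<omega>
      unfolding q_def H_def by (rule arg_cong[where f=card]) auto
    \<comment> \<open>A stopping time: the first r with a positive position and n hits strictly
      before it. Since S_r > 0, every hit of T from r on is also a hit of the same level x by the
      perturbed walk restarted at r.\<close>
    define A where "A r \<omega> \<longleftrightarrow> n \<le> q r \<omega> \<and> 0 < rwalk r \<omega> \<and> (\<forall>k<r. \<not> (n \<le> q k \<omega> \<and> 0 < rwalk k \<omega>))" for r \<omega>
    have [measurable]: "q r \<in> measurable S (count_space UNIV)" for r
      unfolding q_def by measurable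
    have [measurable]: "Measurable.pred S (A r)" for r
      unfolding A_def by measurable
    have sub: "\<exists>r. A r \<omega> \<and> of_nat n \<le> Nprwalk x (\<lambda>i. \<omega> (i + r))" if "of_nat (2 * n) \<le> D \<omega>" for \<omega>
    proof -
      have H2: "finite (H \<omega>) \<longrightarrow> 2 * n \<le> card (H \<omega>)"
        using that unfolding D_def of_nat_le_count_iff .
      have "\<exists>r\<in>H \<omega>. n \<le> q r \<omega>"
      proof -
        have "card {m\<in>H \<omega>. n \<le> card (H \<omega> \<inter> {..<m}) \<and> card (H \<omega> \<inter> {..<m}) < 2 * n} \<noteq> 0"
          using card_rank_interval(2)[OF H2, of n] n by simp
        then have "{m\<in>H \<omega>. n \<le> card (H \<omega> \<inter> {..<m}) \<and> card (H \<omega> \<inter> {..<m}) < 2 * n} \<noteq> {}"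
          by (metis card.empty)
        then show ?thesis unfolding q_eq by blast
      qed
      then have ex: "\<exists>r. n \<le> q r \<omega> \<and> 0 < rwalk r \<omega>" by (auto simp: H_def)
      define r where "r = (LEAST r. n \<le> q r \<omega> \<and> 0 < rwalk r \<omega>)"
      have r1: "n \<le> q r \<omega>" "0 < rwalk r \<omega>" using LeastI_ex[OF ex] unfolding r_def by auto
      have r2: "\<not> (n \<le> q k \<omega> \<and> 0 < rwalk k \<omega>)" if "k < r" for k
        using that not_less_Least unfolding r_def by blast
      \<comment> \<open>Not more than n hits precede r: otherwise the hit of rank n would lie before
        r, and being itself at a positive position it would have stopped earlier. So of 2n hits at
        least n remain from r on.\<close>
      have "q r \<omega> \<le> n"
      proof (rule ccontr)
        assume "\<not> q r \<omega> \<le> n"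
        then have "Suc n \<le> card (H \<omega> \<inter> {..<r})" by (simp add: q_eq)
        then have "card {m \<in> H \<omega> \<inter> {..<r}. n \<le> card (H \<omega> \<inter> {..<r} \<inter> {..<m}) \<and> card (H \<omega> \<inter> {..<r} \<inter> {..<m}) < Suc n} \<noteq> 0"
          using card_rank_interval(2)[of "H \<omega> \<inter> {..<r}" "Suc n" n] by simp
        then have "{m \<in> H \<omega> \<inter> {..<r}. n \<le> card (H \<omega> \<inter> {..<r} \<inter> {..<m}) \<and> card (H \<omega> \<inter> {..<r} \<inter> {..<m}) < Suc n} \<noteq> {}"
          by (metis card.empty)
        then obtain k where k: "k \<in> H \<omega>" "k < r" "n \<le> card (H \<omega> \<inter> {..<r} \<inter> {..<k})" by blast
        have "H \<omega> \<inter> {..<r} \<inter> {..<k} = H \<omega> \<inter> {..<k}" using k by auto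
        then show False using r2[OF k(2)] k by (auto simp: q_eq H_def)
      qed
      define T where "T = {i. i \<in> H \<omega> \<and> r \<le> i}"
      have HT: "H \<omega> = (H \<omega> \<inter> {..<r}) \<union> T" by (auto simp: T_def)
      have T: "finite T \<longrightarrow> n \<le> card T"
      proof
        assume "finite T"
        then have "finite (H \<omega>)" by (subst HT) auto
        have "card (H \<omega>) \<le> card (H \<omega> \<inter> {..<r}) + card T"
          by (subst HT) (rule card_Un_le)
        then show "n \<le> card T" using H2 \<open>finite (H \<omega>)\<close> \<open>q r \<omega> \<le> n\<close> by (simp add: q_eq)
      qed
      have inj: "inj_on (\<lambda>i. i - r) T" by (auto simp: inj_on_def T_def)
      have T_sub: "(\<lambda>i. i - r) ` T \<subseteq> {i. prwalk i (\<lambda>i. \<omega> (i + r)) \<le> x}"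
      proof safe
        fix i assume "i \<in> T"
        then have "prwalk (r + (i - r)) \<omega> \<le> x" by (auto simp: T_def H_def)
        then show "prwalk (i - r) (\<lambda>i. \<omega> (i + r)) \<le> x" unfolding prwalk_add using r1 by linarith
      qed
      have "of_nat n \<le> Nprwalk x (\<lambda>i. \<omega> (i + r))"
        unfolding Nprwalk_def of_nat_le_count_iff
      proof
        assume f: "finite {i. prwalk i (\<lambda>i. \<omega> (i + r)) \<le> x}"
        then have "finite T" using finite_subset[OF T_sub f] inj by (simp add: finite_image_iff)
        then have "n \<le> card ((\<lambda>i. i - r) ` T)" using T inj by (simp add: card_image)
        also have "\<dots> \<le> card {i. prwalk i (\<lambda>i. \<omega> (i + r)) \<le> x}" by (intro card_mono f T_sub)
        finally show "n \<le> card {i. prwalk i (\<lambda>i. \<omega> (i + r)) \<le> x}" .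
      qed
      moreover have "A r \<omega>" using r1 r2 by (auto simp: A_def)
      ultimately show ?thesis by blast
    qed
    have "emeasure S {\<omega>. of_nat (2 * n) \<le> D \<omega>} \<le> emeasure S {\<omega>. \<exists>r. A r \<omega> \<and> of_nat n \<le> Nprwalk x (\<lambda>i. \<omega> (i + r))}"
    proof (rule emeasure_mono)
      have [measurable]: "Measurable.pred S (\<lambda>\<omega>. of_nat n \<le> Nprwalk x (\<lambda>i. \<omega> (i + r)))" for r
        using measurable_shift[of r] by measurable
      have "{\<omega>\<in>space S. \<exists>r. A r \<omega> \<and> of_nat n \<le> Nprwalk x (\<lambda>i. \<omega> (i + r))} \<in> sets S" by measurable
      then show "{\<omega>. \<exists>r. A r \<omega> \<and> of_nat n \<le> Nprwalk x (\<lambda>i. \<omega> (i + r))} \<in> sets S" by simp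
    qed (use sub in blast)
    also have "\<dots> = emeasure S {\<omega>. \<exists>r. A r \<omega>} * emeasure S {\<omega>. of_nat n \<le> Nprwalk x \<omega>}"
    proof (rule emeasure_stopped_markov)
      fix r m' \<omega> assume "A r \<omega>" "A m' \<omega>"
      then show "r = m'" unfolding A_def by (meson linorder_neqE_nat)
    next
      fix r and \<omega> \<omega>' :: "nat \<Rightarrow> real \<times> real" assume eq: "\<And>i. i < r \<Longrightarrow> \<omega> i = \<omega>' i"
      then have 1: "rwalk k \<omega> = rwalk k \<omega>'" if "k \<le> r" for k
        using that by (intro rwalk_cong) auto
      have 2: "prwalk k \<omega> = prwalk k \<omega>'" if "k < r" for k
        using that eq by (intro prwalk_cong) auto
      have "q k \<omega> = q k \<omega>'" if "k \<le> r" for k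
        using that unfolding q_def by (intro arg_cong[where f=card]) (auto simp: 1 2)
      then show "A r \<omega> = A r \<omega>'" using 1 unfolding A_def by auto
    qed measurable
    also have "\<dots> \<le> emeasure S {\<omega>. of_nat n \<le> D \<omega>} * emeasure S {\<omega>. of_nat n \<le> Nprwalk x \<omega>}"
    proof (intro mult_right_mono emeasure_mono subsetI)
      fix \<omega> assume "\<omega> \<in> {\<omega>. \<exists>r. A r \<omega>}"
      then obtain r where "n \<le> card (H \<omega> \<inter> {..<r})" by (auto simp: A_def q_eq)
      then show "\<omega> \<in> {\<omega>. of_nat n \<le> D \<omega>}"
        unfolding D_def by (auto intro!: of_nat_le_countI[of "H \<omega> \<inter> {..<r}"])
    next
      have "{\<omega>\<in>space S. of_nat n \<le> D \<omega>} \<in> sets S" by measurable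
      then show "{\<omega>. of_nat n \<le> D \<omega>} \<in> sets S" by simp
    qed auto
    finally show ?thesis by (simp add: P.emeasure_eq_measure ennreal_mult''[symmetric])
  qed
  have D_sum: "summable (\<lambda>i. r ^ i * measure S {\<omega>. 2 ^ i \<le> D \<omega>})"
  proof -
    \<comment> \<open>The factor P(N >= 2^i) in the doubling inequality tends to 0 because N is
      almost surely finite. Once it is below 1/(2r), the weighted tails of D contract by 1/2, for
      any weight r.\<close>
    have "eventually (\<lambda>i. measure S {\<omega>. (2::ennreal) ^ i \<le> Nprwalk x \<omega>} < 1 / (2 * r)) sequentially"
      using P.tail_tendsto_0[OF Nprwalk_measurable fin] r by (intro order_tendstoD) auto
    then obtain k where k: "\<And>i. i \<ge> k \<Longrightarrow> measure S {\<omega>. (2::ennreal) ^ i \<le> Nprwalk x \<omega>} < 1 / (2 * r)"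
      by (auto simp: eventually_sequentially)
    show ?thesis
    proof (rule summable_of_contraction[where v="\<lambda>_. 0" and c="1/2" and k=k])
      fix i assume "i \<ge> k"
      have "measure S {\<omega>. 2 ^ Suc i \<le> D \<omega>}
        \<le> measure S {\<omega>. 2 ^ i \<le> D \<omega>} * measure S {\<omega>. 2 ^ i \<le> Nprwalk x \<omega>}"
        using D_step[of "2 ^ i"] by simp
      also have "\<dots> \<le> measure S {\<omega>. 2 ^ i \<le> D \<omega>} * (1 / (2 * r))"
        using k[OF \<open>i \<ge> k\<close>] by (intro mult_left_mono) auto
      finally have "r ^ Suc i * measure S {\<omega>. 2 ^ Suc i \<le> D \<omega>}
          \<le> r ^ Suc i * (measure S {\<omega>. 2 ^ i \<le> D \<omega>} * (1 / (2 * r)))"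
        using r by (intro mult_left_mono) auto
      then show "r ^ Suc i * measure S {\<omega>. 2 ^ Suc i \<le> D \<omega>}
          \<le> 0 + 1 / 2 * (r ^ i * measure S {\<omega>. 2 ^ i \<le> D \<omega>})"
        using r by (simp add: field_simps)
    qed (use r in auto)
  qed
  have step: "measure S {\<omega>. 2 ^ Suc i \<le> Nprwalk x \<omega>}
      \<le> measure S {\<omega>. 2 ^ i \<le> Nrwalk 0 \<omega>} + measure S {\<omega>. 2 ^ i \<le> D \<omega>}" for i
  proof -
    have m: "{\<omega>\<in>space S. 2 ^ i \<le> Nrwalk 0 \<omega>} \<in> sets S" "{\<omega>\<in>space S. 2 ^ i \<le> D \<omega>} \<in> sets S"
      by measurable
    have "{\<omega>. 2 ^ Suc i \<le> Nprwalk x \<omega>} \<subseteq> {\<omega>. 2 ^ i \<le> Nrwalk 0 \<omega>} \<union> {\<omega>. 2 ^ i \<le> D \<omega>}"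
    proof
      fix \<omega> assume "\<omega> \<in> {\<omega>. 2 ^ Suc i \<le> Nprwalk x \<omega>}"
      then have "2 * 2 ^ i \<le> Nprwalk x \<omega>" by simp
      also have "Nprwalk x \<omega> \<le> emeasure (count_space UNIV) ({n. rwalk n \<omega> \<le> 0} \<union> H \<omega>)"
        unfolding Nprwalk_def by (intro emeasure_mono) (auto simp: H_def)
      also have "\<dots> \<le> Nrwalk 0 \<omega> + D \<omega>"
        unfolding Nrwalk_def D_def by (intro emeasure_subadditive) auto
      also have "\<dots> \<le> 2 * max (Nrwalk 0 \<omega>) (D \<omega>)"
        unfolding mult_2 by (intro add_mono) auto
      finally have "2 ^ i \<le> max (Nrwalk 0 \<omega>) (D \<omega>)"
        by (simp add: ennreal_mult_le_mult_iff)
      then show "\<omega> \<in> {\<omega>. 2 ^ i \<le> Nrwalk 0 \<omega>} \<union> {\<omega>. 2 ^ i \<le> D \<omega>}"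
        by (auto simp: le_max_iff_disj)
    qed
    then have "measure S {\<omega>. 2 ^ Suc i \<le> Nprwalk x \<omega>} \<le> measure S ({\<omega>. 2 ^ i \<le> Nrwalk 0 \<omega>} \<union> {\<omega>. 2 ^ i \<le> D \<omega>})"
      using m by (intro P.finite_measure_mono) auto
    also have "\<dots> \<le> measure S {\<omega>. 2 ^ i \<le> Nrwalk 0 \<omega>} + measure S {\<omega>. 2 ^ i \<le> D \<omega>}"
      using m by (intro measure_Un_le) auto
    finally show ?thesis .
  qed
  have "summable (\<lambda>i. r ^ Suc i * measure S {\<omega>. 2 ^ Suc i \<le> Nprwalk x \<omega>})"
  proof (rule summable_comparison_test')
    show "summable (\<lambda>i. r * (r ^ i * measure S {\<omega>. 2 ^ i \<le> Nrwalk 0 \<omega>}) + r * (r ^ i * measure S {\<omega>. 2 ^ i \<le> D \<omega>}))"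
      by (intro summable_add summable_mult sum D_sum)
    fix i :: nat
    show "norm (r ^ Suc i * measure S {\<omega>. 2 ^ Suc i \<le> Nprwalk x \<omega>})
      \<le> r * (r ^ i * measure S {\<omega>. 2 ^ i \<le> Nrwalk 0 \<omega>}) + r * (r ^ i * measure S {\<omega>. 2 ^ i \<le> D \<omega>})"
      using mult_left_mono[OF step[of i], of "r ^ Suc i"] r by (simp add: algebra_simps)
  qed
  then show ?thesis by (subst (asm) summable_Suc_iff)
qed

text \<open>Only a first moment is taken. Whether m is a visit of S with rank in {n..<2n} depends on
  the coordinates before m, so the perturbation met there exceeds C with probability
  \<open>\<delta>\<close> independently. Summing over m, the expected number of such bad visits is
  at most \<open>\<delta>\<close> n P(\<open>Nrwalk y\<close> >= n).\<close>

lemma summable_Nrwalk_of_Nprwalk: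
  assumes r: "r > 0"
    and sum: "summable (\<lambda>i. r ^ i * measure S {\<omega>. 2 ^ i \<le> Nprwalk x \<omega>})"
  shows "\<exists>y. summable (\<lambda>i. r ^ i * measure S {\<omega>. 2 ^ i \<le> Nrwalk y \<omega>})"
proof -
  \<comment> \<open>With \<open>\<delta>\<close> < 1/(4r), the factor 2 \<open>\<delta>\<close> of
    the doubling inequality times the ratio r of the weights is at most 1/2.\<close>
  obtain C where C: "measure \<nu> {z. snd z > C} < 1 / (4 * r)"
    using snd_tail_small[of "1 / (4 * r)"] r by auto
  define \<delta> where "\<delta> = measure \<nu> {z. snd z > C}"
  define y where "y = x - C"
  have step: "measure S {\<omega>. of_nat (2 * (2 * h)) \<le> Nrwalk y \<omega>}
      \<le> measure S {\<omega>. of_nat h \<le> Nprwalk x \<omega>} + 2 * \<delta> * measure S {\<omega>. of_nat (2 * h) \<le> Nrwalk y \<omega>}"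
    if h: "h \<ge> 1" for h
  proof -
    define n where "n = 2 * h"
    define q where "q m \<omega> = card {k. k < m \<and> rwalk k \<omega> \<le> y}" for m \<omega>
    define V where "V \<omega> = {m. rwalk m \<omega> \<le> y}" for \<omega>
    have q_eq: "q m \<omega> = card (V \<omega> \<inter> {..<m})" for m \<omega>
      unfolding q_def V_def by (rule arg_cong[where f=card]) auto
    define A where "A m \<omega> \<longleftrightarrow> rwalk m \<omega> \<le> y \<and> n \<le> q m \<omega> \<and> q m \<omega> < 2 * n" for m \<omega>
    have A_eq: "{m. A m \<omega>} = {m\<in>V \<omega>. n \<le> card (V \<omega> \<inter> {..<m}) \<and> card (V \<omega> \<inter> {..<m}) < 2 * n}" for \<omega>
      unfolding A_def q_eq V_def by auto
    have [measurable]: "q m \<in> measurable S (count_space UNIV)" for m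
      unfolding q_def by measurable
    have [measurable]: "Measurable.pred S (A m)" for m
      unfolding A_def by measurable
    define X where "X \<omega> = emeasure (count_space UNIV) {m. A m \<omega> \<and> snd (\<omega> m) > C}" for \<omega>
    have [measurable]: "X \<in> borel_measurable S" unfolding X_def by measurable
    have sets: "{\<omega>. of_nat k \<le> Nrwalk a \<omega>} \<in> sets S" "{\<omega>. of_nat k \<le> Nprwalk a \<omega>} \<in> sets S"
        "{\<omega>. of_nat k \<le> X \<omega>} \<in> sets S" for k a
    proof -
      have "{\<omega>\<in>space S. of_nat k \<le> Nrwalk a \<omega>} \<in> sets S" "{\<omega>\<in>space S. of_nat k \<le> Nprwalk a \<omega>} \<in> sets S"
        "{\<omega>\<in>space S. of_nat k \<le> X \<omega>} \<in> sets S"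
        by measurable
      then show "{\<omega>. of_nat k \<le> Nrwalk a \<omega>} \<in> sets S" "{\<omega>. of_nat k \<le> Nprwalk a \<omega>} \<in> sets S"
        "{\<omega>. of_nat k \<le> X \<omega>} \<in> sets S" by auto
    qed
    have "(\<integral>\<^sup>+\<omega>. X \<omega> \<partial>S) = (\<Sum>m. emeasure S {\<omega>\<in>space S. A m \<omega> \<and> snd (\<omega> m) > C})"
      unfolding X_def by (rule nn_integral_count) measurable
    also have "\<dots> = (\<Sum>m. emeasure S {\<omega>\<in>space S. A m \<omega>} * ennreal \<delta>)"
    proof (rule suminf_cong)
      fix m
      have "emeasure S {\<omega>\<in>space S. A m \<omega> \<and> snd (\<omega> (0 + m)) > C}
          = emeasure S {\<omega>\<in>space S. A m \<omega>} * emeasure S {\<omega>\<in>space S. snd (\<omega> 0) > C}"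
      proof (rule emeasure_markov)
        fix \<omega> \<omega>' :: "nat \<Rightarrow> real \<times> real" assume "\<And>i. i < m \<Longrightarrow> \<omega> i = \<omega>' i"
        then have 1: "rwalk k \<omega> = rwalk k \<omega>'" if "k \<le> m" for k
          using that by (intro rwalk_cong) auto
        have "q m \<omega> = q m \<omega>'"
          unfolding q_def by (intro arg_cong[where f=card]) (auto simp: 1)
        then show "A m \<omega> = A m \<omega>'" using 1 unfolding A_def by auto
      qed measurable
      then show "emeasure S {\<omega>\<in>space S. A m \<omega> \<and> snd (\<omega> m) > C} = emeasure S {\<omega>\<in>space S. A m \<omega>} * ennreal \<delta>"
        by (simp add: emeasure_coord[of "\<lambda>z. snd z > C"] M.emeasure_eq_measure \<delta>_def)
    qed
    also have "\<dots> = (\<integral>\<^sup>+\<omega>. emeasure (count_space UNIV) {m. A m \<omega>} \<partial>S) * ennreal \<delta>"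
      by (subst nn_integral_count) simp_all
    \<comment> \<open>At most n visits have rank in {n..<2n}, and one of them exists only if S has
      made at least n visits before it.\<close>
    also have "(\<integral>\<^sup>+\<omega>. emeasure (count_space UNIV) {m. A m \<omega>} \<partial>S)
        \<le> (\<integral>\<^sup>+\<omega>. of_nat n * indicator {\<omega>. of_nat n \<le> Nrwalk y \<omega>} \<omega> \<partial>S)"
    proof (rule nn_integral_mono)
      fix \<omega>
      show "emeasure (count_space UNIV) {m. A m \<omega>} \<le> of_nat n * indicator {\<omega>. of_nat n \<le> Nrwalk y \<omega>} \<omega>"
      proof (cases "{m. A m \<omega>} = {}")
        case False
        then obtain m where m: "A m \<omega>" by auto
        have "of_nat n \<le> Nrwalk y \<omega>"
          unfolding Nrwalk_def V_def[symmetric] using m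
          by (auto simp: A_def q_eq intro!: of_nat_le_countI[of "V \<omega> \<inter> {..<m}"])
        moreover have "emeasure (count_space UNIV) {m. A m \<omega>} \<le> of_nat n"
          unfolding A_eq using card_rank_interval_le[of "V \<omega>" n "2 * n"]
          by (simp add: emeasure_count_space_finite)
        ultimately show ?thesis by simp
      qed simp
    qed
    also have "\<dots> = of_nat n * emeasure S {\<omega>. of_nat n \<le> Nrwalk y \<omega>}"
      using sets by (intro nn_integral_cmult_indicator) auto
    finally have X_int: "(\<integral>\<^sup>+\<omega>. X \<omega> \<partial>S) \<le> of_nat n * emeasure S {\<omega>. of_nat n \<le> Nrwalk y \<omega>} * ennreal \<delta>"
      by (simp add: mult_right_mono)
    \<comment> \<open>Markov's inequality at h = n / 2, the origin of the factor 2 in front of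
      \<open>\<delta>\<close>.\<close>
    have "of_nat h * emeasure S {\<omega>. of_nat h \<le> X \<omega>} = (\<integral>\<^sup>+\<omega>. of_nat h * indicator {\<omega>. of_nat h \<le> X \<omega>} \<omega> \<partial>S)"
      using sets by (intro nn_integral_cmult_indicator[symmetric]) auto
    also have "\<dots> \<le> (\<integral>\<^sup>+\<omega>. X \<omega> \<partial>S)"
      by (intro nn_integral_mono) (auto simp: indicator_def)
    also note X_int
    finally have "real h * measure S {\<omega>. of_nat h \<le> X \<omega>} \<le> real n * measure S {\<omega>. of_nat n \<le> Nrwalk y \<omega>} * \<delta>"
      by (simp add: P.emeasure_eq_measure \<delta>_def ennreal_of_nat_eq_real_of_nat ennreal_mult''[symmetric])
    then have X_le: "measure S {\<omega>. of_nat h \<le> X \<omega>} \<le> 2 * \<delta> * measure S {\<omega>. of_nat n \<le> Nrwalk y \<omega>}"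
      using h by (simp add: n_def field_simps)
    have "{\<omega>. of_nat (2 * n) \<le> Nrwalk y \<omega>} \<subseteq> {\<omega>. of_nat h \<le> Nprwalk x \<omega>} \<union> {\<omega>. of_nat h \<le> X \<omega>}"
    proof
      fix \<omega> assume "\<omega> \<in> {\<omega>. of_nat (2 * n) \<le> Nrwalk y \<omega>}"
      then have V2: "finite (V \<omega>) \<longrightarrow> 2 * n \<le> card (V \<omega>)"
        unfolding V_def Nrwalk_def mem_Collect_eq of_nat_le_count_iff .
      have fA: "finite {m. A m \<omega>}" and cA: "card {m. A m \<omega>} = n"
        unfolding A_eq using card_rank_interval[OF V2, of n] by auto
      let ?B = "{m. A m \<omega> \<and> snd (\<omega> m) \<le> C}" and ?B' = "{m. A m \<omega> \<and> snd (\<omega> m) > C}"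
      have fB: "finite ?B" "finite ?B'" using fA by (auto intro: finite_subset[OF _ fA])
      have B: "{m. A m \<omega>} = ?B \<union> ?B'" by auto
      have "n \<le> card ?B + card ?B'" unfolding cA[symmetric] by (subst B) (rule card_Un_le)
      then consider "h \<le> card ?B" | "h \<le> card ?B'" unfolding n_def by linarith
      then show "\<omega> \<in> {\<omega>. of_nat h \<le> Nprwalk x \<omega>} \<union> {\<omega>. of_nat h \<le> X \<omega>}"
      proof cases
        case 1
        have "?B \<subseteq> {m. prwalk m \<omega> \<le> x}" by (auto simp: A_def prwalk_def y_def)
        then show ?thesis using 1 fB unfolding Nprwalk_def by (auto intro: of_nat_le_countI)
      next
        case 2
        then show ?thesis using fB unfolding X_def by (auto intro: of_nat_le_countI)
      qed
    qed
    then have "measure S {\<omega>. of_nat (2 * n) \<le> Nrwalk y \<omega>}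
       \<le> measure S ({\<omega>. of_nat h \<le> Nprwalk x \<omega>} \<union> {\<omega>. of_nat h \<le> X \<omega>})"
      using sets by (intro P.finite_measure_mono) auto
    also have "\<dots> \<le> measure S {\<omega>. of_nat h \<le> Nprwalk x \<omega>} + measure S {\<omega>. of_nat h \<le> X \<omega>}"
      using sets by (intro measure_Un_le) auto
    finally show ?thesis using X_le unfolding n_def by linarith
  qed
  \<comment> \<open>With h = 2^i the inequality links the levels i + 2 and i + 1 of S to level i of
    T, so the contraction runs along \<open>Suc i\<close>.\<close>
  let ?u = "\<lambda>i. r ^ Suc i * measure S {\<omega>. 2 ^ Suc i \<le> Nrwalk y \<omega>}"
  have "summable ?u"
  proof (rule summable_of_contraction[where c="1/2" and k=0])
    show "summable (\<lambda>i. r\<^sup>2 * (r ^ i * measure S {\<omega>. 2 ^ i \<le> Nprwalk x \<omega>}))"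
      by (intro summable_mult sum)
    fix i :: nat
    let ?N = "measure S {\<omega>. 2 ^ Suc i \<le> Nrwalk y \<omega>}"
    have "2 * \<delta> * r \<le> 1 / 2" using C r by (simp add: \<delta>_def field_simps)
    then have *: "(2 * \<delta> * r) * (r ^ Suc i * ?N) \<le> 1 / 2 * (r ^ Suc i * ?N)"
      using r by (intro mult_right_mono) auto
    have "measure S {\<omega>. 2 ^ Suc (Suc i) \<le> Nrwalk y \<omega>}
        \<le> measure S {\<omega>. 2 ^ i \<le> Nprwalk x \<omega>} + 2 * \<delta> * ?N"
      using step[of "2 ^ i"] by simp
    then have "?u (Suc i) \<le> r ^ Suc (Suc i) * (measure S {\<omega>. 2 ^ i \<le> Nprwalk x \<omega>} + 2 * \<delta> * ?N)"
      using r by (intro mult_left_mono) auto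
    also have "\<dots> = r\<^sup>2 * (r ^ i * measure S {\<omega>. 2 ^ i \<le> Nprwalk x \<omega>}) + (2 * \<delta> * r) * (r ^ Suc i * ?N)"
      by (simp add: power2_eq_square algebra_simps)
    finally show "?u (Suc i) \<le> r\<^sup>2 * (r ^ i * measure S {\<omega>. 2 ^ i \<le> Nprwalk x \<omega>}) + 1 / 2 * ?u i"
      using * by linarith
  qed (use r in auto)
  then have "summable (\<lambda>i. r ^ i * measure S {\<omega>. 2 ^ i \<le> Nrwalk y \<omega>})"
    by (subst (asm) summable_Suc_iff)
  then show ?thesis by blast
qed

end

section \<open>One big jump\<close>

text \<open>Tonelli on the pairs with 0 <= y <= x and y < X: the inner integral over y is the length
  of an interval, min (X^+) x.\<close>

lemma (in prob_space) ennreal_A_plus: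
  assumes [measurable]: "X \<in> borel_measurable M" and x: "0 \<le> x"
  shows "ennreal (A_plus M X x) = (\<integral>\<^sup>+\<omega>. ennreal (min (max (X \<omega>) 0) x) \<partial>M)"
proof -
  interpret pair_sigma_finite lborel M
    by unfold_locales
  define f where "f y = prob {\<omega>\<in>space M. X \<omega> > y}" for y
  have "mono (\<lambda>y. - f y)"
    by (auto simp: mono_def f_def intro!: finite_measure_mono)
  then have "(\<lambda>y. - f y) \<in> borel_measurable borel" by (rule borel_measurable_mono)
  then have f_meas [measurable]: "f \<in> borel_measurable borel"
    using borel_measurable_uminus[of "\<lambda>y. - f y" borel] by simp
  have int: "integrable lborel (\<lambda>y. indicator {0..x} y *\<^sub>R f y)"
    by (rule integrableI_bounded_set_indicator[where B=1])
      (auto simp: f_def x intro: measure_nonneg)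
  have "ennreal (A_plus M X x) = (\<integral>\<^sup>+y. ennreal (indicator {0..x} y *\<^sub>R f y) \<partial>lborel)"
    unfolding A_plus_def set_lebesgue_integral_def f_def[symmetric]
    by (rule nn_integral_eq_integral[symmetric, OF int]) (auto simp: f_def)
  also have "\<dots> = (\<integral>\<^sup>+y. \<integral>\<^sup>+\<omega>. indicator {0..x} y * indicator {\<omega>\<in>space M. X \<omega> > y} \<omega> \<partial>M \<partial>lborel)"
    by (intro nn_integral_cong, subst nn_integral_cmult_indicator)
      (auto simp: f_def emeasure_eq_measure indicator_def)
  also have "\<dots> = (\<integral>\<^sup>+\<omega>. \<integral>\<^sup>+y. indicator {0..x} y * indicator {\<omega>\<in>space M. X \<omega> > y} \<omega> \<partial>lborel \<partial>M)"
  proof (rule Fubini'[symmetric])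
    have "fst \<in> measurable (lborel \<Otimes>\<^sub>M M) lborel" by (rule measurable_fst)
    then have [measurable]: "fst \<in> borel_measurable (lborel \<Otimes>\<^sub>M M)"
      by simp
    have [measurable]: "(\<lambda>z. X (snd z)) \<in> borel_measurable (lborel \<Otimes>\<^sub>M M)"
      by (rule measurable_compose[OF measurable_snd]) fact
    have "(\<lambda>(y, \<omega>). indicator {0..x} y * (if X \<omega> > y then 1 else 0) :: ennreal) \<in> borel_measurable (lborel \<Otimes>\<^sub>M M)"
      (is "?g \<in> _")
      unfolding case_prod_beta indicator_def of_bool_def by measurable
    also have "?g \<in> borel_measurable (lborel \<Otimes>\<^sub>M M) \<longleftrightarrow>
        (\<lambda>(y, \<omega>). indicator {0..x} y * indicator {\<omega>\<in>space M. X \<omega> > y} \<omega> :: ennreal) \<in> borel_measurable (lborel \<Otimes>\<^sub>M M)"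
      by (intro measurable_cong) (auto simp: space_pair_measure indicator_def)
    finally show "(\<lambda>(y, \<omega>). indicator {0..x} y * indicator {\<omega>\<in>space M. X \<omega> > y} \<omega> :: ennreal) \<in> borel_measurable (lborel \<Otimes>\<^sub>M M)" .
  qed
  also have "\<dots> = (\<integral>\<^sup>+\<omega>. ennreal (min (max (X \<omega>) 0) x) \<partial>M)"
  proof (rule nn_integral_cong)
    fix \<omega> assume \<omega>: "\<omega> \<in> space M"
    have "(\<integral>\<^sup>+y. indicator {0..x} y * indicator {\<omega>\<in>space M. X \<omega> > y} \<omega> \<partial>lborel)
        = (\<integral>\<^sup>+y. indicator ({0..x} \<inter> {..<X \<omega>}) y \<partial>lborel)"
      using \<omega> by (intro nn_integral_cong) (auto simp: indicator_def)
    also have "\<dots> = emeasure lborel ({0..x} \<inter> {..<X \<omega>})" by (rule nn_integral_indicator) simp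
    also have "\<dots> = ennreal (min (max (X \<omega>) 0) x)"
    proof -
      consider "X \<omega> \<le> 0" | "0 < X \<omega>" "X \<omega> \<le> x" | "x < X \<omega>" by linarith
      then show ?thesis
      proof cases
        case 1
        then have "{0..x} \<inter> {..<X \<omega>} = {}" by auto
        then show ?thesis using 1 x by simp
      next
        case 2
        then have "{0..x} \<inter> {..<X \<omega>} = {0..<X \<omega>}" by auto
        then show ?thesis using 2 by simp
      next
        case 3
        then have "{0..x} \<inter> {..<X \<omega>} = {0..x}" by auto
        then show ?thesis using 3 x by simp
      qed
    qed
    finally show "(\<integral>\<^sup>+y. indicator {0..x} y * indicator {\<omega>\<in>space M. X \<omega> > y} \<omega> \<partial>lborel) = ennreal (min (max (X \<omega>) 0) x)" .
  qed
  finally show ?thesis .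
qed

lemma (in prob_space) A_plus_eq:
  assumes [measurable]: "X \<in> borel_measurable M" and x: "0 \<le> x"
  shows "A_plus M X x = expectation (\<lambda>\<omega>. min (max (X \<omega>) 0) x)"
    and "integrable M (\<lambda>\<omega>. min (max (X \<omega>) 0) x)"
proof -
  show int: "integrable M (\<lambda>\<omega>. min (max (X \<omega>) 0) x)"
    by (rule integrable_const_bound[where B=x]) (use x in auto)
  have "ennreal (A_plus M X x) = ennreal (expectation (\<lambda>\<omega>. min (max (X \<omega>) 0) x))"
    unfolding ennreal_A_plus[OF assms] by (rule nn_integral_eq_integral[OF int]) (use x in auto)
  moreover have "0 \<le> A_plus M X x"
    unfolding A_plus_def set_lebesgue_integral_def by (intro Bochner_Integration.integral_nonneg) simp
  moreover have "0 \<le> expectation (\<lambda>\<omega>. min (max (X \<omega>) 0) x)"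
    using x by (intro Bochner_Integration.integral_nonneg) simp
  ultimately show "A_plus M X x = expectation (\<lambda>\<omega>. min (max (X \<omega>) 0) x)" by simp
qed

text \<open>The reindexing that puts k first and keeps the order of all others. It lets
  \<open>emeasure_case_nat\<close> condition on step k while sums over the other steps remain
  initial sums.\<close>

definition move_front :: "nat \<Rightarrow> nat \<Rightarrow> nat" where
  "move_front k = case_nat k (\<lambda>j. if j < k then j else Suc j)"

lemma move_front_simps [simp]:
  "move_front k 0 = k" "move_front k (Suc j) = (if j < k then j else Suc j)"
  by (simp_all add: move_front_def)

lemma inj_move_front: "inj (move_front k)"
proof (rule injI)
  fix i j assume "move_front k i = move_front k j"
  then show "i = j" by (cases i; cases j) (auto split: if_splits)
qed

lemma bij_betw_move_front:
  assumes "k < Suc N"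
  shows "bij_betw (\<lambda>j. move_front k (Suc j)) {..<N} ({..<Suc N} - {k})"
  unfolding bij_betw_def
proof
  show "inj_on (\<lambda>j. move_front k (Suc j)) {..<N}" by (auto simp: inj_on_def)
  show "(\<lambda>j. move_front k (Suc j)) ` {..<N} = {..<Suc N} - {k}"
  proof (intro set_eqI iffI)
    fix i assume i: "i \<in> {..<Suc N} - {k}"
    show "i \<in> (\<lambda>j. move_front k (Suc j)) ` {..<N}"
    proof (cases "i < k")
      case True
      then show ?thesis using assms by (intro image_eqI[of _ _ i]) auto
    next
      case False
      then obtain j where "i = Suc j" "j \<ge> k" using i by (cases i) auto
      then show ?thesis using i by (intro image_eqI[of _ _ j]) auto
    qed
  qed (use assms in \<open>auto split: if_splits\<close>)
qed

lemma sum_move_front: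
  assumes "k < Suc N"
  shows "(\<Sum>i\<in>{..<Suc N} - {k}. g i) = (\<Sum>j<N. g (move_front k (Suc j)))"
  using sum.reindex_bij_betw[OF bij_betw_move_front[OF assms], of g] by simp

section \<open>The functions A and J on the canonical space\<close>

locale rw_space_pos = rw_space +
  assumes pos: "measure \<nu> {z. fst z > 0} > 0"
begin

abbreviation "A \<equiv> A_plus \<nu> fst"
abbreviation "J \<equiv> J_plus \<nu> fst"

lemmas A_eq = M.A_plus_eq(1)[OF measurable_fst_nu]
lemmas A_integrable = M.A_plus_eq(2)[OF measurable_fst_nu]

lemma A_nonneg: "0 \<le> x \<Longrightarrow> 0 \<le> A x"
  by (simp add: A_eq)

lemma A_mono: "0 \<le> x \<Longrightarrow> x \<le> y \<Longrightarrow> A x \<le> A y"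
  by (simp add: A_eq) (intro integral_mono A_integrable, auto)

text \<open>A x / x is nonincreasing because min v x / x is, for each v >= 0. This is the
  monotonicity of J away from 0.\<close>

lemma A_scale:
  assumes "0 \<le> x" "x \<le> y"
  shows "x * A y \<le> y * A x"
proof -
  have "(\<integral>z. x * min (max (fst z) 0) y \<partial>\<nu>) \<le> (\<integral>z. y * min (max (fst z) 0) x \<partial>\<nu>)"
  proof (rule integral_mono)
    fix z :: "real \<times> real"
    define v where "v = max (fst z) 0"
    have v: "v \<ge> 0" by (simp add: v_def)
    have "x * min v y \<le> y * min v x"
    proof (cases "v \<le> x")
      case True
      then show ?thesis using assms v by (simp add: mult_right_mono)
    next
      case False
      have "x * min v y \<le> x * y" using assms by (intro mult_left_mono) auto
      then show ?thesis using False by (simp add: mult.commute)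
    qed
    then show "x * min (max (fst z) 0) y \<le> y * min (max (fst z) 0) x" by (simp add: v_def)
  qed (use assms in \<open>auto intro!: A_integrable\<close>)
  then show ?thesis using assms by (simp add: A_eq)
qed

text \<open>Says that J x is at least the value assigned to J at 0, so that J is monotone up to and
  including 0.\<close>

lemma A_le:
  assumes "0 \<le> x"
  shows "A x \<le> x * measure \<nu> {z. fst z > 0}"
proof -
  have [measurable]: "{z. fst z > 0} \<in> sets \<nu>"
    using measurable_sets[OF measurable_fst_nu, of "{0<..}"] by (simp add: vimage_def)
  have "A x \<le> (\<integral>z. x * indicator {z. fst z > 0} z \<partial>\<nu>)"
    unfolding A_eq[OF assms]
  proof (rule integral_mono)
    show "integrable \<nu> (\<lambda>z. x * indicator {z. fst z > 0} z)"
      by (intro integrable_mult_right integrable_real_indicator) (auto simp: M.emeasure_eq_measure)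
  qed (use assms in \<open>auto intro!: A_integrable simp: indicator_def\<close>)
  then show ?thesis by simp
qed

lemma A_pos:
  assumes "0 < x"
  shows "0 < A x"
proof (rule ccontr)
  assume "\<not> 0 < A x"
  then have "A x = 0" using A_nonneg[of x] assms by simp
  then have "AE z in \<nu>. min (max (fst z) 0) x = 0"
    using assms A_integrable[of x]
    by (subst (asm) A_eq) (auto simp: integral_nonneg_eq_0_iff_AE)
  then have "AE z in \<nu>. \<not> fst z > 0" by eventually_elim (use assms in \<open>auto simp: min_def split: if_splits\<close>)
  moreover have "{z. fst z > 0} \<in> sets \<nu>"
    using measurable_sets[OF measurable_fst_nu, of "{0<..}"] by (simp add: vimage_def)
  ultimately have "measure \<nu> {z. fst z > 0} = 0"
    by (subst M.prob_eq_0) auto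
  then show False using pos by simp
qed

lemma J_mono:
  assumes "0 \<le> x" "x \<le> y"
  shows "J x \<le> J y"
proof -
  consider "y = 0" "x = 0" | "x = 0" "y > 0" | "x > 0" "y > 0" using assms by fastforce
  then show ?thesis
  proof cases
    case 2
    then show ?thesis using A_le[of y] A_pos[of y] pos
      by (simp add: J_plus_def field_simps)
  next
    case 3
    then show ?thesis using A_scale[OF assms] A_pos[of x] A_pos[of y]
      by (simp add: J_plus_def field_simps)
  qed simp
qed

lemma J_ge_1: "0 \<le> x \<Longrightarrow> 1 \<le> J x"
proof -
  assume "0 \<le> x"
  then have "J 0 \<le> J x" by (intro J_mono) auto
  moreover have "1 \<le> J 0" using pos by (simp add: J_plus_def field_simps)
  ultimately show ?thesis by linarith
qed

lemma A_mult_J: "0 \<le> x \<Longrightarrow> A x * J x = x"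
  using A_pos[of x] A_le[of 0] A_nonneg[of 0] by (cases "x = 0") (auto simp: J_plus_def)

definition G :: "real \<times> real \<Rightarrow> real" where
  "G z = J (max (- fst z) 0)"

lemma G_ge_1: "1 \<le> G z"
  by (simp add: G_def J_ge_1)

lemma J_measurable: "(\<lambda>x. J (max x 0)) \<in> borel_measurable borel"
  by (rule borel_measurable_mono) (auto simp: mono_def intro!: J_mono)

lemma G_measurable [measurable]: "G \<in> borel_measurable \<nu>"
  unfolding G_def[abs_def] by (rule measurable_compose[OF _ J_measurable]) measurable

text \<open>Let k < m be the first step with G > y and let u be its negative part. The choice of y
  forces u > 2 \<open>\<bar>x\<bar>\<close>, and with conditional probability at least 3/4 the
  positive parts of the other steps up to time 2n sum to less than u/2, so that S stays below -u/2 <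
  x from time k + 1 to 2n. Being first costs a factor 1 - m q by the union bound, whence q (1 - m q)
  - q/4 for each k, and these events are disjoint. The free parameter m serves to keep m q away from
  3/4.\<close>

lemma prob_Nrwalk_ge:
  assumes n: "n \<ge> 1" and y: "J (2 * \<bar>x\<bar>) \<le> y" "16 * real n \<le> y" and m: "m \<le> n"
  defines "q \<equiv> measure \<nu> {z. G z > y}"
  shows "real m * q * (3 / 4 - real m * q) \<le> measure S {\<omega>. of_nat n \<le> Nrwalk x \<omega>}"
proof -
  define pp where "pp i \<omega> = max (fst (\<omega> i)) 0" for i and \<omega> :: "nat \<Rightarrow> real \<times> real"
  have [measurable]: "pp i \<in> borel_measurable S" for i unfolding pp_def[abs_def] by measurable
  define N where "N = 2 * n - 1"
  have N: "Suc N = 2 * n" using n by (simp add: N_def)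
  define R where "R k \<omega> = (\<Sum>i\<in>{..<Suc N} - {k}. pp i \<omega>)" for k \<omega>
  have [measurable]: "R k \<in> borel_measurable S" for k unfolding R_def[abs_def] by measurable
  define B where "B k \<omega> \<longleftrightarrow> (\<forall>i<k. G (\<omega> i) \<le> y) \<and> G (\<omega> k) > y" for k :: nat and \<omega>
  have [measurable]: "Measurable.pred S (B k)" for k unfolding B_def by measurable
  have Gy: "Measurable.pred \<nu> (\<lambda>z. G z > y)" by measurable
  have q_eq: "emeasure \<nu> {z. G z > y} = ennreal q" by (simp add: q_def M.emeasure_eq_measure)
  have q0: "0 \<le> q" by (simp add: q_def)
  have coord: "measure S {\<omega>. G (\<omega> i) > y} = q" for i
    using emeasure_coord[OF Gy, of i] q0 by (simp add: q_eq P.emeasure_eq_measure)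
  have G_large: "2 * \<bar>x\<bar> < - fst z \<and> 0 < - fst z" if "G z > y" for z
  proof (rule ccontr)
    assume "\<not> ?thesis"
    then have "max (- fst z) 0 \<le> 2 * \<bar>x\<bar>" by auto
    then have "G z \<le> J (2 * \<bar>x\<bar>)" unfolding G_def by (intro J_mono) auto
    then show False using that y by linarith
  qed
  \<comment> \<open>The positive parts are truncated at u before Markov's inequality is applied, so
    that their means are A u. The event is not lost: a single positive part above u already
    contributes u to the truncated sum.\<close>
  have markov: "emeasure S {\<omega>. - fst z / 2 \<le> (\<Sum>j<N. pp j \<omega>)} \<le> ennreal (1 / 4)" if z: "G z > y" for z
  proof -
    define u where "u = - fst z"
    have u: "u > 0" "J u > y" using G_large[OF z] z by (auto simp: u_def G_def)
    have "ennreal (u / 2) * emeasure S {\<omega>. u / 2 \<le> (\<Sum>j<N. pp j \<omega>)}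
        = (\<integral>\<^sup>+\<omega>. ennreal (u / 2) * indicator {\<omega>. u / 2 \<le> (\<Sum>j<N. pp j \<omega>)} \<omega> \<partial>S)"
      by (intro nn_integral_cmult_indicator[symmetric] Collect_sets_S) measurable
    also have "\<dots> \<le> (\<integral>\<^sup>+\<omega>. (\<Sum>j<N. ennreal (min (pp j \<omega>) u)) \<partial>S)"
    proof (rule nn_integral_mono)
      fix \<omega>
      have "u / 2 \<le> (\<Sum>j<N. min (pp j \<omega>) u)" if *: "u / 2 \<le> (\<Sum>j<N. pp j \<omega>)"
      proof (cases "\<exists>j<N. pp j \<omega> > u")
        case True
        then obtain j where j: "j < N" "pp j \<omega> > u" by blast
        have "u / 2 \<le> min (pp j \<omega>) u" using u j by simp
        also have "\<dots> \<le> (\<Sum>j<N. min (pp j \<omega>) u)"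
          using u j by (intro member_le_sum) (auto simp: pp_def)
        finally show ?thesis .
      next
        case False
        then have "(\<Sum>j<N. min (pp j \<omega>) u) = (\<Sum>j<N. pp j \<omega>)" by (intro sum.cong) auto
        then show ?thesis using * by simp
      qed
      moreover have "(\<Sum>j<N. ennreal (min (pp j \<omega>) u)) = ennreal (\<Sum>j<N. min (pp j \<omega>) u)"
        using u by (intro sum_ennreal) (auto simp: pp_def)
      ultimately show "ennreal (u / 2) * indicator {\<omega>. u / 2 \<le> (\<Sum>j<N. pp j \<omega>)} \<omega> \<le> (\<Sum>j<N. ennreal (min (pp j \<omega>) u))"
        by (auto simp: indicator_def intro!: ennreal_leI)
    qed
    also have "\<dots> = (\<Sum>j<N. \<integral>\<^sup>+\<omega>. ennreal (min (pp j \<omega>) u) \<partial>S)"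
      by (rule nn_integral_sum) measurable
    also have "\<dots> = (\<Sum>j<N. ennreal (A u))"
    proof (rule sum.cong)
      fix j
      have "distr S \<nu> (\<lambda>\<omega>. \<omega> j) = \<nu>"
        by (rule distr_PiM_component) (auto intro: M.prob_space_axioms)
      then have "(\<integral>\<^sup>+z. ennreal (min (max (fst z) 0) u) \<partial>\<nu>) = (\<integral>\<^sup>+z. ennreal (min (max (fst z) 0) u) \<partial>distr S \<nu> (\<lambda>\<omega>. \<omega> j))"
        by simp
      also have "\<dots> = (\<integral>\<^sup>+\<omega>. ennreal (min (pp j \<omega>) u) \<partial>S)"
        unfolding pp_def
      proof (rule nn_integral_distr)
        show "(\<lambda>\<omega>. \<omega> j) \<in> measurable S \<nu>" by (rule measurable_component_singleton) simp
        show "(\<lambda>z. ennreal (min (max (fst z) 0) u)) \<in> borel_measurable (distr S \<nu> (\<lambda>\<omega>. \<omega> j))"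
          using measurable_fst_nu by simp
      qed
      finally show "(\<integral>\<^sup>+\<omega>. ennreal (min (pp j \<omega>) u) \<partial>S) = ennreal (A u)"
        using M.ennreal_A_plus[OF measurable_fst_nu, of u] u by simp
    qed simp
    also have "\<dots> = ennreal (real N * A u)"
      using A_nonneg[of u] u by (simp add: ennreal_of_nat_eq_real_of_nat ennreal_mult)
    finally have "ennreal (u / 2 * measure S {\<omega>. u / 2 \<le> (\<Sum>j<N. pp j \<omega>)}) \<le> ennreal (real N * A u)"
      using u by (simp only: P.emeasure_eq_measure ennreal_mult[symmetric] measure_nonneg half_gt_zero less_imp_le)
    then have "u / 2 * measure S {\<omega>. u / 2 \<le> (\<Sum>j<N. pp j \<omega>)} \<le> real N * A u"
      by (rule ennreal_le_iff[THEN iffD1, rotated]) (use u A_nonneg[of u] in auto)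
    \<comment> \<open>The constant 16 is made for this: 2 n A(u) <= y A(u) / 8 <= J(u) A(u) / 8 = u
      / 8.\<close>
    also have "\<dots> \<le> u / 2 * (1 / 4)"
    proof -
      have "real N * A u \<le> 2 * real n * A u" using A_nonneg[of u] u N by (intro mult_right_mono) linarith+
      also have "\<dots> \<le> y / 8 * A u" using y A_nonneg[of u] u by (intro mult_right_mono) linarith+
      also have "\<dots> \<le> J u / 8 * A u" using u A_nonneg[of u] by (intro mult_right_mono) linarith+
      also have "\<dots> = u / 8" using A_mult_J[of u] u by (simp add: mult.commute)
      finally show ?thesis by simp
    qed
    finally have "measure S {\<omega>. u / 2 \<le> (\<Sum>j<N. pp j \<omega>)} \<le> 1 / 4"
      using u by (subst (asm) mult_le_cancel_left_pos) auto
    then show ?thesis unfolding u_def P.emeasure_eq_measure by (intro ennreal_leI) simp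
  qed
  \<comment> \<open>Step k is moved to the front and conditioned on; the remaining 2n - 1 steps are
    again i.i.d. and independent of it.\<close>
  have bad: "measure S {\<omega>. G (\<omega> k) > y \<and> \<not> R k \<omega> < - fst (\<omega> k) / 2} \<le> q / 4" if k: "k < n" for k
  proof -
    define Q where "Q \<omega> \<longleftrightarrow> G (\<omega> 0) > y \<and> \<not> (\<Sum>j<N. pp (Suc j) \<omega>) < - fst (\<omega> 0) / 2" for \<omega>
    have [measurable]: "Measurable.pred S Q" unfolding Q_def by measurable
    have "k < Suc N" using k N by linarith
    from sum_move_front[OF this, of "\<lambda>i. pp i _"]
    have R_eq: "R k \<omega> = (\<Sum>j<N. pp (Suc j) (\<lambda>i. \<omega> (move_front k i)))" for \<omega>
      unfolding R_def by (simp add: pp_def)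
    have "emeasure S {\<omega>. G (\<omega> k) > y \<and> \<not> R k \<omega> < - fst (\<omega> k) / 2}
        = emeasure S {\<omega>\<in>space S. Q (\<lambda>i. \<omega> (move_front k i))}"
      unfolding Q_def R_eq by simp
    also have "\<dots> = emeasure S {\<omega>\<in>space S. Q \<omega>}"
      by (rule emeasure_reindex[OF inj_move_front]) measurable
    also have "\<dots> = (\<integral>\<^sup>+z. emeasure S {\<omega>\<in>space S. Q (case_nat z \<omega>)} \<partial>\<nu>)"
      by (rule emeasure_case_nat) measurable
    also have "\<dots> \<le> (\<integral>\<^sup>+z. ennreal (1 / 4) * indicator {z. G z > y} z \<partial>\<nu>)"
      using markov by (intro nn_integral_mono) (auto simp: Q_def pp_def indicator_def not_less)
    also have "\<dots> = ennreal (1 / 4) * ennreal q"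
    proof -
      have "{z\<in>space \<nu>. G z > y} \<in> sets \<nu>" by measurable
      then show ?thesis by (subst nn_integral_cmult_indicator) (simp_all add: q_eq)
    qed
    finally have "ennreal (measure S {\<omega>. G (\<omega> k) > y \<and> \<not> R k \<omega> < - fst (\<omega> k) / 2}) \<le> ennreal (1 / 4 * q)"
      unfolding P.emeasure_eq_measure ennreal_mult[OF zero_le_divide_1_iff[THEN iffD2, OF zero_le_numeral] q0] .
    then have "measure S {\<omega>. G (\<omega> k) > y \<and> \<not> R k \<omega> < - fst (\<omega> k) / 2} \<le> 1 / 4 * q"
      by (rule ennreal_le_iff[THEN iffD1, rotated]) (use q0 in auto)
    then show ?thesis by simp
  qed
  have good: "(1 - real m * q) * q \<le> measure S {\<omega>. B k \<omega>}" if k: "k < m" for k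
  proof -
    have sets: "{\<omega>. G (\<omega> i) > y} \<in> sets S" for i by (intro Collect_sets_S) measurable
    have "emeasure S {\<omega>\<in>space S. (\<forall>i<k. G (\<omega> i) \<le> y) \<and> G (\<omega> (0 + k)) > y}
        = emeasure S {\<omega>\<in>space S. \<forall>i<k. G (\<omega> i) \<le> y} * emeasure S {\<omega>\<in>space S. G (\<omega> 0) > y}"
      by (rule emeasure_markov) auto
    then have eq: "measure S {\<omega>. B k \<omega>} = measure S {\<omega>. \<forall>i<k. G (\<omega> i) \<le> y} * q"
      by (simp add: B_def coord P.emeasure_eq_measure q0 ennreal_mult''[symmetric])
    have "measure S {\<omega>. \<forall>i<k. G (\<omega> i) \<le> y} = 1 - measure S (\<Union>i<k. {\<omega>. G (\<omega> i) > y})"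
    proof -
      have "{\<omega>. \<forall>i<k. G (\<omega> i) \<le> y} = space S - (\<Union>i<k. {\<omega>. G (\<omega> i) > y})" by (auto simp: not_less)
      then show ?thesis using P.prob_compl[of "\<Union>i<k. {\<omega>. G (\<omega> i) > y}"] sets by auto
    qed
    moreover have "measure S (\<Union>i<k. {\<omega>. G (\<omega> i) > y}) \<le> (\<Sum>i<k. measure S {\<omega>. G (\<omega> i) > y})"
      using sets by (intro P.finite_measure_subadditive_finite) auto
    moreover have "(\<Sum>i<k. measure S {\<omega>. G (\<omega> i) > y}) = real k * q"
      by (simp add: coord)
    moreover have "real k * q \<le> real m * q" using k q0 by (intro mult_right_mono) auto
    ultimately have "1 - real m * q \<le> measure S {\<omega>. \<forall>i<k. G (\<omega> i) \<le> y}" by linarith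
    then show ?thesis unfolding eq using q0 by (rule mult_right_mono)
  qed
  define E where "E k = {\<omega>. B k \<omega> \<and> R k \<omega> < - fst (\<omega> k) / 2}" for k
  have E_sets: "E k \<in> sets S" for k unfolding E_def by (intro Collect_sets_S) measurable
  have E_ge: "q * (3 / 4 - real m * q) \<le> measure S (E k)" if k: "k < m" for k
  proof -
    have sets: "{\<omega>. B k \<omega>} \<in> sets S" "{\<omega>. G (\<omega> k) > y \<and> \<not> R k \<omega> < - fst (\<omega> k) / 2} \<in> sets S"
      by (auto intro!: Collect_sets_S)
    have "measure S {\<omega>. B k \<omega>} \<le> measure S (E k \<union> {\<omega>. G (\<omega> k) > y \<and> \<not> R k \<omega> < - fst (\<omega> k) / 2})"
      using sets E_sets by (intro P.finite_measure_mono) (auto simp: E_def B_def not_less)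
    also have "\<dots> \<le> measure S (E k) + measure S {\<omega>. G (\<omega> k) > y \<and> \<not> R k \<omega> < - fst (\<omega> k) / 2}"
      using sets E_sets by (intro measure_Un_le) auto
    finally show ?thesis using good[OF k] bad[of k] k m by (simp add: algebra_simps)
  qed
  have "real m * q * (3 / 4 - real m * q) = (\<Sum>k<m. q * (3 / 4 - real m * q))" by simp
  also have "\<dots> \<le> (\<Sum>k<m. measure S (E k))" by (intro sum_mono E_ge) simp
  also have "\<dots> = measure S (\<Union>k<m. E k)"
  proof (rule P.finite_measure_finite_Union[symmetric])
    show "disjoint_family_on E {..<m}"
    proof (auto simp: disjoint_family_on_def E_def B_def)
      fix k l :: nat and \<omega> :: "nat \<Rightarrow> real \<times> real"
      assume "k \<noteq> l" "\<forall>i<k. G (\<omega> i) \<le> y" "y < G (\<omega> k)" "\<forall>i<l. G (\<omega> i) \<le> y" "y < G (\<omega> l)"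
      then show False by (cases k l rule: linorder_cases) (auto simp: not_le[symmetric])
    qed
  qed (use E_sets in auto)
  also have "\<dots> \<le> measure S {\<omega>. of_nat n \<le> Nrwalk x \<omega>}"
  proof (rule P.finite_measure_mono)
    show "(\<Union>k<m. E k) \<subseteq> {\<omega>. of_nat n \<le> Nrwalk x \<omega>}"
    proof
      fix \<omega> assume "\<omega> \<in> (\<Union>k<m. E k)"
      then obtain k where k: "k < m" "B k \<omega>" "R k \<omega> < - fst (\<omega> k) / 2" by (auto simp: E_def)
      \<comment> \<open>These times number 2n - k, which is at least n because k < m <= n.\<close>
      have "rwalk j \<omega> \<le> x" if j: "j \<in> {k + 1..2 * n}" for j
      proof -
        have "rwalk j \<omega> = fst (\<omega> k) + (\<Sum>i\<in>{..<j} - {k}. fst (\<omega> i))"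
          unfolding rwalk_def using j by (subst sum.remove[of _ k]) auto
        also have "(\<Sum>i\<in>{..<j} - {k}. fst (\<omega> i)) \<le> (\<Sum>i\<in>{..<j} - {k}. pp i \<omega>)"
          by (intro sum_mono) (simp add: pp_def)
        also have "\<dots> \<le> R k \<omega>"
          unfolding R_def N using j by (intro sum_mono2) (auto simp: pp_def)
        finally show ?thesis using k G_large[of "\<omega> k"] by (auto simp: B_def)
      qed
      then show "\<omega> \<in> {\<omega>. of_nat n \<le> Nrwalk x \<omega>}"
        unfolding Nrwalk_def using k m
        by (auto intro!: of_nat_le_countI[of "{k + 1..2 * n}"])
    qed
  qed (auto intro!: Collect_sets_S)
  finally show ?thesis .
qed

text \<open>The weight grows from r to 2r, that is from moment p to p + 1, because a big step at any
  of about 2^i times is enough: 2^i q i <= 4 a i for all large i.\<close>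

lemma summable_G_of_Nrwalk:
  assumes r: "r \<ge> 1"
    and sum: "summable (\<lambda>i. r ^ i * measure S {\<omega>. 2 ^ i \<le> Nrwalk x \<omega>})"
  shows "summable (\<lambda>i. (2 * r) ^ i * measure \<nu> {z. 2 ^ i \<le> ennreal (G z)})"
proof -
  define a where "a i = measure S {\<omega>. 2 ^ i \<le> Nrwalk x \<omega>}" for i
  define q where "q i = measure \<nu> {z. G z > 2 ^ (i + 4)}" for i
  have q0: "0 \<le> q i" for i by (simp add: q_def)
  have "(\<lambda>i. r ^ i * a i) \<longlonglongrightarrow> 0" using sum unfolding a_def by (rule summable_LIMSEQ_zero)
  then have "eventually (\<lambda>i. r ^ i * a i < 1 / 16) sequentially" by (rule order_tendstoD) simp
  then have ev_a: "eventually (\<lambda>i. a i < 1 / 16) sequentially"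
  proof eventually_elim
    case (elim i)
    have "1 * a i \<le> r ^ i * a i" using r by (intro mult_right_mono one_le_power) (auto simp: a_def)
    then show ?case using elim by linarith
  qed
  have tail: "(\<lambda>i. measure \<nu> {z\<in>space \<nu>. 2 ^ i \<le> ennreal (G z)}) \<longlonglongrightarrow> 0"
    by (rule M.tail_tendsto_0) auto
  have G0: "0 \<le> G z" for z using G_ge_1[of z] by linarith
  have G_sets: "{z. 2 ^ i \<le> ennreal (G z)} \<in> sets \<nu>" "{z. G z > t} \<in> sets \<nu>" for i t
  proof -
    have "{z\<in>space \<nu>. 2 ^ i \<le> ennreal (G z)} \<in> sets \<nu>" "{z\<in>space \<nu>. G z > t} \<in> sets \<nu>" by measurable
    then show "{z. 2 ^ i \<le> ennreal (G z)} \<in> sets \<nu>" "{z. G z > t} \<in> sets \<nu>" by auto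
  qed
  have q_le: "q i \<le> measure \<nu> {z. 2 ^ i \<le> ennreal (G z)}" for i
    unfolding q_def
  proof (rule M.finite_measure_mono)
    show "{z. 2 ^ (i + 4) < G z} \<subseteq> {z. 2 ^ i \<le> ennreal (G z)}"
    proof
      fix z assume "z \<in> {z. 2 ^ (i + 4) < G z}"
      moreover have "(2::real) ^ i \<le> 2 ^ (i + 4)" by (intro power_increasing) auto
      ultimately have "2 ^ i \<le> G z" by (simp only: mem_Collect_eq)
      then show "z \<in> {z. 2 ^ i \<le> ennreal (G z)}"
        using G0 by (simp add: pow2_le_ennreal_iff)
    qed
  qed (rule G_sets)
  have "eventually (\<lambda>i. measure \<nu> {z. 2 ^ i \<le> ennreal (G z)} < 1 / 4) sequentially"
    using order_tendstoD(2)[OF tail, of "1/4"] by simp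
  then have ev_q: "eventually (\<lambda>i. q i < 1 / 4) sequentially"
  proof eventually_elim
    case (elim i)
    then show ?case using q_le[of i] by linarith
  qed
  obtain i1 where i1: "J (2 * \<bar>x\<bar>) < 2 ^ i1" using real_arch_pow[of 2 "J (2 * \<bar>x\<bar>)"] by auto
  have "eventually (\<lambda>i. 2 ^ i * q i \<le> 4 * a i) sequentially"
    using ev_a ev_q eventually_ge_at_top[of i1]
  proof eventually_elim
    case (elim i)
    define n :: nat where "n = 2 ^ i"
    have y1: "J (2 * \<bar>x\<bar>) \<le> 2 ^ (i + 4)"
    proof -
      have "(2::real) ^ i1 \<le> 2 ^ (i + 4)" using elim(3) by (intro power_increasing) auto
      then show ?thesis using i1 by linarith
    qed
    have key: "real m * q i * (3 / 4 - real m * q i) \<le> a i" if "m \<le> n" for m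
      using prob_Nrwalk_ge[of n x "2 ^ (i + 4)" m] y1 that
      by (simp add: n_def q_def a_def power_add)
    show ?case
    proof (cases "real n * q i \<le> 1 / 2")
      case True
      have "real n * q i * (1 / 4) \<le> real n * q i * (3 / 4 - real n * q i)"
        using True q0[of i] by (intro mult_left_mono) auto
      then have "real n * q i * (1 / 4) \<le> a i" using key[of n] by linarith
      then show ?thesis by (simp add: n_def)
    next
      \<comment> \<open>Here m is reduced until m q lies in (1/4, 1/2], which needs q < 1/4. Then a
        i >= 1/16, against the eventual bound on a.\<close>
      case False
      then have qpos: "q i > 0" using q0[of i] by (cases "q i = 0") auto
      define m where "m = nat \<lfloor>1 / (2 * q i)\<rfloor>"
      have "1 / (2 * q i) > 0" using qpos by simp
      then have m1: "real m \<le> 1 / (2 * q i)" and m2: "1 / (2 * q i) < real m + 1"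
        unfolding m_def by linarith+
      have mq1: "real m * q i \<le> 1 / 2" using m1 qpos by (simp add: field_simps)
      have "1 / 2 < (real m + 1) * q i" using m2 qpos by (simp add: field_simps)
      then have mq2: "1 / 4 < real m * q i" using elim(2) by (simp add: algebra_simps)
      have "real m * q i < real n * q i" using mq1 False by linarith
      then have "m \<le> n" using qpos by simp
      have "1 / 4 * (1 / 4) \<le> real m * q i * (3 / 4 - real m * q i)"
        using mq1 mq2 by (intro mult_mono) auto
      then show ?thesis using key[OF \<open>m \<le> n\<close>] elim(1) by simp
    qed
  qed
  then obtain k where k: "\<And>i. i \<ge> k \<Longrightarrow> 2 ^ i * q i \<le> 4 * a i" by (auto simp: eventually_sequentially)
  have sq: "summable (\<lambda>i. (2 * r) ^ i * q i)"
  proof (rule summable_comparison_test')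
    show "summable (\<lambda>i. 4 * (r ^ i * a i))" unfolding a_def by (intro summable_mult sum)
    fix i assume "i \<ge> k"
    then have "r ^ i * (2 ^ i * q i) \<le> r ^ i * (4 * a i)" using r by (intro mult_left_mono k) auto
    then show "norm ((2 * r) ^ i * q i) \<le> 4 * (r ^ i * a i)"
      using r q0[of i] by (simp add: power_mult_distrib algebra_simps)
  qed
  \<comment> \<open>The index is shifted by 4 for the constant 16 and once more to pass from the
    weak to the strict inequality for G.\<close>
  have "summable (\<lambda>i. (2 * r) ^ (i + 5) * measure \<nu> {z. 2 ^ (i + 5) \<le> ennreal (G z)})"
  proof (rule summable_comparison_test')
    show "summable (\<lambda>i. (2 * r) ^ 5 * ((2 * r) ^ i * q i))" by (intro summable_mult sq)
    fix i :: nat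
    have "measure \<nu> {z. 2 ^ (i + 5) \<le> ennreal (G z)} \<le> q i"
      unfolding q_def
    proof (rule M.finite_measure_mono)
      show "{z. 2 ^ (i + 5) \<le> ennreal (G z)} \<subseteq> {z. 2 ^ (i + 4) < G z}"
      proof
        fix z assume "z \<in> {z. 2 ^ (i + 5) \<le> ennreal (G z)}"
        then have "2 ^ (i + 5) \<le> G z" using pow2_le_ennreal_iff[OF G0] by blast
        moreover have "(2::real) ^ (i + 4) < 2 ^ (i + 5)" by (intro power_strict_increasing) auto
        ultimately have "2 ^ (i + 4) < G z" by linarith
        then show "z \<in> {z. 2 ^ (i + 4) < G z}" by simp
      qed
    qed (rule G_sets)
    then have "(2 * r) ^ (i + 5) * measure \<nu> {z. 2 ^ (i + 5) \<le> ennreal (G z)} \<le> (2 * r) ^ (i + 5) * q i"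
      using r by (intro mult_left_mono) auto
    then show "norm ((2 * r) ^ (i + 5) * measure \<nu> {z. 2 ^ (i + 5) \<le> ennreal (G z)})
        \<le> (2 * r) ^ 5 * ((2 * r) ^ i * q i)"
      using r by (simp add: power_add algebra_simps)
  qed
  then show ?thesis by (subst (asm) summable_iff_shift)
qed

end

section \<open>Lindley's recursion and dyadic exponential sums\<close>

lemma exp_minus_le_quadratic:
  fixes u :: real assumes "\<bar>u\<bar> \<le> 1"
  shows "exp (- u) \<le> 1 - u + u\<^sup>2"
proof (cases "u \<le> 0")
  case True
  then show ?thesis using exp_bound[of "- u"] assms by simp
next
  case False
  have "exp (- u) = 1 / exp u" by (simp add: exp_minus field_simps)
  also have "\<dots> \<le> 1 / (1 + u)"
    using exp_ge_add_one_self[of u] False by (intro divide_left_mono) auto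
  also have "\<dots> \<le> 1 - u + u\<^sup>2"
  proof -
    have "(1 - u + u\<^sup>2) * (1 + u) = 1 + u ^ 3" by (simp add: algebra_simps power2_eq_square power3_eq_cube)
    then have "1 \<le> (1 - u + u\<^sup>2) * (1 + u)" using False by simp
    then show ?thesis using False by (simp add: divide_le_eq)
  qed
  finally show ?thesis .
qed

lemma powr_le_exp:
  fixes u s :: real assumes "u > 0" "s > 0"
  shows "u powr s \<le> s powr s * exp u"
proof -
  have "ln (u / s) \<le> u / s" using ln_le_minus_one[of "u / s"] assms by simp
  then have "s * ln (u / s) \<le> u" using assms by (simp add: field_simps)
  then have "(u / s) powr s \<le> exp u" using assms by (simp add: powr_def)
  moreover have "u powr s = s powr s * (u / s) powr s"
    using assms by (simp add: powr_divide)
  ultimately show ?thesis by (simp add: mult_left_mono)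
qed

text \<open>The exponential cuts the series off when 2^j is of order g. Up to the dyadic exponent of
  g the terms are bounded by a geometric sum of order g^q; beyond it a power bound on the
  exponential outweighs the growth of the weights.\<close>

lemma dyadic_exp_suminf_le:
  assumes q: "q > 0" and \<kappa>: "\<kappa> > 0"
  shows "\<exists>K\<ge>0. \<forall>g\<ge>1. (\<Sum>j. ennreal ((2 powr q) ^ j * exp (- \<kappa> * 2 ^ j / g))) \<le> ennreal (K * g powr q)"
proof -
  define \<rho> where "\<rho> = 2 powr q"
  have \<rho>: "\<rho> > 1" using q by (simp add: \<rho>_def)
  \<comment> \<open>With exp (-u) <= s^s u^(-s) and s = 2q, the growth \<open>\<rho>\<close>^j of
    the weights turns into the decay \<open>\<rho>\<close>^(-j), at the price of g^(2q).\<close>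
  define s where "s = 2 * q"
  define B where "B = s powr s * \<kappa> powr (- s)"
  have B: "B \<ge> 0" by (simp add: B_def)
  define K where "K = \<rho> / (\<rho> - 1) + B * (\<rho> / (\<rho> - 1))"
  have "(\<Sum>j. ennreal (\<rho> ^ j * exp (- \<kappa> * 2 ^ j / g))) \<le> ennreal (K * g powr q)" if g: "g \<ge> 1" for g :: real
  proof -
    obtain j0 where j0: "2 ^ j0 \<le> g" "g < 2 ^ Suc j0" "\<And>i. 2 ^ i \<le> g \<longleftrightarrow> i \<le> j0"
      using dyadic_index[OF g] by blast
    define b where "b j = (if j < Suc j0 then 0 else B * g powr s * (1 / \<rho>) ^ j)" for j
    have b0: "0 \<le> b j" for j using B \<rho> by (simp add: b_def)
    have tail: "\<rho> ^ j * exp (- \<kappa> * 2 ^ j / g) \<le> B * g powr s * (1 / \<rho>) ^ j" for j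
    proof -
      define u where "u = \<kappa> * 2 ^ j / g"
      have u: "u > 0" using \<kappa> g by (simp add: u_def)
      have "u powr s \<le> s powr s * exp u" using u q by (intro powr_le_exp) (auto simp: s_def)
      then have "exp (- u) \<le> s powr s * u powr (- s)"
        using u by (simp add: exp_minus powr_minus field_simps)
      also have "u powr (- s) = \<kappa> powr (- s) * (2 ^ j) powr (- s) * g powr s"
        using \<kappa> g by (simp add: u_def powr_mult powr_divide powr_minus field_simps)
      finally have "\<rho> ^ j * exp (- u) \<le> \<rho> ^ j * (s powr s * (\<kappa> powr (- s) * (2 ^ j) powr (- s) * g powr s))"
        using \<rho> by (intro mult_left_mono) auto
      also have "\<dots> = B * g powr s * (\<rho> ^ j * (2 ^ j) powr (- s))" by (simp add: B_def)
      also have "\<rho> ^ j * (2 ^ j) powr (- s) = (1 / \<rho>) ^ j"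
      proof -
        have "\<rho> ^ j * (2 ^ j) powr (- s) = (2 ^ j) powr q * (2 ^ j) powr (- s)"
          by (simp add: pow2_powr \<rho>_def)
        also have "\<dots> = (2 ^ j) powr (- q)" by (simp add: s_def flip: powr_add)
        also have "\<dots> = (1 / \<rho>) ^ j" by (simp add: pow2_powr \<rho>_def powr_minus divide_inverse power_inverse)
        finally show ?thesis .
      qed
      finally show ?thesis by (simp add: u_def)
    qed
    have "(\<Sum>j. ennreal (\<rho> ^ j * exp (- \<kappa> * 2 ^ j / g)))
        \<le> (\<Sum>j. ennreal (\<rho> ^ j) * indicator {i. 2 ^ i \<le> ennreal g} j + ennreal (b j))"
    proof (intro suminf_le)
      fix j
      show "ennreal (\<rho> ^ j * exp (- \<kappa> * 2 ^ j / g)) \<le> ennreal (\<rho> ^ j) * indicator {i. 2 ^ i \<le> ennreal g} j + ennreal (b j)"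
      proof (cases "j \<le> j0")
        case True
        then have "2 ^ j \<le> ennreal g" using j0(3) g by (simp add: pow2_le_ennreal_iff)
        moreover have "\<rho> ^ j * exp (- \<kappa> * 2 ^ j / g) \<le> \<rho> ^ j" using \<rho> \<kappa> g by simp
        ultimately show ?thesis by (simp add: add_increasing2 ennreal_leI)
      next
        case False
        then show ?thesis using tail[of j] by (simp add: b_def add_increasing ennreal_leI)
      qed
    qed auto
    also have "\<dots> = (\<Sum>j. ennreal (\<rho> ^ j) * indicator {i. 2 ^ i \<le> ennreal g} j) + (\<Sum>j. ennreal (b j))"
      by (rule suminf_add[symmetric]) auto
    also have "(\<Sum>j. ennreal (\<rho> ^ j) * indicator {i. 2 ^ i \<le> ennreal g} j) \<le> ennreal (\<rho> / (\<rho> - 1) * g powr q)"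
      using dyadic_suminf_le_powr[OF q, of "ennreal g"] g \<rho>
      by (simp add: ennreal_powr_ennreal \<rho>_def[symmetric] flip: ennreal_mult)
    also have "(\<Sum>j. ennreal (b j)) \<le> ennreal (B * (\<rho> / (\<rho> - 1)) * g powr q)"
    proof -
      have "(\<lambda>i. B * g powr s * (1 / \<rho>) ^ Suc j0 * (1 / \<rho>) ^ i) sums (B * g powr s * (1 / \<rho>) ^ Suc j0 * (1 / (1 - 1 / \<rho>)))"
        using \<rho> by (intro sums_mult geometric_sums) auto
      also have "(\<lambda>i. B * g powr s * (1 / \<rho>) ^ Suc j0 * (1 / \<rho>) ^ i) = (\<lambda>i. b (i + Suc j0))"
        by (simp add: b_def power_add fun_eq_iff mult_ac)
      finally have sums: "b sums (B * g powr s * (1 / \<rho>) ^ Suc j0 * (1 / (1 - 1 / \<rho>)))"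
        by (subst (asm) sums_zero_iff_shift) (auto simp: b_def)
      then have "(\<Sum>j. ennreal (b j)) = ennreal (B * g powr s * (1 / \<rho>) ^ Suc j0 * (1 / (1 - 1 / \<rho>)))"
        using b0 by (subst suminf_ennreal2) (auto simp: sums_iff)
      also have "\<dots> \<le> ennreal (B * (\<rho> / (\<rho> - 1)) * g powr q)"
      proof (rule ennreal_leI)
        \<comment> \<open>As g < 2^(j0 + 1), the first tail term is of order g^(-q), which brings
          g^(2q) back to g^q.\<close>
        have "(1 / \<rho>) ^ Suc j0 = (2 ^ Suc j0) powr (- q)"
          unfolding pow2_powr by (simp add: \<rho>_def powr_minus divide_inverse)
        also have "\<dots> \<le> g powr (- q)" using j0(2) g q by (intro powr_mono2') auto
        finally have "B * g powr s * (1 / \<rho>) ^ Suc j0 * (1 / (1 - 1 / \<rho>)) \<le> B * g powr s * g powr (- q) * (1 / (1 - 1 / \<rho>))"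
          using B \<rho> by (intro mult_right_mono mult_left_mono) auto
        also have "\<dots> = B * (g powr s * g powr (- q)) * (\<rho> / (\<rho> - 1))" using \<rho> by (simp add: field_simps)
        also have "g powr s * g powr (- q) = g powr q" by (simp add: s_def flip: powr_add)
        finally show "B * g powr s * (1 / \<rho>) ^ Suc j0 * (1 / (1 - 1 / \<rho>)) \<le> B * (\<rho> / (\<rho> - 1)) * g powr q"
          by (simp add: mult_ac)
      qed
      finally show ?thesis .
    qed
    also have "ennreal (\<rho> / (\<rho> - 1) * g powr q) + ennreal (B * (\<rho> / (\<rho> - 1)) * g powr q) = ennreal (K * g powr q)"
    proof -
      have "0 \<le> \<rho> / (\<rho> - 1) * g powr q" "0 \<le> B * (\<rho> / (\<rho> - 1)) * g powr q" using \<rho> B by simp_all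
      then show ?thesis unfolding K_def distrib_right by (rule ennreal_plus[symmetric])
    qed
    finally show ?thesis by (simp add: add_mono)
  qed
  moreover have "K \<ge> 0" using \<rho> B by (simp add: K_def)
  ultimately show ?thesis unfolding \<rho>_def by blast
qed

section \<open>The depth of the walk and the sign of the mean\<close>

lemma filterlim_at_top_attains_min:
  fixes f :: "nat \<Rightarrow> real"
  assumes "filterlim f at_top sequentially"
  obtains n where "\<And>m. f n \<le> f m"
proof -
  have "eventually (\<lambda>m. f 0 < f m) sequentially" using assms by (simp add: filterlim_at_top_dense)
  then obtain N where N: "\<And>m. m \<ge> N \<Longrightarrow> f 0 < f m" by (auto simp: eventually_sequentially)
  have "Min (f ` {..N}) \<in> f ` {..N}" by (intro Min_in) auto
  then obtain n where n: "n \<le> N" "f n = Min (f ` {..N})" by (metis imageE atMost_iff)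
  have "f n \<le> f m" for m
  proof (cases "m \<le> N")
    case True then show ?thesis unfolding n(2) by (intro Min_le) auto
  next
    case False
    then have "f n \<le> f 0" unfolding n(2) by (intro Min_le) auto
    then show ?thesis using N[of m] False by simp
  qed
  then show ?thesis using that by blast
qed

lemma rwalk_Suc': "rwalk (Suc n) \<omega> = fst (\<omega> 0) + rwalk n (\<lambda>i. \<omega> (Suc i))"
  unfolding rwalk_def by (subst sum.lessThan_Suc_shift) simp

lemma rwalk_shift_at_top:
  assumes "filterlim (\<lambda>n. rwalk n \<omega>) at_top sequentially"
  shows "filterlim (\<lambda>n. rwalk n (\<lambda>i. \<omega> (Suc i))) at_top sequentially"
proof -
  have "filterlim (\<lambda>n. rwalk (Suc n) \<omega>) at_top sequentially"
    using assms filterlim_sequentially_Suc[of "\<lambda>n. rwalk n \<omega>"] by simp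
  then have "filterlim (\<lambda>n. - fst (\<omega> 0) + rwalk (Suc n) \<omega>) at_top sequentially"
    by (rule filterlim_tendsto_add_at_top[OF tendsto_const])
  then show ?thesis by (simp add: rwalk_Suc')
qed

text \<open>The supremum is taken in the extended reals, which makes measurability immediate; where
  it is infinite the value is 0. On divergent paths it is attained and equals minus the minimum of
  the walk.\<close>

definition drop_depth :: "(nat \<Rightarrow> real \<times> real) \<Rightarrow> real" where
  "drop_depth \<omega> = real_of_ereal (SUP n. ereal (- rwalk n \<omega>))"

lemma drop_depth_eqI:
  assumes "\<And>m. rwalk n \<omega> \<le> rwalk m \<omega>"
  shows "drop_depth \<omega> = - rwalk n \<omega>"
proof -
  have "(SUP n. ereal (- rwalk n \<omega>)) = ereal (- rwalk n \<omega>)"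
    using assms by (intro antisym SUP_least SUP_upper2[of n]) auto
  then show ?thesis by (simp add: drop_depth_def)
qed

text \<open>The minimum is attained either at time 0 or after the first step, and in the latter case
  it is the first step plus the minimum of the shifted walk.\<close>

lemma drop_depth_lindley:
  assumes "filterlim (\<lambda>n. rwalk n \<omega>) at_top sequentially"
  shows "drop_depth \<omega> = max 0 (drop_depth (\<lambda>i. \<omega> (Suc i)) - fst (\<omega> 0))"
    and "0 \<le> drop_depth \<omega>"
proof -
  obtain n where n: "\<And>m. rwalk n \<omega> \<le> rwalk m \<omega>"
    using filterlim_at_top_attains_min[OF assms] by blast
  obtain k where k: "\<And>m. rwalk k (\<lambda>i. \<omega> (Suc i)) \<le> rwalk m (\<lambda>i. \<omega> (Suc i))"
    using filterlim_at_top_attains_min[OF rwalk_shift_at_top[OF assms]] by blast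
  show "0 \<le> drop_depth \<omega>" using n[of 0] by (simp add: drop_depth_eqI[OF n])
  have "rwalk n \<omega> = min 0 (rwalk (Suc k) \<omega>)"
  proof (rule antisym)
    show "rwalk n \<omega> \<le> min 0 (rwalk (Suc k) \<omega>)" using n[of 0] n[of "Suc k"] by simp
    show "min 0 (rwalk (Suc k) \<omega>) \<le> rwalk n \<omega>"
    proof (cases n)
      case (Suc l)
      then show ?thesis using k[of l] by (simp add: rwalk_Suc')
    qed simp
  qed
  then show "drop_depth \<omega> = max 0 (drop_depth (\<lambda>i. \<omega> (Suc i)) - fst (\<omega> 0))"
    unfolding drop_depth_eqI[OF n] drop_depth_eqI[OF k] rwalk_Suc' by linarith
qed

context rw_space_pos
begin

lemma drop_depth_measurable [measurable]: "drop_depth \<in> borel_measurable S"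
  unfolding drop_depth_def[abs_def] by measurable

text \<open>Let \<open>V'\<close> be the depth of the shifted walk, which is distributed as the depth \<open>V\<close>.  By Lindley's
  recursion \<open>V = max 0 (V' - \<xi>)\<close>, so truncating \<open>V - V'\<close> at level \<open>a\<close>, taking expectations and
  letting \<open>a\<close> tend to infinity gives \<open>E \<xi> = E max 0 (\<xi> - V')\<close>.  This is positive since the walk
  stays nonnegative with positive probability, that is \<open>P(V' = 0) > 0\<close>.\<close>

lemma expectation_pos_of_divergent:
  assumes int: "integrable \<nu> fst"
    and div: "AE \<omega> in S. filterlim (\<lambda>n. rwalk n \<omega>) at_top sequentially"
  shows "(\<integral>z. fst z \<partial>\<nu>) > 0"
proof (rule ccontr)
  assume neg: "\<not> (\<integral>z. fst z \<partial>\<nu>) > 0"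
  have coord: "distr S \<nu> (\<lambda>\<omega>. \<omega> 0) = \<nu>"
    by (rule distr_PiM_component) (auto intro: M.prob_space_axioms)
  have comp0: "(\<lambda>\<omega>. \<omega> 0) \<in> measurable S \<nu>" by (rule measurable_component_singleton) simp
  have int0: "integrable S (\<lambda>\<omega>. fst (\<omega> 0))"
    using integrable_distr[OF comp0, of fst] int by (simp add: coord)
  have exp0: "(\<integral>\<omega>. fst (\<omega> 0) \<partial>S) = (\<integral>z. fst z \<partial>\<nu>)"
    using integral_distr[OF comp0 measurable_fst_nu] by (simp add: coord)
  have shift: "(\<lambda>\<omega> i. \<omega> (Suc i)) \<in> measurable S S" by (rule measurable_reindex)
  have inj: "inj Suc" by simp
  define V where "V \<omega> = drop_depth (\<lambda>i. \<omega> (Suc i))" for \<omega>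
  have [measurable]: "V \<in> borel_measurable S"
    unfolding V_def[abs_def] by (rule measurable_compose[OF shift drop_depth_measurable])
  have [measurable]: "(\<lambda>\<omega>. fst (\<omega> 0)) \<in> borel_measurable S"
    by (rule measurable_compose[OF comp0 measurable_fst_nu])
  \<comment> \<open>The depth need not be integrable, hence the truncation at a; both truncated
    depths have the same mean because V is equal in law to \<open>drop_depth\<close>. The difference
    is bounded by the absolute value of the first step, uniformly in a, since min a and max 0 are
    1-Lipschitz.\<close>
  define h where "h a \<omega> = min (real a) (drop_depth \<omega>) - min (real a) (V \<omega>)" for a \<omega>
  have rec: "AE \<omega> in S. drop_depth \<omega> = max 0 (V \<omega> - fst (\<omega> 0)) \<and> 0 \<le> drop_depth \<omega> \<and> 0 \<le> V \<omega>"
    using div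
  proof eventually_elim
    case (elim \<omega>)
    show ?case using drop_depth_lindley[OF elim] drop_depth_lindley(2)[OF rwalk_shift_at_top[OF elim]]
      by (simp add: V_def)
  qed
  have "(\<integral>\<omega>. h a \<omega> \<partial>S) = 0" for a
  proof -
    have i1: "integrable S (\<lambda>\<omega>. min (real a) (drop_depth \<omega>))"
    proof (rule P.integrable_const_bound[where B="real a"])
      show "AE \<omega> in S. norm (min (real a) (drop_depth \<omega>)) \<le> real a"
        using rec by eventually_elim auto
    qed measurable
    have "integrable S (\<lambda>\<omega>. min (real a) (V \<omega>))"
    proof (rule P.integrable_const_bound[where B="real a"])
      show "AE \<omega> in S. norm (min (real a) (V \<omega>)) \<le> real a"
        using rec by eventually_elim auto
    qed measurable
    then have "(\<integral>\<omega>. h a \<omega> \<partial>S) = (\<integral>\<omega>. min (real a) (drop_depth \<omega>) \<partial>S) - (\<integral>\<omega>. min (real a) (V \<omega>) \<partial>S)"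
      unfolding h_def using i1 by simp
    also have "(\<integral>\<omega>. min (real a) (V \<omega>) \<partial>S) = (\<integral>\<omega>. min (real a) (drop_depth \<omega>) \<partial>distr S S (\<lambda>\<omega> i. \<omega> (Suc i)))"
      unfolding V_def by (rule integral_distr[OF shift, symmetric]) measurable
    finally show ?thesis by (simp add: distr_reindex[OF inj])
  qed
  moreover have "(\<lambda>a. \<integral>\<omega>. h a \<omega> \<partial>S) \<longlonglongrightarrow> (\<integral>\<omega>. - fst (\<omega> 0) + max 0 (fst (\<omega> 0) - V \<omega>) \<partial>S)"
  proof (rule integral_dominated_convergence)
    show "integrable S (\<lambda>\<omega>. \<bar>fst (\<omega> 0)\<bar>)" using int0 by simp
    show "AE \<omega> in S. (\<lambda>a. h a \<omega>) \<longlonglongrightarrow> - fst (\<omega> 0) + max 0 (fst (\<omega> 0) - V \<omega>)"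
      using rec
    proof eventually_elim
      case (elim \<omega>)
      obtain b :: nat where b: "max (drop_depth \<omega>) (V \<omega>) \<le> real b" using real_arch_simple by blast
      have "h a \<omega> = - fst (\<omega> 0) + max 0 (fst (\<omega> 0) - V \<omega>)" if "a \<ge> b" for a
      proof -
        have "real b \<le> real a" using that by simp
        then have "h a \<omega> = drop_depth \<omega> - V \<omega>" using b unfolding h_def by linarith
        then show ?thesis using elim by linarith
      qed
      then show ?case by (intro tendsto_eventually) (auto simp: eventually_sequentially)
    qed
    show "AE \<omega> in S. norm (h a \<omega>) \<le> \<bar>fst (\<omega> 0)\<bar>" for a
      using rec by eventually_elim (auto simp: h_def)
  qed (auto simp: h_def)
  ultimately have "(\<integral>\<omega>. - fst (\<omega> 0) + max 0 (fst (\<omega> 0) - V \<omega>) \<partial>S) = 0"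
    using LIMSEQ_unique[OF tendsto_const, of 0] by simp
  moreover have imax: "integrable S (\<lambda>\<omega>. max 0 (fst (\<omega> 0) - V \<omega>))"
  proof (rule Bochner_Integration.integrable_bound[OF int0])
    show "AE \<omega> in S. norm (max 0 (fst (\<omega> 0) - V \<omega>)) \<le> norm (fst (\<omega> 0))"
      using rec by eventually_elim auto
  qed measurable
  ultimately have "(\<integral>\<omega>. max 0 (fst (\<omega> 0) - V \<omega>) \<partial>S) = (\<integral>\<omega>. fst (\<omega> 0) \<partial>S)"
    using int0 by simp
  then have "(\<integral>\<omega>. max 0 (fst (\<omega> 0) - V \<omega>) \<partial>S) = 0"
    using neg exp0 Bochner_Integration.integral_nonneg[of S "\<lambda>\<omega>. max 0 (fst (\<omega> 0) - V \<omega>)"] by simp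
  then have "AE \<omega> in S. max 0 (fst (\<omega> 0) - V \<omega>) = 0"
    using imax by (subst (asm) integral_nonneg_eq_0_iff_AE) auto
  then have AE1: "AE \<omega> in S. \<not> (fst (\<omega> 0) > 0 \<and> drop_depth (\<lambda>i. \<omega> (i + 1)) = 0)"
    by eventually_elim (auto simp: V_def)
  have "emeasure S {\<omega>\<in>space S. fst (\<omega> 0) > 0 \<and> drop_depth (\<lambda>i. \<omega> (i + 1)) = 0}
      = emeasure S {\<omega>\<in>space S. fst (\<omega> 0) > 0} * emeasure S {\<omega>\<in>space S. drop_depth \<omega> = 0}"
    by (rule emeasure_markov) auto
  moreover have "emeasure S {\<omega>\<in>space S. fst (\<omega> 0) > 0 \<and> drop_depth (\<lambda>i. \<omega> (i + 1)) = 0} = 0"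
    using AE1 by (intro emeasure_eq_0_AE) auto
  moreover have "emeasure S {\<omega>\<in>space S. fst (\<omega> 0) > 0} \<noteq> 0"
    using emeasure_coord[of "\<lambda>z. fst z > 0" 0] pos by (simp add: M.emeasure_eq_measure)
  ultimately have "emeasure S {\<omega>\<in>space S. drop_depth \<omega> = 0} = 0" by simp
  moreover have sets0: "{\<omega>\<in>space S. drop_depth \<omega> = 0} \<in> sets S" by measurable
  ultimately have "{\<omega>\<in>space S. drop_depth \<omega> = 0} \<in> null_sets S" by blast
  then have "AE \<omega> in S. drop_depth \<omega> \<noteq> 0" unfolding AE_iff_null_sets[OF sets0] by simp
  \<comment> \<open>If depth 0 had probability 0, then almost surely no shifted walk would have
    depth 0. But the walk restarted at a time where S attains its minimum does.\<close>
  then have "AE \<omega> in S. drop_depth (\<lambda>i. \<omega> (i + m)) \<noteq> 0" for m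
    by (rule AE_reindex[rotated]) (auto simp: inj_on_def)
  then have "AE \<omega> in S. \<forall>m. drop_depth (\<lambda>i. \<omega> (i + m)) \<noteq> 0" by (simp add: AE_all_countable)
  with div have "AE \<omega> in S. False"
  proof eventually_elim
    case (elim \<omega>)
    obtain n where n: "\<And>m. rwalk n \<omega> \<le> rwalk m \<omega>"
      using filterlim_at_top_attains_min[OF elim(1)] by blast
    have "rwalk 0 (\<lambda>i. \<omega> (i + n)) \<le> rwalk m (\<lambda>i. \<omega> (i + n))" for m
      using n[of "n + m"] by (simp add: rwalk_add)
    then have "drop_depth (\<lambda>i. \<omega> (i + n)) = 0" using drop_depth_eqI[of 0] by simp
    then show ?case using elim(2) by blast
  qed
  then show False by simp
qed

end

section \<open>The sufficiency of the moment condition\<close>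

definition clip :: "real \<Rightarrow> real \<Rightarrow> real" where
  "clip x v = max (- x) (min x v)"

lemma clip_eq: "x \<ge> 0 \<Longrightarrow> clip x v = min (max v 0) x - min (max (- v) 0) x"
  unfolding clip_def by linarith

text \<open>The number of visits is at most one more than the last visit L. If L lies in block j
  this is at most 2^(j+2), whence the factor r^2; the summand 1 covers paths with no visit after
  time 0.\<close>

lemma powr_Nrwalk_le_blocks:
  assumes p: "p > 0" and fin: "Nrwalk a \<omega> < \<infinity>"
  defines "r \<equiv> 2 powr p"
  shows "ennreal_powr (Nrwalk a \<omega>) p \<le> 1 + ennreal (r\<^sup>2) *
    (\<Sum>j. ennreal (r ^ j) * indicator {j. \<exists>k. 2 ^ j \<le> k \<and> k < 2 * 2 ^ j \<and> rwalk k \<omega> \<le> a} j)"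
proof -
  let ?H = "{j. \<exists>k. 2 ^ j \<le> k \<and> k < 2 * 2 ^ j \<and> rwalk k \<omega> \<le> a}"
  define V where "V = {n. rwalk n \<omega> \<le> a}"
  have r: "r > 1" using p by (simp add: r_def)
  have V: "finite V"
    using fin by (cases "finite V") (auto simp: Nrwalk_def V_def)
  have N: "Nrwalk a \<omega> = ennreal (real (card V))"
    using V by (simp add: Nrwalk_def V_def[symmetric] emeasure_count_space_finite ennreal_of_nat_eq_real_of_nat)
  show ?thesis
  proof (cases "V \<subseteq> {0}")
    case True
    then have "card V \<le> 1" using card_mono[of "{0}" V] by simp
    then have "real (card V) powr p \<le> 1" using p powr_mono2[of p "real (card V)" 1] by simp
    then have "ennreal_powr (Nrwalk a \<omega>) p \<le> 1" unfolding N by (simp add: ennreal_powr_ennreal)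
    then show ?thesis by (meson add_increasing2 order_trans zero_le order_refl)
  next
    case False
    define L where "L = Max V"
    have ne: "V \<noteq> {}" using False by auto
    have LV: "L \<in> V" unfolding L_def using V ne by (rule Max_in)
    have VL: "V \<subseteq> {..L}" unfolding L_def using V by auto
    have L1: "L \<ge> 1" using False VL by (cases L) auto
    obtain j where j: "2 ^ j \<le> L" "L < 2 ^ (j + 1)" using ex_power_ivl1[of 2 L] L1 by auto
    have "card V \<le> Suc L" using card_mono[OF _ VL] by simp
    also have "\<dots> \<le> 2 ^ (j + 2)" using j(2) by simp
    finally have "real (card V) \<le> real (2 ^ (j + 2))" by (rule of_nat_mono)
    then have "real (card V) powr p \<le> (2 ^ (j + 2)) powr p" using p by (intro powr_mono2) auto
    also have "\<dots> = r\<^sup>2 * r ^ j" unfolding pow2_powr r_def by (simp add: power_add power2_eq_square)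
    finally have "ennreal_powr (Nrwalk a \<omega>) p \<le> ennreal (r\<^sup>2) * ennreal (r ^ j)"
      unfolding N using r by (simp add: ennreal_powr_ennreal ennreal_mult[symmetric] ennreal_leI)
    also have "ennreal (r ^ j) = (\<Sum>j\<in>{j}. ennreal (r ^ j) * indicator ?H j)"
    proof -
      have "j \<in> ?H" using j LV by (auto simp: V_def intro!: exI[of _ L])
      then show ?thesis by simp
    qed
    also have "\<dots> \<le> (\<Sum>j. ennreal (r ^ j) * indicator ?H j)" by (intro sum_le_suminf) auto
    finally show ?thesis by (meson add_increasing mult_left_mono order_trans zero_le order_refl)
  qed
qed

context rw_space_pos
begin

lemma neg_integrable: "0 \<le> x \<Longrightarrow> integrable \<nu> (\<lambda>z. min (max (- fst z) 0) x)"
  by (rule M.integrable_const_bound[where B=x]) auto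

text \<open>At v = min u x one has v = A v * J v; the first factor is then enlarged to A x and the
  second to J u. With u = \<open>\<xi>\<close>^- this bounds a truncated negative part by A x times
  G.\<close>

lemma min_le_A_mult_J:
  assumes "0 \<le> u" "0 \<le> x"
  shows "min u x \<le> A x * J u"
proof -
  have "min u x = A (min u x) * J (min u x)" using assms by (simp add: A_mult_J)
  also have "\<dots> \<le> A x * J u"
    using assms J_ge_1[of "min u x"] by (intro mult_mono A_mono J_mono A_nonneg) auto
  finally show ?thesis .
qed

text \<open>If \<open>A\<close> is unbounded, then \<open>min (\<xi>\<^sup>-) x \<le> l + A x * G * 1(\<xi>\<^sup>- > l)\<close> with \<open>E (G * 1(\<xi>\<^sup>- > l))\<close> small
  suffices; if \<open>A\<close> is bounded, then \<open>\<xi>\<close> is integrable with positive mean.\<close>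

lemma truncated_drift:
  assumes G: "integrable \<nu> G"
    and div: "AE \<omega> in S. filterlim (\<lambda>n. rwalk n \<omega>) at_top sequentially"
  obtains c x\<^sub>0 where "0 < c" "c \<le> 1" "0 < x\<^sub>0"
    "\<And>x. x \<ge> x\<^sub>0 \<Longrightarrow> (\<integral>z. min (max (- fst z) 0) x \<partial>\<nu>) \<le> (1 - c) * A x"
proof (cases "\<forall>K. \<exists>x\<ge>0. A x > K")
  case True
  have G0: "0 \<le> G z" for z using G_ge_1[of z] by linarith
  have "(\<lambda>n. \<integral>z. G z * indicator {z. real n < - fst z} z \<partial>\<nu>) \<longlonglongrightarrow> (\<integral>z. 0 \<partial>\<nu>)"
  proof (rule integral_dominated_convergence[where w=G])
    show "AE z in \<nu>. (\<lambda>n. G z * indicator {z. real n < - fst z} z) \<longlonglongrightarrow> 0"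
    proof (rule AE_I2)
      fix z :: "real \<times> real"
      obtain N :: nat where N: "- fst z \<le> real N" using real_arch_simple by blast
      have "G z * indicator {z. real n < - fst z} z = 0" if "n \<ge> N" for n
        using N that by (auto simp: indicator_def)
      then show "(\<lambda>n. G z * indicator {z. real n < - fst z} z) \<longlonglongrightarrow> 0"
        by (intro tendsto_eventually) (auto simp: eventually_sequentially)
    qed
    show "AE z in \<nu>. norm (G z * indicator {z. real n < - fst z} z) \<le> G z" for n
      using G0 by (intro AE_I2) (auto simp: indicator_def)
  qed (use G in measurable)
  then have "eventually (\<lambda>n. (\<integral>z. G z * indicator {z. real n < - fst z} z \<partial>\<nu>) < 1 / 4) sequentially"
    by (intro order_tendstoD) auto
  then obtain l :: nat where l: "(\<integral>z. G z * indicator {z. real l < - fst z} z \<partial>\<nu>) < 1 / 4"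
    by (auto simp: eventually_sequentially)
  \<comment> \<open>Negative parts up to l contribute at most l < A x / 4, those beyond l at most A
    x / 4; hence c = 1/2.\<close>
  obtain x1 where x1: "x1 \<ge> 0" "A x1 > 4 * real l" using True by blast
  define x0 where "x0 = max 1 x1"
  have bound: "(\<integral>z. min (max (- fst z) 0) x \<partial>\<nu>) \<le> (1 - 1 / 2) * A x" if x: "x \<ge> x0" for x
  proof -
    have x': "x \<ge> 0" "x \<ge> x1" using x by (auto simp: x0_def)
    have iG: "integrable \<nu> (\<lambda>z. G z * indicator {z. real l < - fst z} z)"
      by (rule Bochner_Integration.integrable_bound[OF G]) (auto simp: indicator_def)
    have "(\<integral>z. min (max (- fst z) 0) x \<partial>\<nu>) \<le> (\<integral>z. real l + A x * (G z * indicator {z. real l < - fst z} z) \<partial>\<nu>)"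
    proof (rule integral_mono)
      show "integrable \<nu> (\<lambda>z. real l + A x * (G z * indicator {z. real l < - fst z} z))"
        using iG by simp
      fix z
      show "min (max (- fst z) 0) x \<le> real l + A x * (G z * indicator {z. real l < - fst z} z)"
      proof (cases "real l < - fst z")
        case True
        then show ?thesis using min_le_A_mult_J[of "max (- fst z) 0" x] x' by (simp add: G_def)
      next
        case False
        then show ?thesis by auto
      qed
    qed (rule neg_integrable[OF x'(1)])
    also have "\<dots> = real l + A x * (\<integral>z. G z * indicator {z. real l < - fst z} z \<partial>\<nu>)"
      using iG by (simp add: M.prob_space[unfolded space_nu])
    also have "\<dots> \<le> real l + A x * (1 / 4)"
      using l A_nonneg[OF x'(1)] by (intro add_left_mono mult_left_mono) auto
    also have "\<dots> \<le> (1 - 1 / 2) * A x"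
      using x1 A_mono[OF x1(1) x'(2)] by simp
    finally show ?thesis .
  qed
  show ?thesis by (rule that[of "1/2" x0]) (use bound in \<open>auto simp: x0_def\<close>)
next
  case False
  \<comment> \<open>Monotone convergence along A n makes the positive part integrable, and the
    negative part u satisfies u = A u * J u <= K * G.\<close>
  then obtain K where K: "\<And>x. x \<ge> 0 \<Longrightarrow> A x \<le> K" by (auto simp: not_less)
  have K0: "0 \<le> K" using K[of 0] A_nonneg[of 0] by simp
  have "(\<integral>\<^sup>+z. ennreal (max (fst z) 0) \<partial>\<nu>) = (\<integral>\<^sup>+z. (SUP n. ennreal (min (max (fst z) 0) (real n))) \<partial>\<nu>)"
  proof (rule nn_integral_cong)
    fix z :: "real \<times> real"
    obtain N :: nat where N: "max (fst z) 0 \<le> real N" using real_arch_simple by blast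
    show "ennreal (max (fst z) 0) = (SUP n. ennreal (min (max (fst z) 0) (real n)))"
    proof (rule antisym)
      show "ennreal (max (fst z) 0) \<le> (SUP n. ennreal (min (max (fst z) 0) (real n)))"
        using N by (intro SUP_upper2[of N]) auto
      show "(SUP n. ennreal (min (max (fst z) 0) (real n))) \<le> ennreal (max (fst z) 0)"
        by (intro SUP_least ennreal_leI min.cobounded1)
    qed
  qed
  also have "\<dots> = (SUP n. \<integral>\<^sup>+z. ennreal (min (max (fst z) 0) (real n)) \<partial>\<nu>)"
    by (rule nn_integral_monotone_convergence_SUP) (auto simp: incseq_def le_fun_def intro!: ennreal_leI)
  also have "\<dots> \<le> ennreal K"
    by (rule SUP_least) (auto simp flip: M.ennreal_A_plus[OF measurable_fst_nu] intro!: ennreal_leI K)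
  finally have "(\<integral>\<^sup>+z. ennreal (max (fst z) 0) \<partial>\<nu>) \<le> ennreal K" .
  then have "(\<integral>\<^sup>+z. ennreal (max (fst z) 0) \<partial>\<nu>) < \<infinity>" by (rule le_less_trans) simp
  then have ip: "integrable \<nu> (\<lambda>z. max (fst z) 0)" by (intro integrableI_nonneg) auto
  have im: "integrable \<nu> (\<lambda>z. max (- fst z) 0)"
  proof (rule Bochner_Integration.integrable_bound)
    show "integrable \<nu> (\<lambda>z. K * G z)" using G by simp
    have "max (- fst z) 0 \<le> K * G z" for z
    proof -
      let ?u = "max (- fst z) 0"
      have "?u \<le> A ?u * J ?u" using min_le_A_mult_J[of ?u ?u] by simp
      also have "\<dots> \<le> K * G z" unfolding G_def using K J_ge_1[of ?u] by (intro mult_right_mono) auto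
      finally show ?thesis .
    qed
    then show "AE z in \<nu>. norm (max (- fst z) 0) \<le> norm (K * G z)" 
      by (intro AE_I2) (smt (verit) real_norm_def)
  qed measurable
  have fst_eq: "fst z = max (fst z) 0 - max (- fst z) 0" for z :: "real \<times> real" by simp
  have "integrable \<nu> fst" by (subst fst_eq[abs_def]) (intro Bochner_Integration.integrable_diff ip im)
  then have "(\<integral>z. fst z \<partial>\<nu>) > 0" using div by (rule expectation_pos_of_divergent)
  moreover have "(\<integral>z. fst z \<partial>\<nu>) = (\<integral>z. max (fst z) 0 \<partial>\<nu>) - (\<integral>z. max (- fst z) 0 \<partial>\<nu>)"
    by (subst fst_eq) (rule Bochner_Integration.integral_diff[OF ip im])
  ultimately have d: "(\<integral>z. max (fst z) 0 \<partial>\<nu>) - (\<integral>z. max (- fst z) 0 \<partial>\<nu>) > 0" (is "?d > 0") by simp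
  have "(\<lambda>n. \<integral>z. min (max (fst z) 0) (real n) \<partial>\<nu>) \<longlonglongrightarrow> (\<integral>z. max (fst z) 0 \<partial>\<nu>)"
  proof (rule integral_dominated_convergence[OF _ _ ip])
    show "AE z in \<nu>. (\<lambda>n. min (max (fst z) 0) (real n)) \<longlonglongrightarrow> max (fst z) 0"
    proof (rule AE_I2)
      fix z :: "real \<times> real"
      obtain N :: nat where N: "max (fst z) 0 \<le> real N" using real_arch_simple by blast
      have "min (max (fst z) 0) (real n) = max (fst z) 0" if "n \<ge> N" for n
        using N that by (simp add: min_def)
      then show "(\<lambda>n. min (max (fst z) 0) (real n)) \<longlonglongrightarrow> max (fst z) 0"
        by (intro tendsto_eventually) (auto simp: eventually_sequentially)
    qed
  qed auto
  then have "(\<lambda>n. A (real n)) \<longlonglongrightarrow> (\<integral>z. max (fst z) 0 \<partial>\<nu>)" by (simp add: A_eq)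
  then have "eventually (\<lambda>n. (\<integral>z. max (fst z) 0 \<partial>\<nu>) - ?d / 2 < A (real n)) sequentially"
    using d by (intro order_tendstoD) auto
  then obtain n where n: "(\<integral>z. max (fst z) 0 \<partial>\<nu>) - ?d / 2 < A (real n)" by (auto simp: eventually_sequentially)
  define x0 where "x0 = real n + 1"
  \<comment> \<open>\<open>?d\<close> is the mean of the first component. Truncation at n loses less
    than \<open>?d / 2\<close> of the mean of its positive part, and this c keeps c * A x within the
    other half; K + 1 keeps the denominator positive.\<close>
  define c where "c = min 1 (?d / (2 * (K + 1)))"
  have c: "0 < c" "c \<le> 1" using d K0 by (auto simp: c_def)
  have bound: "(\<integral>z. min (max (- fst z) 0) x \<partial>\<nu>) \<le> (1 - c) * A x" if x: "x \<ge> x0" for x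
  proof -
    have x': "x \<ge> 0" "real n \<le> x" using x by (auto simp: x0_def)
    have "(\<integral>z. min (max (- fst z) 0) x \<partial>\<nu>) \<le> (\<integral>z. max (- fst z) 0 \<partial>\<nu>)"
      by (intro integral_mono neg_integrable x' im) simp
    moreover have "A (real n) \<le> A x" using x' by (intro A_mono) auto
    moreover have "c * A x \<le> ?d / 2"
    proof -
      have "c * A x \<le> ?d / (2 * (K + 1)) * (K + 1)"
        using K[OF x'(1)] A_nonneg[OF x'(1)] d K0 by (intro mult_mono) (auto simp: c_def)
      also have "\<dots> = ?d / 2"
      proof -
        have "K + 1 \<noteq> 0" using K0 by simp
        then show ?thesis by (simp add: divide_simps)
      qed
      finally show ?thesis .
    qed
    moreover have "(1 - c) * A x = A x - c * A x" by (simp add: algebra_simps)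
    ultimately show ?thesis using n by argo
  qed
  show ?thesis by (rule that[of c x0]) (use c bound in \<open>auto simp: x0_def\<close>)
qed

text \<open>With l = c / (4x) the exponent is at most 1/4 in absolute value, so exp (-u) <= 1 - u +
  u^2 applies, and the square of the clipped step is at most x times its absolute value. The drift
  gains at least l c A(x) = c^2 A(x) / (4x), the quadratic term loses at most 2 l^2 x A(x), which is
  half of this. The net gain is c^2 / (8 J(x)).\<close>

lemma clip_exp_moment:
  assumes c: "0 < c" "c \<le> 1" and x: "x > 0"
    and drift: "(\<integral>z. min (max (- fst z) 0) x \<partial>\<nu>) \<le> (1 - c) * A x"
  shows "(\<integral>\<^sup>+z. ennreal (exp (- (c / (4 * x) * clip x (fst z)))) \<partial>\<nu>) \<le> ennreal (exp (- (c\<^sup>2 / 8 / J x)))"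
proof -
  define l where "l = c / (4 * x)"
  have l: "l > 0" "l * x = c / 4" using c x by (auto simp: l_def)
  define B where "B = (\<integral>z. min (max (- fst z) 0) x \<partial>\<nu>)"
  let ?P = "\<lambda>z. min (max (fst z) 0) x" and ?N = "\<lambda>z. min (max (- fst z) 0) x"
  let ?f = "\<lambda>z. 1 - l * (?P z - ?N z) + l\<^sup>2 * x * (?P z + ?N z)"
  have le: "exp (- (l * clip x (fst z))) \<le> ?f z" for z
  proof -
    define y where "y = clip x (fst z)"
    have y: "\<bar>y\<bar> \<le> x" "y = ?P z - ?N z" "\<bar>y\<bar> = ?P z + ?N z"
      using x by (auto simp: y_def clip_eq) (auto simp: clip_def max_def min_def)
    have "\<bar>l * y\<bar> \<le> l * x" using l y by (simp add: abs_mult)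
    then have "\<bar>l * y\<bar> \<le> 1" using l c by simp
    then have "exp (- (l * y)) \<le> 1 - l * y + (l * y)\<^sup>2" by (rule exp_minus_le_quadratic)
    also have "(l * y)\<^sup>2 = l\<^sup>2 * (\<bar>y\<bar> * \<bar>y\<bar>)" by (simp add: power_mult_distrib power2_eq_square)
    also have "\<dots> \<le> l\<^sup>2 * (x * \<bar>y\<bar>)"
      by (rule mult_left_mono[OF mult_right_mono[OF y(1) abs_ge_zero]]) simp
    finally show ?thesis using y by (simp add: y_def mult.assoc)
  qed
  have iP: "integrable \<nu> ?P" and iN: "integrable \<nu> ?N"
    using x by (auto intro!: A_integrable neg_integrable)
  have i: "integrable \<nu> ?f" using iP iN by simp
  have "(\<integral>\<^sup>+z. ennreal (exp (- (l * clip x (fst z)))) \<partial>\<nu>) \<le> (\<integral>\<^sup>+z. ennreal (?f z) \<partial>\<nu>)"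
    using le by (intro nn_integral_mono ennreal_leI)
  also have "\<dots> = ennreal (\<integral>z. ?f z \<partial>\<nu>)"
    using le by (intro nn_integral_eq_integral i AE_I2 order_trans[OF exp_ge_zero])
  also have "(\<integral>z. ?f z \<partial>\<nu>) = 1 - l * (A x - B) + l\<^sup>2 * x * (A x + B)"
    using iP iN x by (simp add: B_def A_eq M.prob_space[unfolded space_nu])
  also have "\<dots> \<le> exp (- (c\<^sup>2 / 8 / J x))"
  proof -
    have cA: "c * A x \<le> A x - B"
      using drift unfolding B_def[symmetric] by (simp add: algebra_simps)
    moreover have "A x + B \<le> 2 * A x"
      using cA mult_nonneg_nonneg[of c "A x"] A_nonneg[of x] x c by linarith
    ultimately have "1 - l * (A x - B) + l\<^sup>2 * x * (A x + B) \<le> 1 - l * (c * A x) + l\<^sup>2 * x * (2 * A x)"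
      using l x by (intro add_mono diff_left_mono mult_left_mono) auto
    also have "\<dots> = 1 - c\<^sup>2 / 8 / J x"
    proof -
      have "c\<^sup>2 / 8 / J x = c\<^sup>2 / 8 * (A x / x)" using x by (simp add: J_plus_def)
      moreover have "l * (c * A x) = c\<^sup>2 / 4 * (A x / x)"
        by (simp add: l_def power2_eq_square)
      moreover have "l\<^sup>2 * x * (2 * A x) = c\<^sup>2 / 8 * (A x / x)"
        using x by (simp add: l_def power2_eq_square)
      ultimately show ?thesis by linarith
    qed
    also have "\<dots> \<le> exp (- (c\<^sup>2 / 8 / J x))" using exp_ge_add_one_self[of "- (c\<^sup>2 / 8 / J x)"] by simp
    finally show ?thesis .
  qed
  finally show ?thesis by (simp add: l_def ennreal_leI)
qed

text \<open>Compensating the exponential by \<open>\<kappa>\<close> per step gives factors of mean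
  at most 1, so a single maximal inequality covers all k from m on, with a bound that does not
  involve n.\<close>

lemma clip_walk_maximal:
  assumes c: "0 < c" "c \<le> 1" and x: "x > 0"
    and drift: "(\<integral>z. min (max (- fst z) 0) x \<partial>\<nu>) \<le> (1 - c) * A x"
  shows "emeasure S {\<omega>. \<exists>k\<le>n. m \<le> k \<and> (\<Sum>i<k. clip x (fst (\<omega> i))) \<le> 2 * x}
       \<le> ennreal (exp (1 - c\<^sup>2 / 8 * real m / J x))"
proof -
  define l where "l = c / (4 * x)"
  have l: "l > 0" "l * x = c / 4" using c x by (auto simp: l_def)
  define \<kappa> where "\<kappa> = c\<^sup>2 / 8 / J x"
  have \<kappa>: "\<kappa> \<ge> 0" using J_ge_1[of x] x by (simp add: \<kappa>_def)
  define w where "w z = ennreal (exp (- (l * clip x (fst z)) + \<kappa>))" for z :: "real \<times> real"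
  have [measurable]: "w \<in> borel_measurable \<nu>" unfolding w_def[abs_def] clip_def by measurable
  have "(\<integral>\<^sup>+z. w z \<partial>\<nu>) = (\<integral>\<^sup>+z. ennreal (exp (- (l * clip x (fst z)))) * ennreal (exp \<kappa>) \<partial>\<nu>)"
    by (simp only: w_def exp_add ennreal_mult exp_ge_zero)
  also have "\<dots> = (\<integral>\<^sup>+z. ennreal (exp (- (l * clip x (fst z)))) \<partial>\<nu>) * ennreal (exp \<kappa>)"
    by (rule nn_integral_multc) (simp add: clip_def)
  also have "\<dots> \<le> ennreal (exp (- \<kappa>)) * ennreal (exp \<kappa>)"
    unfolding \<kappa>_def l_def by (intro mult_right_mono clip_exp_moment assms) simp
  also have "\<dots> = 1" by (simp flip: ennreal_mult exp_add)
  finally have w: "(\<integral>\<^sup>+z. w z \<partial>\<nu>) \<le> 1" .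
  \<comment> \<open>On the event the product is at least exp (m \<open>\<kappa>\<close> - 2 l x)
    with 2 l x = c/2 <= 1, so this s lifts it to at least 1.\<close>
  define s where "s = exp (1 - \<kappa> * real m)"
  have prod: "(\<Prod>i<k. w (\<omega> i)) = ennreal (exp (- (l * (\<Sum>i<k. clip x (fst (\<omega> i)))) + real k * \<kappa>))" for k and \<omega> :: "nat \<Rightarrow> real \<times> real"
  proof -
    have "(\<Prod>i<k. w (\<omega> i)) = ennreal (\<Prod>i<k. exp (- (l * clip x (fst (\<omega> i))) + \<kappa>))"
      unfolding w_def by (rule prod_ennreal) simp
    also have "(\<Prod>i<k. exp (- (l * clip x (fst (\<omega> i))) + \<kappa>)) = exp (\<Sum>i<k. - (l * clip x (fst (\<omega> i))) + \<kappa>)"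
      by (simp add: exp_sum)
    also have "(\<Sum>i<k. - (l * clip x (fst (\<omega> i))) + \<kappa>) = - (l * (\<Sum>i<k. clip x (fst (\<omega> i)))) + real k * \<kappa>"
      by (simp add: sum_subtractf sum_distrib_left)
    finally show ?thesis .
  qed
  have "emeasure S {\<omega>. \<exists>k\<le>n. m \<le> k \<and> (\<Sum>i<k. clip x (fst (\<omega> i))) \<le> 2 * x}
      \<le> emeasure S {\<omega>\<in>space S. \<exists>k\<le>n. 1 \<le> ennreal s * (\<Prod>i<k. w (\<omega> i))}"
  proof (rule emeasure_mono)
    show "{\<omega>. \<exists>k\<le>n. m \<le> k \<and> (\<Sum>i<k. clip x (fst (\<omega> i))) \<le> 2 * x}
        \<subseteq> {\<omega>\<in>space S. \<exists>k\<le>n. 1 \<le> ennreal s * (\<Prod>i<k. w (\<omega> i))}"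
    proof
      fix \<omega> :: "nat \<Rightarrow> real \<times> real"
      assume "\<omega> \<in> {\<omega>. \<exists>k\<le>n. m \<le> k \<and> (\<Sum>i<k. clip x (fst (\<omega> i))) \<le> 2 * x}"
      then obtain k where k: "k \<le> n" "m \<le> k" "(\<Sum>i<k. clip x (fst (\<omega> i))) \<le> 2 * x" by auto
      let ?W = "\<Sum>i<k. clip x (fst (\<omega> i))"
      have "l * ?W \<le> l * (2 * x)" using k l by (intro mult_left_mono) auto
      moreover have "l * (2 * x) = c / 2" using l(2) by simp
      ultimately have "l * ?W \<le> 1" using c by linarith
      moreover have "\<kappa> * real m \<le> \<kappa> * real k" using k \<kappa> by (intro mult_left_mono) auto
      ultimately have "0 \<le> (1 - \<kappa> * real m) + (- (l * ?W) + real k * \<kappa>)" by (simp add: mult.commute)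
      then have "1 \<le> s * exp (- (l * ?W) + real k * \<kappa>)" unfolding s_def by (simp flip: exp_add)
      then have "1 \<le> ennreal s * (\<Prod>i<k. w (\<omega> i))"
        unfolding prod by (simp add: s_def flip: ennreal_mult)
      then show "\<omega> \<in> {\<omega>\<in>space S. \<exists>k\<le>n. 1 \<le> ennreal s * (\<Prod>i<k. w (\<omega> i))}" using k by auto
    qed
  qed measurable
  also have "\<dots> \<le> ennreal s" by (rule emeasure_prod_maximal[OF _ w]) measurable
  finally show ?thesis by (simp add: s_def \<kappa>_def)
qed

text \<open>The step \<open>i\<close> of largest negative part is removed; all the others are at least
  \<open>fst (\<omega> i)\<close>, so that truncating them at this level only makes the walk smaller.\<close>

lemma block_le:
  assumes c: "0 < c" "c \<le> 1" and b: "b > 0" "\<bar>a\<bar> \<le> b" and m: "m \<ge> 1"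
    and drift: "\<And>x. x \<ge> b \<Longrightarrow> (\<integral>z. min (max (- fst z) 0) x \<partial>\<nu>) \<le> (1 - c) * A x"
  shows "emeasure S {\<omega>. \<exists>k. m \<le> k \<and> k < 2 * m \<and> rwalk k \<omega> \<le> a}
       \<le> (\<integral>\<^sup>+z. ennreal (2 * real m * exp 2 * exp (- (c\<^sup>2 / 8) * real m / J (max (- fst z) b))) \<partial>\<nu>)"
proof -
  \<comment> \<open>The truncation level is the removed negative part, but at least b, so that the
    drift bound applies and a <= X.\<close>
  define X where "X z = max (- fst z) b" for z :: "real \<times> real"
  have X: "X z > 0" "X z \<ge> b" for z using b by (auto simp: X_def)
  have [measurable]: "X \<in> borel_measurable \<nu>" unfolding X_def[abs_def] by measurable
  define E where "E i = {\<omega>. (\<forall>j<2 * m. \<not> fst (\<omega> j) < fst (\<omega> i)) \<and> (\<exists>k. m \<le> k \<and> k < 2 * m \<and> rwalk k \<omega> \<le> a)}" for i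
  \<comment> \<open>Removing step i raises the position by at most x, so it is at most a + x <= 2 x.
    A time k of the block becomes k - 1 if i < k and stays k otherwise, hence the range from m - 1
    to 2m - 1.\<close>
  define Q where "Q \<omega> \<longleftrightarrow> (\<exists>k\<le>2 * m - 1. m - 1 \<le> k \<and>
      \<not> 2 * X (\<omega> 0) < (\<Sum>j<k. clip (X (\<omega> 0)) (fst (\<omega> (Suc j)))))" for \<omega>
  have [measurable]: "Measurable.pred S Q" unfolding Q_def clip_def by measurable
  have QE: "Q (\<lambda>j. \<omega> (move_front i j))" if "\<omega> \<in> E i" "i < 2 * m" for i \<omega>
  proof -
    obtain k where k: "m \<le> k" "k < 2 * m" "rwalk k \<omega> \<le> a" using \<open>\<omega> \<in> E i\<close> by (auto simp: E_def)
    define x where "x = X (\<omega> i)"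
    have x: "x > 0" "- fst (\<omega> i) \<le> x" "a \<le> x" using b X[of "\<omega> i"] by (auto simp: x_def X_def)
    have cl: "clip x (fst (\<omega> j)) \<le> fst (\<omega> j)" if "j < 2 * m" for j
    proof -
      have "fst (\<omega> i) \<le> fst (\<omega> j)" using \<open>\<omega> \<in> E i\<close> that by (auto simp: E_def not_less)
      then show ?thesis using x unfolding clip_def by linarith
    qed
    have "\<exists>k'\<le>2 * m - 1. m - 1 \<le> k' \<and> (\<Sum>j<k'. clip x (fst (\<omega> (move_front i (Suc j))))) \<le> 2 * x"
    proof (cases "i < k")
      case True
      then obtain k' where k': "k = Suc k'" by (cases k) auto
      have "(\<Sum>j<k'. clip x (fst (\<omega> (move_front i (Suc j))))) = (\<Sum>j\<in>{..<k} - {i}. clip x (fst (\<omega> j)))"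
        unfolding k' using True k' by (subst sum_move_front) auto
      also have "\<dots> \<le> (\<Sum>j\<in>{..<k} - {i}. fst (\<omega> j))" using k by (intro sum_mono cl) auto
      also have "\<dots> = rwalk k \<omega> - fst (\<omega> i)"
        unfolding rwalk_def using True by (subst sum.remove[of "{..<k}" i]) auto
      also have "\<dots> \<le> 2 * x" using k x by linarith
      finally show ?thesis using k k' by (intro exI[of _ k']) auto
    next
      case False
      have "(\<Sum>j<k. clip x (fst (\<omega> (move_front i (Suc j))))) = (\<Sum>j<k. clip x (fst (\<omega> j)))"
        using False by (intro sum.cong) auto
      also have "\<dots> \<le> (\<Sum>j<k. fst (\<omega> j))" using k by (intro sum_mono cl) auto
      also have "\<dots> \<le> 2 * x" using k x unfolding rwalk_def by linarith
      finally show ?thesis using k by (intro exI[of _ k]) auto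
    qed
    then show ?thesis unfolding Q_def x_def by (auto simp: not_less)
  qed
  have Q_le: "emeasure S {\<omega>\<in>space S. Q \<omega>} \<le> (\<integral>\<^sup>+z. ennreal (exp 2 * exp (- (c\<^sup>2 / 8) * real m / J (X z))) \<partial>\<nu>)"
  proof -
    have "emeasure S {\<omega>\<in>space S. Q \<omega>} = (\<integral>\<^sup>+z. emeasure S {\<omega>\<in>space S. Q (case_nat z \<omega>)} \<partial>\<nu>)"
      by (rule emeasure_case_nat) measurable
    also have "\<dots> \<le> (\<integral>\<^sup>+z. ennreal (exp 2 * exp (- (c\<^sup>2 / 8) * real m / J (X z))) \<partial>\<nu>)"
    proof (rule nn_integral_mono)
      fix z
      have "emeasure S {\<omega>\<in>space S. Q (case_nat z \<omega>)}
          \<le> ennreal (exp (1 - c\<^sup>2 / 8 * real (m - 1) / J (X z)))"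
        using clip_walk_maximal[OF c X(1) drift[OF X(2)], of "2 * m - 1" "m - 1" z]
        by (simp add: Q_def not_less)
      \<comment> \<open>Replacing m - 1 by m costs a factor exp (c^2 / (8 J)) <= exp 1; with the exp
        1 of the maximal inequality this gives exp 2.\<close>
      also have "\<dots> \<le> ennreal (exp 2 * exp (- (c\<^sup>2 / 8) * real m / J (X z)))"
      proof (rule ennreal_leI)
        have J1: "J (X z) \<ge> 1" using X[of z] by (intro J_ge_1) auto
        have "c\<^sup>2 \<le> 1" using c by (simp add: power_le_one)
        then have "c\<^sup>2 / 8 / J (X z) \<le> 1" using J1 by (simp add: divide_le_eq)
        moreover have "c\<^sup>2 / 8 * real (m - 1) / J (X z) = c\<^sup>2 / 8 * real m / J (X z) - c\<^sup>2 / 8 / J (X z)"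
          using m J1 by (simp add: of_nat_diff field_simps)
        ultimately have "1 - c\<^sup>2 / 8 * real (m - 1) / J (X z) \<le> 2 + - (c\<^sup>2 / 8) * real m / J (X z)" by simp
        then show "exp (1 - c\<^sup>2 / 8 * real (m - 1) / J (X z)) \<le> exp 2 * exp (- (c\<^sup>2 / 8) * real m / J (X z))"
          by (simp flip: exp_add)
      qed
      finally show "emeasure S {\<omega>\<in>space S. Q (case_nat z \<omega>)} \<le> ennreal (exp 2 * exp (- (c\<^sup>2 / 8) * real m / J (X z)))" .
    qed
    finally show ?thesis .
  qed
  have JX: "(\<lambda>z. J (X z)) \<in> borel_measurable \<nu>"
  proof -
    have "(\<lambda>z. J (max (X z) 0)) \<in> borel_measurable \<nu>"
      by (rule measurable_compose[OF _ J_measurable]) measurable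
    moreover have "max (X z) 0 = X z" for z using X[of z] by simp
    ultimately show ?thesis by simp
  qed
  have E_sets: "E i \<in> sets S" for i unfolding E_def by (intro Collect_sets_S) measurable
  have E_le: "emeasure S (E i) \<le> (\<integral>\<^sup>+z. ennreal (exp 2 * exp (- (c\<^sup>2 / 8) * real m / J (X z))) \<partial>\<nu>)" if i: "i < 2 * m" for i
  proof -
    have "emeasure S (E i) \<le> emeasure S {\<omega>\<in>space S. Q (\<lambda>j. \<omega> (move_front i j))}"
    proof (rule emeasure_mono)
      have "Measurable.pred S (\<lambda>\<omega>. Q (\<lambda>j. \<omega> (move_front i j)))"
        by (rule measurable_compose[OF measurable_reindex]) fact
      then show "{\<omega>\<in>space S. Q (\<lambda>j. \<omega> (move_front i j))} \<in> sets S" by (simp add: pred_def)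
    qed (use QE[OF _ i] in auto)
    also have "\<dots> = emeasure S {\<omega>\<in>space S. Q \<omega>}" by (rule emeasure_reindex[OF inj_move_front]) measurable
    also note Q_le
    finally show ?thesis .
  qed
  have "emeasure S {\<omega>. \<exists>k. m \<le> k \<and> k < 2 * m \<and> rwalk k \<omega> \<le> a} \<le> emeasure S (\<Union>i<2 * m. E i)"
  proof (rule emeasure_mono)
    show "{\<omega>. \<exists>k. m \<le> k \<and> k < 2 * m \<and> rwalk k \<omega> \<le> a} \<subseteq> (\<Union>i<2 * m. E i)"
    proof
      fix \<omega> assume \<omega>: "\<omega> \<in> {\<omega>. \<exists>k. m \<le> k \<and> k < 2 * m \<and> rwalk k \<omega> \<le> a}"
      let ?F = "(\<lambda>j. fst (\<omega> j)) ` {..<2 * m}"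
      have "{..<2 * m} \<noteq> {}" using m by (simp add: lessThan_empty_iff)
      then have "Min ?F \<in> ?F" by (intro Min_in) simp_all
      then obtain i where i: "Min ?F = fst (\<omega> i)" "i \<in> {..<2 * m}" by (rule imageE)
      have "\<not> fst (\<omega> j) < fst (\<omega> i)" if "j < 2 * m" for j
        unfolding i(1)[symmetric] not_less using that by (intro Min_le) auto
      then show "\<omega> \<in> (\<Union>i<2 * m. E i)" using \<omega> i by (auto simp: E_def)
    qed
  qed (use E_sets in auto)
  also have "\<dots> \<le> (\<Sum>i<2 * m. emeasure S (E i))" using E_sets by (intro emeasure_subadditive_finite) auto
  also have "\<dots> \<le> (\<Sum>i<2 * m. (\<integral>\<^sup>+z. ennreal (exp 2 * exp (- (c\<^sup>2 / 8) * real m / J (X z))) \<partial>\<nu>))"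
    by (intro sum_mono E_le) simp
  also have "\<dots> = ennreal (2 * real m) * (\<integral>\<^sup>+z. ennreal (exp 2 * exp (- (c\<^sup>2 / 8) * real m / J (X z))) \<partial>\<nu>)"
    by (simp add: ennreal_of_nat_eq_real_of_nat ennreal_mult)
  also have "\<dots> = (\<integral>\<^sup>+z. ennreal (2 * real m) * ennreal (exp 2 * exp (- (c\<^sup>2 / 8) * real m / J (X z))) \<partial>\<nu>)"
    by (rule nn_integral_cmult[symmetric]) (use JX in measurable)
  also have "\<dots> = (\<integral>\<^sup>+z. ennreal (2 * real m * exp 2 * exp (- (c\<^sup>2 / 8) * real m / J (max (- fst z) b))) \<partial>\<nu>)"
    by (simp add: X_def mult.assoc flip: ennreal_mult)
  finally show ?thesis .
qed

lemma Nrwalk_moment_of_G_moment: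
  assumes p: "p > 0"
    and div: "AE \<omega> in S. filterlim (\<lambda>n. rwalk n \<omega>) at_top sequentially"
    and G: "(\<integral>\<^sup>+z. ennreal (G z powr (p + 1)) \<partial>\<nu>) < \<infinity>"
  shows "(\<integral>\<^sup>+\<omega>. ennreal_powr (Nrwalk a \<omega>) p \<partial>S) < \<infinity>"
proof -
  \<comment> \<open>Since G >= 1, its moment of order p + 1 dominates its mean, which the drift
    estimate requires.\<close>
  have "G z \<le> G z powr (p + 1)" for z
    using powr_mono[of 1 "p + 1" "G z"] p G_ge_1[of z] by simp
  then have "(\<integral>\<^sup>+z. ennreal (G z) \<partial>\<nu>) \<le> (\<integral>\<^sup>+z. ennreal (G z powr (p + 1)) \<partial>\<nu>)"
    by (intro nn_integral_mono ennreal_leI)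
  then have "(\<integral>\<^sup>+z. ennreal (G z) \<partial>\<nu>) < \<infinity>" using G by (rule le_less_trans)
  then have "integrable \<nu> G"
    using G_ge_1 by (intro integrableI_nonneg AE_I2) (auto intro: order_trans[OF zero_le_one])
  from truncated_drift[OF this div] obtain c x0 where c: "0 < c" "c \<le> 1" and x0: "0 < x0"
    and drift: "\<And>x. x \<ge> x0 \<Longrightarrow> (\<integral>z. min (max (- fst z) 0) x \<partial>\<nu>) \<le> (1 - c) * A x" by metis
  define b where "b = max x0 \<bar>a\<bar>"
  have b: "b > 0" "\<bar>a\<bar> \<le> b" "b \<ge> x0" using x0 by (auto simp: b_def)
  define r where "r = 2 powr p"
  have r: "r > 1" using p by (simp add: r_def)
  have r2: "2 powr (p + 1) = r * 2" by (simp add: r_def powr_add)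
  define g where "g z = J (max (- fst z) b)" for z :: "real \<times> real"
  have g1: "g z \<ge> 1" for z using b unfolding g_def by (intro J_ge_1) auto
  have [measurable]: "g \<in> borel_measurable \<nu>"
  proof -
    have "(\<lambda>z. J (max (max (- fst z) b) 0)) \<in> borel_measurable \<nu>"
      by (rule measurable_compose[OF _ J_measurable]) measurable
    moreover have "max (max v b) 0 = max v b" for v using b by simp
    ultimately show ?thesis by (simp add: g_def[abs_def])
  qed
  define \<kappa> where "\<kappa> = c\<^sup>2 / 8"
  have \<kappa>: "\<kappa> > 0" using c by (simp add: \<kappa>_def)
  have "p + 1 > 0" using p by simp
  from dyadic_exp_suminf_le[OF this \<kappa>]
  obtain K where K: "K \<ge> 0" "\<And>g. g \<ge> 1 \<Longrightarrow> (\<Sum>j. ennreal ((2 powr (p + 1)) ^ j * exp (- \<kappa> * 2 ^ j / g))) \<le> ennreal (K * g powr (p + 1))"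
    by blast
  define H where "H j = {\<omega>. \<exists>k. 2 ^ j \<le> k \<and> k < 2 * 2 ^ j \<and> rwalk k \<omega> \<le> a}" for j :: nat
  have H_sets [measurable]: "H j \<in> sets S" for j unfolding H_def by (intro Collect_sets_S) measurable
  have H_le: "emeasure S (H j) \<le> (\<integral>\<^sup>+z. ennreal (2 * exp 2 * (2 ^ j * exp (- \<kappa> * 2 ^ j / g z))) \<partial>\<nu>)" for j
  proof -
    have "emeasure S (H j) \<le> (\<integral>\<^sup>+z. ennreal (2 * real (2 ^ j) * exp 2 * exp (- (c\<^sup>2 / 8) * real (2 ^ j) / J (max (- fst z) b))) \<partial>\<nu>)"
      unfolding H_def by (rule block_le[OF c b(1,2)]) (use drift b in auto)
    then show ?thesis by (simp add: g_def \<kappa>_def mult_ac)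
  qed
  have "(\<integral>\<^sup>+\<omega>. ennreal_powr (Nrwalk a \<omega>) p \<partial>S)
      \<le> (\<integral>\<^sup>+\<omega>. 1 + ennreal (r\<^sup>2) * (\<Sum>j. ennreal (r ^ j) * indicator (H j) \<omega>) \<partial>S)"
  proof (rule nn_integral_mono_AE)
    show "AE \<omega> in S. ennreal_powr (Nrwalk a \<omega>) p \<le> 1 + ennreal (r\<^sup>2) * (\<Sum>j. ennreal (r ^ j) * indicator (H j) \<omega>)"
      using div
    proof eventually_elim
      case (elim \<omega>)
      then have "eventually (\<lambda>n. a < rwalk n \<omega>) sequentially" by (simp add: filterlim_at_top_dense)
      then obtain N where "\<And>n. n \<ge> N \<Longrightarrow> a < rwalk n \<omega>" by (auto simp: eventually_sequentially)
      then have "{n. rwalk n \<omega> \<le> a} \<subseteq> {..<N}" by (auto simp: not_le[symmetric])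
      then have "finite {n. rwalk n \<omega> \<le> a}" by (rule finite_subset) simp
      then have "Nrwalk a \<omega> < \<infinity>" by (simp add: Nrwalk_def of_nat_less_top)
      from powr_Nrwalk_le_blocks[OF p this]
      show ?case by (simp add: r_def H_def indicator_def)
    qed
  qed
  also have "\<dots> = 1 + ennreal (r\<^sup>2) * (\<integral>\<^sup>+\<omega>. (\<Sum>j. ennreal (r ^ j) * indicator (H j) \<omega>) \<partial>S)"
    by (simp add: nn_integral_add nn_integral_cmult P.emeasure_space_1[unfolded space_S])
  also have "(\<integral>\<^sup>+\<omega>. (\<Sum>j. ennreal (r ^ j) * indicator (H j) \<omega>) \<partial>S) = (\<Sum>j. ennreal (r ^ j) * emeasure S (H j))"
    by (subst nn_integral_suminf) (auto simp: nn_integral_cmult_indicator)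
  also have "\<dots> \<le> (\<Sum>j. ennreal (r ^ j) * (\<integral>\<^sup>+z. ennreal (2 * exp 2 * (2 ^ j * exp (- \<kappa> * 2 ^ j / g z))) \<partial>\<nu>))"
    by (intro suminf_le mult_left_mono H_le) auto
  also have "\<dots> = (\<Sum>j. \<integral>\<^sup>+z. ennreal (2 * exp 2) * ennreal ((2 powr (p + 1)) ^ j * exp (- \<kappa> * 2 ^ j / g z)) \<partial>\<nu>)"
  proof (rule suminf_cong)
    fix j
    have "ennreal (r ^ j) * (\<integral>\<^sup>+z. ennreal (2 * exp 2 * (2 ^ j * exp (- \<kappa> * 2 ^ j / g z))) \<partial>\<nu>)
        = (\<integral>\<^sup>+z. ennreal (r ^ j) * ennreal (2 * exp 2 * (2 ^ j * exp (- \<kappa> * 2 ^ j / g z))) \<partial>\<nu>)"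
      by (rule nn_integral_cmult[symmetric]) measurable
    also have "\<dots> = (\<integral>\<^sup>+z. ennreal (2 * exp 2) * ennreal ((2 powr (p + 1)) ^ j * exp (- \<kappa> * 2 ^ j / g z)) \<partial>\<nu>)"
      using r by (simp add: r2 power_mult_distrib mult_ac flip: ennreal_mult)
    finally show "ennreal (r ^ j) * (\<integral>\<^sup>+z. ennreal (2 * exp 2 * (2 ^ j * exp (- \<kappa> * 2 ^ j / g z))) \<partial>\<nu>)
        = (\<integral>\<^sup>+z. ennreal (2 * exp 2) * ennreal ((2 powr (p + 1)) ^ j * exp (- \<kappa> * 2 ^ j / g z)) \<partial>\<nu>)" .
  qed
  also have "\<dots> = (\<integral>\<^sup>+z. (\<Sum>j. ennreal (2 * exp 2) * ennreal ((2 powr (p + 1)) ^ j * exp (- \<kappa> * 2 ^ j / g z))) \<partial>\<nu>)"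
    by (rule nn_integral_suminf[symmetric]) measurable
  also have "\<dots> = (\<integral>\<^sup>+z. ennreal (2 * exp 2) * (\<Sum>j. ennreal ((2 powr (p + 1)) ^ j * exp (- \<kappa> * 2 ^ j / g z))) \<partial>\<nu>)"
    by simp
  also have "\<dots> \<le> (\<integral>\<^sup>+z. ennreal (2 * exp 2) * ennreal (K * g z powr (p + 1)) \<partial>\<nu>)"
    by (intro nn_integral_mono mult_left_mono K g1) simp
  also have "\<dots> \<le> (\<integral>\<^sup>+z. ennreal (2 * exp 2) * (ennreal K * (ennreal (G z powr (p + 1)) + ennreal (J b powr (p + 1)))) \<partial>\<nu>)"
  proof (intro nn_integral_mono mult_left_mono)
    fix z
    \<comment> \<open>\<open>g\<close> carries the lower level b: where the negative part is below b
      it equals the constant J b, elsewhere it is G z.\<close>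
    have "g z powr (p + 1) \<le> G z powr (p + 1) + J b powr (p + 1)"
    proof (cases "- fst z \<ge> b")
      case True
      then show ?thesis using b by (simp add: g_def G_def)
    next
      case False
      then show ?thesis by (simp add: g_def)
    qed
    then have "K * g z powr (p + 1) \<le> K * (G z powr (p + 1) + J b powr (p + 1))"
      using K by (intro mult_left_mono) auto
    then have "ennreal (K * g z powr (p + 1)) \<le> ennreal (K * (G z powr (p + 1) + J b powr (p + 1)))"
      by (rule ennreal_leI)
    also have "\<dots> = ennreal K * (ennreal (G z powr (p + 1)) + ennreal (J b powr (p + 1)))"
      using K by (simp add: ennreal_mult)
    finally show "ennreal (K * g z powr (p + 1)) \<le> ennreal K * (ennreal (G z powr (p + 1)) + ennreal (J b powr (p + 1)))" .
  qed simp
  also have "\<dots> = ennreal (2 * exp 2) * (ennreal K * ((\<integral>\<^sup>+z. ennreal (G z powr (p + 1)) \<partial>\<nu>) + ennreal (J b powr (p + 1))))"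
    by (simp add: nn_integral_cmult nn_integral_add M.emeasure_space_1[unfolded space_nu])
  finally have "(\<integral>\<^sup>+\<omega>. ennreal_powr (Nrwalk a \<omega>) p \<partial>S)
      \<le> 1 + ennreal (r\<^sup>2) * (ennreal (2 * exp 2) * (ennreal K * ((\<integral>\<^sup>+z. ennreal (G z powr (p + 1)) \<partial>\<nu>) + ennreal (J b powr (p + 1)))))"
    by (simp add: add_left_mono mult_left_mono)
  also have "\<dots> < \<infinity>" using G by (simp add: ennreal_mult_less_top)
  finally show ?thesis .
qed

end

section \<open>Transfer to the given probability space\<close>

context rw_space
begin

lemma fst_pos_of_divergent:
  assumes div: "AE \<omega> in S. filterlim (\<lambda>n. rwalk n \<omega>) at_top sequentially"
  shows "measure \<nu> {z. fst z > 0} > 0"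
proof (rule ccontr)
  assume "\<not> ?thesis"
  then have "measure \<nu> {z. fst z > 0} = 0" by (simp add: zero_less_measure_iff)
  moreover have "{z. fst z > 0} \<in> sets \<nu>"
    using measurable_sets[OF measurable_fst_nu, of "{0<..}"] by (simp add: vimage_def)
  ultimately have "AE z in \<nu>. \<not> fst z > 0" by (subst (asm) M.prob_eq_0) auto
  then have "AE \<omega> in S. \<not> fst (\<omega> i) > 0" for i
    by (rule AE_PiM_component[rotated 2]) (auto intro: M.prob_space_axioms)
  then have "AE \<omega> in S. \<forall>i. \<not> fst (\<omega> i) > 0" by (simp add: AE_all_countable)
  with div have "AE \<omega> in S. False"
  proof eventually_elim
    case (elim \<omega>)
    have "rwalk n \<omega> \<le> 0" for n
      unfolding rwalk_def using elim(2) by (intro sum_nonpos) (simp add: not_less)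
    moreover have "eventually (\<lambda>n. 0 < rwalk n \<omega>) sequentially"
      using elim(1) by (simp add: filterlim_at_top_dense)
    ultimately show ?case by (auto simp: eventually_sequentially not_le[symmetric])
  qed
  then show False by simp
qed

text \<open>The third claim produces some level y, possibly negative, and the fourth therefore
  starts from an arbitrary level. The last claim allows the integral of J to be transferred to the
  original space.\<close>

lemma moment_equivalences:
  assumes p: "p > 0"
    and div: "AE \<omega> in S. filterlim (\<lambda>n. prwalk n \<omega>) at_top sequentially"
  defines "J3 \<equiv> (\<integral>\<^sup>+z. ennreal (J_plus \<nu> fst (max (- fst z) 0) powr (p + 1)) \<partial>\<nu>) < \<infinity>"
  shows "J3 \<Longrightarrow> (\<integral>\<^sup>+\<omega>. ennreal_powr (Nrwalk a \<omega>) p \<partial>S) < \<infinity>"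
    and "(\<integral>\<^sup>+\<omega>. ennreal_powr (Nrwalk 0 \<omega>) p \<partial>S) < \<infinity> \<Longrightarrow>
           (\<integral>\<^sup>+\<omega>. ennreal_powr (Nprwalk x \<omega>) p \<partial>S) < \<infinity>"
    and "(\<integral>\<^sup>+\<omega>. ennreal_powr (Nprwalk x \<omega>) p \<partial>S) < \<infinity> \<Longrightarrow>
           \<exists>y. (\<integral>\<^sup>+\<omega>. ennreal_powr (Nrwalk y \<omega>) p \<partial>S) < \<infinity>"
    and "(\<integral>\<^sup>+\<omega>. ennreal_powr (Nrwalk a \<omega>) p \<partial>S) < \<infinity> \<Longrightarrow> J3"
    and "(\<lambda>z. ennreal (J_plus \<nu> fst (max (- fst z) 0) powr (p + 1))) \<in> borel_measurable \<nu>"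
proof -
  note rdiv = rwalk_divergent[OF div]
  interpret rw_space_pos \<nu>
    by unfold_locales (rule fst_pos_of_divergent[OF rdiv])
  have J3: "J3 \<longleftrightarrow> (\<integral>\<^sup>+z. ennreal (G z powr (p + 1)) \<partial>\<nu>) < \<infinity>"
    by (simp add: J3_def G_def)
  have r: "2 powr p \<ge> 1" "2 powr p > 0" using p by (auto intro: ge_one_powr_ge_zero)
  have iff: "(\<integral>\<^sup>+\<omega>. ennreal_powr (Z \<omega>) p \<partial>S) < \<infinity> \<longleftrightarrow>
      summable (\<lambda>i. (2 powr p) ^ i * measure S {\<omega>. 2 ^ i \<le> Z \<omega>})" if "Z \<in> borel_measurable S" for Z
    using P.powr_moment_finite_iff[OF that p] by simp
  show "J3 \<Longrightarrow> (\<integral>\<^sup>+\<omega>. ennreal_powr (Nrwalk a \<omega>) p \<partial>S) < \<infinity>"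
    unfolding J3 by (rule Nrwalk_moment_of_G_moment[OF p rdiv])
  show "(\<integral>\<^sup>+\<omega>. ennreal_powr (Nrwalk 0 \<omega>) p \<partial>S) < \<infinity> \<Longrightarrow>
           (\<integral>\<^sup>+\<omega>. ennreal_powr (Nprwalk x \<omega>) p \<partial>S) < \<infinity>"
    unfolding iff[OF Nrwalk_measurable] iff[OF Nprwalk_measurable]
    by (rule summable_Nprwalk_of_Nrwalk[OF div r(2)])
  show "(\<integral>\<^sup>+\<omega>. ennreal_powr (Nprwalk x \<omega>) p \<partial>S) < \<infinity> \<Longrightarrow>
           \<exists>y. (\<integral>\<^sup>+\<omega>. ennreal_powr (Nrwalk y \<omega>) p \<partial>S) < \<infinity>"
    unfolding iff[OF Nrwalk_measurable] iff[OF Nprwalk_measurable]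
    by (rule summable_Nrwalk_of_Nprwalk[OF r(2)])
  show "(\<integral>\<^sup>+\<omega>. ennreal_powr (Nrwalk a \<omega>) p \<partial>S) < \<infinity> \<Longrightarrow> J3"
  proof -
    assume "(\<integral>\<^sup>+\<omega>. ennreal_powr (Nrwalk a \<omega>) p \<partial>S) < \<infinity>"
    then have "summable (\<lambda>i. (2 * 2 powr p) ^ i * measure \<nu> {z. 2 ^ i \<le> ennreal (G z)})"
      unfolding iff[OF Nrwalk_measurable] by (rule summable_G_of_Nrwalk[OF r(1)])
    then have "summable (\<lambda>i. (2 powr (p + 1)) ^ i * measure \<nu> {z\<in>space \<nu>. 2 ^ i \<le> ennreal (G z)})"
      by (simp add: powr_add mult.commute)
    then have "(\<integral>\<^sup>+z. ennreal_powr (ennreal (G z)) (p + 1) \<partial>\<nu>) < \<infinity>"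
      using p by (subst M.powr_moment_finite_iff) auto
    moreover have "ennreal_powr (ennreal (G z)) (p + 1) = ennreal (G z powr (p + 1))" for z
      using G_ge_1[of z] by (intro ennreal_powr_ennreal) simp
    ultimately show J3 unfolding J3 by simp
  qed
  have "(\<lambda>z. ennreal (G z powr (p + 1))) \<in> borel_measurable \<nu>" by measurable
  then show "(\<lambda>z. ennreal (J_plus \<nu> fst (max (- fst z) 0) powr (p + 1))) \<in> borel_measurable \<nu>"
    by (simp add: G_def)
qed

lemma pred_filterlim_prwalk:
  "Measurable.pred S (\<lambda>\<omega>. filterlim (\<lambda>n. prwalk n \<omega>) at_top sequentially)"
proof -
  have "filterlim (\<lambda>n. prwalk n \<omega>) at_top sequentially \<longleftrightarrow> (\<forall>c::nat. \<exists>N. \<forall>n\<ge>N. real c < prwalk n \<omega>)" for \<omega>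
  proof
    assume "filterlim (\<lambda>n. prwalk n \<omega>) at_top sequentially"
    then show "\<forall>c::nat. \<exists>N. \<forall>n\<ge>N. real c < prwalk n \<omega>"
      by (simp add: filterlim_at_top_dense eventually_sequentially)
  next
    assume *: "\<forall>c::nat. \<exists>N. \<forall>n\<ge>N. real c < prwalk n \<omega>"
    show "filterlim (\<lambda>n. prwalk n \<omega>) at_top sequentially"
      unfolding filterlim_at_top eventually_sequentially
    proof
      fix Z :: real
      obtain c :: nat where "Z \<le> real c" using real_arch_simple by blast
      then show "\<exists>N. \<forall>n\<ge>N. Z \<le> prwalk n \<omega>" using * by (meson less_imp_le order_trans)
    qed
  qed
  then show ?thesis by simp
qed

end

lemma count_image_Suc: "emeasure (count_space UNIV) (Suc ` B) = emeasure (count_space UNIV) B"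
  by (simp add: emeasure_count_space finite_image_iff card_image)

context perturbed_random_walk
begin

text \<open>Index 0 of the given sequences is the generic copy, so the canonical sequence starts
  with index 1.\<close>

definition steps :: "'a \<Rightarrow> nat \<Rightarrow> real \<times> real" where
  "steps \<omega> n = (\<xi> (Suc n) \<omega>, \<eta> (Suc n) \<omega>)"

definition law :: "(real \<times> real) measure" where
  "law = distr M borel (\<lambda>\<omega>. (\<xi> 0 \<omega>, \<eta> 0 \<omega>))"

lemma pair_measurable: "(\<lambda>\<omega>. (\<xi> n \<omega>, \<eta> n \<omega>)) \<in> borel_measurable M"
  using indep by (auto simp: indep_vars_def)

lemma rw_space_law: "rw_space law"
proof -
  interpret law: prob_space law unfolding law_def by (rule prob_space_distr) (rule pair_measurable)
  show ?thesis
    by (intro rw_space.intro sequence_space.intro rw_space_axioms.intro product_prob_spaceI law.prob_space_axioms)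
      (simp add: law_def)
qed

lemma steps_measurable: "steps \<in> measurable M (\<Pi>\<^sub>M n\<in>UNIV. law)"
  by (rule measurable_PiM_single') (auto simp: steps_def[abs_def] law_def pair_measurable space_PiM)

text \<open>Independence over all indices says that the joint law is a product measure, with equal
  factors by \<open>ident\<close>; dropping the generic copy is the reindexing by
  \<open>Suc\<close>.\<close>

lemma distr_steps: "distr M (\<Pi>\<^sub>M n\<in>UNIV. law) steps = (\<Pi>\<^sub>M n\<in>UNIV. law)"
proof -
  interpret L: rw_space law by (rule rw_space_law)
  define Y where "Y \<omega> n = (\<xi> n \<omega>, \<eta> n \<omega>)" for \<omega> n
  have Y: "Y \<in> measurable M L.S"
    by (rule measurable_PiM_single') (auto simp: Y_def[abs_def] law_def pair_measurable space_PiM)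
  have "distr M (\<Pi>\<^sub>M n\<in>UNIV. borel) (\<lambda>\<omega>. \<lambda>n\<in>UNIV. (\<xi> n \<omega>, \<eta> n \<omega>))
      = (\<Pi>\<^sub>M n\<in>UNIV. distr M borel (\<lambda>\<omega>. (\<xi> n \<omega>, \<eta> n \<omega>)))"
    using indep by (subst (asm) indep_vars_iff_distr_eq_PiM) (auto simp: pair_measurable)
  moreover have "distr M borel (\<lambda>\<omega>. (\<xi> n \<omega>, \<eta> n \<omega>)) = law" for n
    unfolding law_def by (rule ident)
  moreover have "distr M (\<Pi>\<^sub>M n\<in>UNIV. borel) (\<lambda>\<omega>. \<lambda>n\<in>UNIV. (\<xi> n \<omega>, \<eta> n \<omega>)) = distr M L.S Y"
    by (rule distr_cong) (auto intro!: sets_PiM_cong simp: law_def Y_def)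
  ultimately have "distr M L.S Y = L.S" by simp
  moreover have "distr M L.S steps = distr (distr M L.S Y) L.S (\<lambda>\<omega> i. \<omega> (Suc i))"
    by (subst distr_distr[OF L.measurable_reindex Y]) (simp add: o_def Y_def steps_def[abs_def])
  ultimately show ?thesis by (simp add: L.distr_reindex)
qed

lemma nn_integral_steps:
  "f \<in> borel_measurable (\<Pi>\<^sub>M n\<in>UNIV. law) \<Longrightarrow> (\<integral>\<^sup>+\<omega>. f (steps \<omega>) \<partial>M) = (\<integral>\<^sup>+\<omega>. f \<omega> \<partial>(\<Pi>\<^sub>M n\<in>UNIV. law))"
  using nn_integral_distr[OF steps_measurable, of f] by (simp add: distr_steps)

lemma rwalk_steps: "rwalk n (steps \<omega>) = walk \<xi> n \<omega>"
  by (simp add: rwalk_def walk_def steps_def sum.atLeast1_atMost_eq)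

lemma prwalk_steps: "prwalk n (steps \<omega>) = pwalk \<xi> \<eta> (Suc n) \<omega>"
  by (simp add: prwalk_def pwalk_def rwalk_steps) (simp add: steps_def)

lemma Nrwalk_steps: "Nrwalk a (steps \<omega>) = N_walk \<xi> a \<omega>"
  by (simp add: Nrwalk_def N_walk_def rwalk_steps)

lemma Nprwalk_steps: "Nprwalk a (steps \<omega>) = N_pwalk \<xi> \<eta> a \<omega>"
proof -
  have "{n. n \<ge> 1 \<and> pwalk \<xi> \<eta> n \<omega> \<le> a} = Suc ` {n. prwalk n (steps \<omega>) \<le> a}"
  proof (intro set_eqI iffI)
    fix n assume "n \<in> {n. n \<ge> 1 \<and> pwalk \<xi> \<eta> n \<omega> \<le> a}"
    then show "n \<in> Suc ` {n. prwalk n (steps \<omega>) \<le> a}" by (cases n) (auto simp: prwalk_steps)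
  qed (auto simp: prwalk_steps)
  then show ?thesis by (simp add: Nprwalk_def N_pwalk_def count_image_Suc)
qed

lemma J_plus_law: "J_plus law fst x = J_plus M (\<xi> 0) x"
proof -
  have *: "measure law {z \<in> space law. fst z > y} = measure M {\<omega> \<in> space M. \<xi> 0 \<omega> > y}" for y
  proof -
    have "fst -` {y<..} \<in> sets (borel :: (real \<times> real) measure)"
      using measurable_sets[of fst "borel :: (real \<times> real) measure" borel "{y<..}"]
      by (simp add: borel_measurable_continuous_onI continuous_on_fst)
    then have "{z \<in> space law. fst z > y} \<in> sets borel" by (simp add: law_def vimage_def)
    then show ?thesis
      unfolding law_def by (subst measure_distr[OF pair_measurable]) (auto intro!: arg_cong[where f=prob])
  qed
  show ?thesis unfolding J_plus_def A_plus_def * ..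
qed

end

theorem theorem2p9:
  fixes M :: "'a measure" and \<xi> \<eta> :: "nat \<Rightarrow> 'a \<Rightarrow> real" and p :: real
  assumes "perturbed_random_walk M \<xi> \<eta>"
    and "positively_divergent M \<xi> \<eta>"
    and "p > 0"
  shows "((\<exists>x::real. (\<integral>\<^sup>+\<omega>. ennreal_powr (N_pwalk \<xi> \<eta> x \<omega>) p \<partial>M) < \<infinity>) \<longleftrightarrow>
          (\<forall>x::real. (\<integral>\<^sup>+\<omega>. ennreal_powr (N_pwalk \<xi> \<eta> x \<omega>) p \<partial>M) < \<infinity>)) \<and>
         ((\<forall>x::real. (\<integral>\<^sup>+\<omega>. ennreal_powr (N_pwalk \<xi> \<eta> x \<omega>) p \<partial>M) < \<infinity>) \<longleftrightarrow>
          (\<exists>x\<ge>0. (\<integral>\<^sup>+\<omega>. ennreal_powr (N_walk \<xi> x \<omega>) p \<partial>M) < \<infinity>)) \<and>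
         ((\<exists>x\<ge>0. (\<integral>\<^sup>+\<omega>. ennreal_powr (N_walk \<xi> x \<omega>) p \<partial>M) < \<infinity>) \<longleftrightarrow>
          (\<forall>x\<ge>0. (\<integral>\<^sup>+\<omega>. ennreal_powr (N_walk \<xi> x \<omega>) p \<partial>M) < \<infinity>)) \<and>
         ((\<forall>x\<ge>0. (\<integral>\<^sup>+\<omega>. ennreal_powr (N_walk \<xi> x \<omega>) p \<partial>M) < \<infinity>) \<longleftrightarrow>
          (\<integral>\<^sup>+\<omega>. ennreal (J_plus M (\<xi> 0) (max (- \<xi> 0 \<omega>) 0) powr (p + 1)) \<partial>M) < \<infinity>)"
proof -
  interpret perturbed_random_walk M \<xi> \<eta> by fact
  interpret L: rw_space law by (rule rw_space_law)
  have div: "AE \<omega> in L.S. filterlim (\<lambda>n. prwalk n \<omega>) at_top sequentially"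
  proof -
    have sets: "{\<omega> \<in> space L.S. filterlim (\<lambda>n. prwalk n \<omega>) at_top sequentially} \<in> sets L.S"
      using L.pred_filterlim_prwalk by (simp add: pred_def)
    have "AE \<omega> in M. filterlim (\<lambda>n. prwalk n (steps \<omega>)) at_top sequentially"
      using assms(2) unfolding positively_divergent_def prwalk_steps
    proof eventually_elim
      case (elim \<omega>)
      then show ?case using filterlim_sequentially_Suc[of "\<lambda>n. pwalk \<xi> \<eta> n \<omega>"] by blast
    qed
    then have "AE \<omega> in distr M L.S steps. filterlim (\<lambda>n. prwalk n \<omega>) at_top sequentially"
      by (subst AE_distr_iff[OF steps_measurable sets])
    then show ?thesis by (simp only: distr_steps)
  qed
  note eq = L.moment_equivalences[OF \<open>p > 0\<close> div]
  have N: "(\<integral>\<^sup>+\<omega>. ennreal_powr (Nrwalk a \<omega>) p \<partial>L.S) = (\<integral>\<^sup>+\<omega>. ennreal_powr (N_walk \<xi> a \<omega>) p \<partial>M)" for a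
    by (subst nn_integral_steps[symmetric]) (simp_all add: Nrwalk_steps)
  have Np: "(\<integral>\<^sup>+\<omega>. ennreal_powr (Nprwalk a \<omega>) p \<partial>L.S) = (\<integral>\<^sup>+\<omega>. ennreal_powr (N_pwalk \<xi> \<eta> a \<omega>) p \<partial>M)" for a
    by (subst nn_integral_steps[symmetric]) (simp_all add: Nprwalk_steps)
  have J: "(\<integral>\<^sup>+z. ennreal (J_plus law fst (max (- fst z) 0) powr (p + 1)) \<partial>law)
      = (\<integral>\<^sup>+\<omega>. ennreal (J_plus M (\<xi> 0) (max (- \<xi> 0 \<omega>) 0) powr (p + 1)) \<partial>M)"
    using nn_integral_distr[OF pair_measurable[of 0], folded law_def, OF eq(5)] by (simp add: J_plus_law)
  note eq' = eq(1-4)[unfolded N Np J]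
  \<comment> \<open>The implications form a cycle: T at some level, S at some level, J_+, S at every
    level and so at 0, T at every level.\<close>
  show ?thesis using eq' by (meson order_refl)
qed

end
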